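(* Let $E$ be a vector bundle over a manifold $M$ and let $B=([\cdot,\cdot],\rho)$ be an anchored faint algebroid structure on $E$. Then the Loday operator $\partial_B$ is a degree $1$ graded derivation of the shuffle algebra $(\mathcal{D}^\bullet(E),\pitchfork)$, i.e. $$\partial_B(\ell'\pitchfork\ell'')=(\partial_B\ell')\pitchfork\ell''+(-1)^p\,\ell'\pitchfork(\partial_B\ell'')$$ for any $\ell'\in\mathcal{D}^p(E)$ and $\ell''\in\mathcal{D}^q(E)$. Moreover, if $[\cdot,\cdot]$ is a pseudoalgebra bracket with left anchor $\rho$, i.e., if $[\cdot,\cdot]$ is of total order $\le1$ and $[X,fY]=f[X,Y]+\rho(X)(f)Y$ for all $X,Y\in\mathrm{Sec}(E)$, $f\in C^\infty(M)$, then $\partial_B$ leaves invariant the reduced shuffle algebra $\mathsf{D}^\bullet(E)\subset\mathcal{D}^\bullet(E)$.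
   Context: All manifolds, bundles and sections are smooth; $\mathcal{A}=C^\infty(M)$, $\mathrm{Sec}(E)$ is the space of sections of $E$. Multidifferential operators. For an $\mathbb{R}$-multilinear map $D$ in $p$ arguments from $\mathrm{Sec}(E)$ (with values in $\mathrm{Sec}(E)$ or $\mathcal{A}$), put $(\delta_i(f)D)(X_1,\dots,X_p)=D(X_1,\dots,fX_i,\dots,X_p)-fD(X_1,\dots,X_p)$. $D$ is a differential operator of order $\le k$ in the $i$-th variable if $\delta_i(f_1)\cdots\delta_i(f_{k+1})D=0$ for all $f_1,\dots,f_{k+1}\in\mathcal{A}$; it is multidifferential (bidifferential if $p=2$) if, for some $k$, it is of order $\le k$ in each variable; it is of total order (degree) $\le k$ if $\delta_{i_1}(f_1)\cdots\delta_{i_{k+1}}(f_{k+1})D=0$ for all $f_j\in\mathcal{A}$ and all indices $i_1,\dots,i_{k+1}\in\{1,\dots,p\}$. An anchored faint algebroid structure on $E$ is a pair $B=([\cdot,\cdot],\rho)$ where $[\cdot,\cdot]$ is an $\mathbb{R}$-bilinear bidifferential operator $\mathrm{Sec}(E)\times\mathrm{Sec}(E)\to\mathrm{Sec}(E)$ and $\rho:E\to TM$ is a vector bundle morphism covering the identity, inducing $\rho:\mathrm{Sec}(E)\to\mathrm{Der}(C^\infty(M))$. Shuffle algebras. $\mathcal{D}^p(E)$ is the space of $p$-linear multidifferential operators $\mathrm{Sec}(E)^{\times p}\to C^\infty(M)$, $\mathcal{D}^0(E)=C^\infty(M)$, $\mathcal{D}^\bullet(E)=\bigoplus_{p\ge0}\mathcal{D}^p(E)$.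 For $\ell'\in\mathcal{D}^p(E)$, $\ell''\in\mathcal{D}^q(E)$, $$(\ell'\pitchfork\ell'')(X_1,\dots,X_{p+q})=\sum_{\sigma\in\mathrm{sh}(p,q)}\mathrm{sign}(\sigma)\,\ell'(X_{\sigma_1},\dots,X_{\sigma_p})\,\ell''(X_{\sigma_{p+1}},\dots,X_{\sigma_{p+q}}),$$ where $\mathrm{sh}(p,q)$ is the set of permutations of $\{1,\dots,p+q\}$ with $\sigma_1<\dots<\sigma_p$ and $\sigma_{p+1}<\dots<\sigma_{p+q}$. $(\mathcal{D}^\bullet(E),\pitchfork)$ is a graded commutative associative unital $\mathbb{R}$-algebra, the shuffle algebra of $E$. For $k\ge1$, $\mathsf{D}^k(E)\subset\mathcal{D}^k(E)$ consists of the operators of order $0$ in the last variable and of total order $\le k-1$; $\mathsf{D}^0(E)=C^\infty(M)$. $\mathsf{D}^\bullet(E)=\bigoplus_{k\ge0}\mathsf{D}^k(E)$ is a subalgebra, the reduced shuffle algebra. The Loday operator $\partial_B:\mathcal{D}^p(E)\to\mathcal{D}^{p+1}(E)$ associated with $B=([\cdot,\cdot],\rho)$ is $$(\partial_Bc)(X_1,\dots,X_{p+1})=\sum_{i=1}^{p+1}(-1)^{i+1}\rho(X_i)\big(c(X_1,\dots\hat{\imath}\dots,X_{p+1})\big)+\sum_{i<j}(-1)^i\,c(X_1,\dots\hat{\imath}\dots,[X_i,X_j],\dots,X_{p+1}),$$ where $\hat{\imath}$ means that $X_i$ is omitted and $[X_i,X_j]$ replaces $X_j$ in its place. *)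

theory Defs
  imports "HOL-Analysis.Analysis"
begin

section \<open>Model spaces\<close>

text \<open>Model spaces of manifolds and standard fibres of bundles are finite-dimensional real normed
  spaces. The class of Euclidean spaces of the library excludes dimension zero; here the type
  unit serves as the zero-dimensional space.\<close>

instantiation unit :: real_normed_vector
begin

definition zero_unit :: unit where "zero_unit = ()"
definition plus_unit :: "unit \<Rightarrow> unit \<Rightarrow> unit" where "plus_unit a b = ()"
definition scaleR_unit :: "real \<Rightarrow> unit \<Rightarrow> unit" where "scaleR_unit r a = ()"
definition norm_unit :: "unit \<Rightarrow> real" where "norm_unit a = 0"
definition sgn_unit :: "unit \<Rightarrow> unit" where "sgn_unit a = ()"
definition dist_unit :: "unit \<Rightarrow> unit \<Rightarrow> real" where "dist_unit a b = 0"
definition uniformity_unit :: "(unit \<times> unit) filter" where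
  "uniformity_unit = (INF e\<in>{0<..}. principal {(x, y). dist x y < e})"
definition open_unit :: "unit set \<Rightarrow> bool" where
  "open_unit U \<longleftrightarrow> (\<forall>x\<in>U. eventually (\<lambda>(x', y). x' = x \<longrightarrow> y \<in> U) uniformity)"

instance
  by standard (simp_all add: norm_unit_def dist_unit_def uniformity_unit_def open_unit_def)

end

definition finite_dimensional :: "'a::real_vector itself \<Rightarrow> bool" where
  "finite_dimensional (_ :: 'a itself) \<longleftrightarrow> (\<exists>B :: 'a set. finite B \<and> span B = UNIV)"

section \<open>Smooth maps between open sets\<close>

primrec Ck_on :: "nat \<Rightarrow> 'a::real_normed_vector set \<Rightarrow> ('a \<Rightarrow> 'b::real_normed_vector) \<Rightarrow> bool" where
  "Ck_on 0 S f \<longleftrightarrow> continuous_on S f"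
| "Ck_on (Suc k) S f \<longleftrightarrow> (\<forall>x\<in>S. f differentiable (at x)) \<and>
     (\<forall>v. Ck_on k S (\<lambda>x. frechet_derivative f (at x) v))"

definition smooth_on :: "'a::real_normed_vector set \<Rightarrow> ('a \<Rightarrow> 'b::real_normed_vector) \<Rightarrow> bool" where
  "smooth_on S f \<longleftrightarrow> (\<forall>k. Ck_on k S f)"

section \<open>Smooth manifolds\<close>

text \<open>The manifold is a whole Hausdorff second-countable topological type; its smooth structure is
  given by an atlas, a set of pairs of a chart domain and a coordinate map.\<close>

type_synonym ('m, 'b) chart = "'m set \<times> ('m \<Rightarrow> 'b)"

definition smooth_manifold ::
    "('m::{t2_space, second_countable_topology}, 'b::real_normed_vector) chart set \<Rightarrow> bool" where
  "smooth_manifold At \<longleftrightarrow>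
     finite_dimensional TYPE('b) \<and>
     (\<Union>(U, \<phi>)\<in>At. U) = UNIV \<and>
     (\<forall>(U, \<phi>)\<in>At. open U \<and> open (\<phi> ` U) \<and> homeomorphism U (\<phi> ` U) \<phi> (inv_into U \<phi>)) \<and>
     (\<forall>(U, \<phi>)\<in>At. \<forall>(V, \<psi>)\<in>At. smooth_on (\<phi> ` (U \<inter> V)) (\<psi> \<circ> inv_into U \<phi>))"

definition smooth_functions :: "('m, 'b::real_normed_vector) chart set \<Rightarrow> ('m \<Rightarrow> real) set" where
  "smooth_functions At = {f. \<forall>(U, \<phi>)\<in>At. smooth_on (\<phi> ` U) (f \<circ> inv_into U \<phi>)}"

section \<open>Vector bundles\<close>

text \<open>A local trivialization over U is stored as a pair of U and the fibre component \<Phi> of the map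
  sending e to (proj e, \<Phi> e). The smooth structure of the total space is the one for which the maps
  (\<phi> \<circ> proj, \<Phi>), with \<phi> a chart of the base, are charts. The axioms make each \<Phi> a bijection from
  the fibre onto the standard fibre that respects the operations, so every fibre is a real vector
  space and \<Phi> is a linear isomorphism on it.\<close>

record ('m, 'e, 'f) vbundle =
  total :: "'e set"
  proj :: "'e \<Rightarrow> 'm"
  vzero :: "'m \<Rightarrow> 'e"
  vadd :: "'e \<Rightarrow> 'e \<Rightarrow> 'e"
  vscale :: "real \<Rightarrow> 'e \<Rightarrow> 'e"
  trivs :: "('m set \<times> ('e \<Rightarrow> 'f)) set"

definition fibre :: "('m, 'e, 'f) vbundle \<Rightarrow> 'm \<Rightarrow> 'e set" where
  "fibre E x = {e \<in> total E. proj E e = x}"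

definition vector_bundle ::
    "('m::topological_space, 'b::real_normed_vector) chart set \<Rightarrow>
     ('m, 'e, 'f::real_normed_vector) vbundle \<Rightarrow> bool" where
  "vector_bundle At E \<longleftrightarrow>
     finite_dimensional TYPE('f) \<and>
     (\<forall>x. vzero E x \<in> fibre E x) \<and>
     (\<forall>x. \<forall>u\<in>fibre E x. \<forall>v\<in>fibre E x. vadd E u v \<in> fibre E x) \<and>
     (\<forall>x. \<forall>r. \<forall>u\<in>fibre E x. vscale E r u \<in> fibre E x) \<and>
     (\<Union>(U, \<Phi>)\<in>trivs E. U) = UNIV \<and>
     (\<forall>(U, \<Phi>)\<in>trivs E. open U \<and>
        (\<forall>x\<in>U. bij_betw \<Phi> (fibre E x) UNIV \<and>
           \<Phi> (vzero E x) = 0 \<and>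
           (\<forall>u\<in>fibre E x. \<forall>v\<in>fibre E x. \<Phi> (vadd E u v) = \<Phi> u + \<Phi> v) \<and>
           (\<forall>r. \<forall>u\<in>fibre E x. \<Phi> (vscale E r u) = r *\<^sub>R \<Phi> u))) \<and>
     (\<forall>(W, \<phi>)\<in>At. \<forall>(U, \<Phi>)\<in>trivs E. \<forall>(V, \<Psi>)\<in>trivs E.
        smooth_on (\<phi> ` (W \<inter> U \<inter> V) \<times> UNIV)
          (\<lambda>(y, a). \<Psi> (inv_into (fibre E (inv_into W \<phi> y)) \<Phi> a)))"

definition sections ::
    "('m, 'b::real_normed_vector) chart set \<Rightarrow> ('m, 'e, 'f::real_normed_vector) vbundle \<Rightarrow>
     ('m \<Rightarrow> 'e) set" where
  "sections At E = {X. (\<forall>x. X x \<in> fibre E x) \<and>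
     (\<forall>(W, \<phi>)\<in>At. \<forall>(U, \<Phi>)\<in>trivs E. smooth_on (\<phi> ` (W \<inter> U)) (\<lambda>y. \<Phi> (X (inv_into W \<phi> y))))}"

text \<open>Vector bundle morphisms covering the identity.\<close>

definition bundle_morphism ::
    "('m, 'b::real_normed_vector) chart set \<Rightarrow> ('m, 'e, 'f::real_normed_vector) vbundle \<Rightarrow>
     ('m, 'e2, 'f2::real_normed_vector) vbundle \<Rightarrow> ('e \<Rightarrow> 'e2) \<Rightarrow> bool" where
  "bundle_morphism At E E' \<rho> \<longleftrightarrow>
     (\<forall>x. \<forall>u\<in>fibre E x. \<rho> u \<in> fibre E' x) \<and>
     (\<forall>x. \<forall>u\<in>fibre E x. \<forall>v\<in>fibre E x. \<rho> (vadd E u v) = vadd E' (\<rho> u) (\<rho> v)) \<and>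
     (\<forall>x. \<forall>r. \<forall>u\<in>fibre E x. \<rho> (vscale E r u) = vscale E' r (\<rho> u)) \<and>
     (\<forall>(W, \<phi>)\<in>At. \<forall>(U, \<Phi>)\<in>trivs E. \<forall>(V, \<Psi>)\<in>trivs E'.
        smooth_on (\<phi> ` (W \<inter> U \<inter> V) \<times> UNIV)
          (\<lambda>(y, a). \<Psi> (\<rho> (inv_into (fibre E (inv_into W \<phi> y)) \<Phi> a))))"

section \<open>The tangent bundle\<close>

text \<open>A tangent vector at x is a family of coordinate vectors, one for each chart around x, that
  transform into each other by the derivatives of the coordinate changes. The family is set to
  zero at all other indices.\<close>

type_synonym ('m, 'b) tvector = "'m \<times> (('m, 'b) chart \<Rightarrow> 'b)"

definition tangent_bundle ::
    "('m, 'b::real_normed_vector) chart set \<Rightarrow> ('m, ('m, 'b) tvector, 'b) vbundle" where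
  "tangent_bundle At = \<lparr>
     total = {(x, v).
       (\<forall>(U, \<phi>)\<in>At. \<forall>(V, \<psi>)\<in>At. x \<in> U \<inter> V \<longrightarrow>
          v (V, \<psi>) = frechet_derivative (\<psi> \<circ> inv_into U \<phi>) (at (\<phi> x)) (v (U, \<phi>))) \<and>
       (\<forall>c. \<not> (c \<in> At \<and> x \<in> fst c) \<longrightarrow> v c = 0)},
     proj = fst,
     vzero = (\<lambda>x. (x, \<lambda>c. 0)),
     vadd = (\<lambda>(x, v) (y, w). (x, \<lambda>c. v c + w c)),
     vscale = (\<lambda>r (x, v). (x, \<lambda>c. r *\<^sub>R v c)),
     trivs = (\<lambda>(U, \<phi>). (U, \<lambda>(x, v). v (U, \<phi>))) ` At \<rparr>"

text \<open>The derivative of a function along a tangent vector; by the chain rule the choice of the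
  chart is irrelevant.\<close>

definition tangent_apply ::
    "('m, 'b::real_normed_vector) chart set \<Rightarrow> ('m, 'b) tvector \<Rightarrow> ('m \<Rightarrow> real) \<Rightarrow> real" where
  "tangent_apply At xv f = (case xv of (x, v) \<Rightarrow>
     (case (SOME c. c \<in> At \<and> x \<in> fst c) of (U, \<phi>) \<Rightarrow>
        frechet_derivative (f \<circ> inv_into U \<phi>) (at (\<phi> x)) (v (U, \<phi>))))"

definition anchor_action ::
    "('m, 'b::real_normed_vector) chart set \<Rightarrow> ('e \<Rightarrow> ('m, 'b) tvector) \<Rightarrow>
     ('m \<Rightarrow> 'e) \<Rightarrow> ('m \<Rightarrow> real) \<Rightarrow> ('m \<Rightarrow> real)" where
  "anchor_action At \<rho> X f = (\<lambda>x. tangent_apply At (\<rho> (X x)) f)"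

section \<open>Multidifferential operators\<close>

text \<open>The operations of a module over the smooth functions, used for both possible targets of
  multidifferential operators: sections and functions.\<close>

record ('m, 'v) fmodule =
  mcarrier :: "'v set"
  mzero :: 'v
  madd :: "'v \<Rightarrow> 'v \<Rightarrow> 'v"
  mscale :: "('m \<Rightarrow> real) \<Rightarrow> 'v \<Rightarrow> 'v"

definition section_module ::
    "('m, 'b::real_normed_vector) chart set \<Rightarrow> ('m, 'e, 'f::real_normed_vector) vbundle \<Rightarrow>
     ('m, 'm \<Rightarrow> 'e) fmodule" where
  "section_module At E = \<lparr>
     mcarrier = sections At E,
     mzero = vzero E,
     madd = (\<lambda>X Y x. vadd E (X x) (Y x)),
     mscale = (\<lambda>f X x. vscale E (f x) (X x)) \<rparr>"

definition function_module ::
    "('m, 'b::real_normed_vector) chart set \<Rightarrow> ('m, 'm \<Rightarrow> real) fmodule" where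
  "function_module At = \<lparr>
     mcarrier = smooth_functions At,
     mzero = (\<lambda>x. 0),
     madd = (\<lambda>f g x. f x + g x),
     mscale = (\<lambda>f g x. f x * g x) \<rparr>"

definition mdiff :: "('m, 'v) fmodule \<Rightarrow> 'v \<Rightarrow> 'v \<Rightarrow> 'v" where
  "mdiff N a b = madd N a (mscale N (\<lambda>x. - 1) b)"

text \<open>An operator in p arguments is a function on lists of length p; the arguments are numbered
  from 0 to p - 1.\<close>

definition arg_lists :: "('m, 'v) fmodule \<Rightarrow> nat \<Rightarrow> 'v list set" where
  "arg_lists S p = {Xs. length Xs = p \<and> set Xs \<subseteq> mcarrier S}"

definition multilinear ::
    "('m, 'v) fmodule \<Rightarrow> ('m, 'w) fmodule \<Rightarrow> nat \<Rightarrow> ('v list \<Rightarrow> 'w) \<Rightarrow> bool" where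
  "multilinear S N p D \<longleftrightarrow>
     (\<forall>Xs\<in>arg_lists S p. D Xs \<in> mcarrier N) \<and>
     (\<forall>Xs\<in>arg_lists S p. \<forall>i<p. \<forall>Y\<in>mcarrier S.
        D (Xs[i := madd S (Xs ! i) Y]) = madd N (D Xs) (D (Xs[i := Y]))) \<and>
     (\<forall>Xs\<in>arg_lists S p. \<forall>i<p. \<forall>r::real.
        D (Xs[i := mscale S (\<lambda>x. r) (Xs ! i)]) = mscale N (\<lambda>x. r) (D Xs))"

definition delta ::
    "('m, 'v) fmodule \<Rightarrow> ('m, 'w) fmodule \<Rightarrow> nat \<Rightarrow> ('m \<Rightarrow> real) \<Rightarrow>
     ('v list \<Rightarrow> 'w) \<Rightarrow> ('v list \<Rightarrow> 'w)" where
  "delta S N i f D = (\<lambda>Xs. mdiff N (D (Xs[i := mscale S f (Xs ! i)])) (mscale N f (D Xs)))"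

definition order_le ::
    "('m, 'b::real_normed_vector) chart set \<Rightarrow> ('m, 'v) fmodule \<Rightarrow> ('m, 'w) fmodule \<Rightarrow>
     nat \<Rightarrow> nat \<Rightarrow> nat \<Rightarrow> ('v list \<Rightarrow> 'w) \<Rightarrow> bool" where
  "order_le At S N p i k D \<longleftrightarrow>
     (\<forall>fs. length fs = k + 1 \<and> set fs \<subseteq> smooth_functions At \<longrightarrow>
        (\<forall>Xs\<in>arg_lists S p. foldr (delta S N i) fs D Xs = mzero N))"

definition total_order_le ::
    "('m, 'b::real_normed_vector) chart set \<Rightarrow> ('m, 'v) fmodule \<Rightarrow> ('m, 'w) fmodule \<Rightarrow>
     nat \<Rightarrow> nat \<Rightarrow> ('v list \<Rightarrow> 'w) \<Rightarrow> bool" where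
  "total_order_le At S N p k D \<longleftrightarrow>
     (\<forall>ifs. length ifs = k + 1 \<and> set ifs \<subseteq> {..<p} \<times> smooth_functions At \<longrightarrow>
        (\<forall>Xs\<in>arg_lists S p. foldr (\<lambda>(i, f). delta S N i f) ifs D Xs = mzero N))"

definition multidifferential ::
    "('m, 'b::real_normed_vector) chart set \<Rightarrow> ('m, 'v) fmodule \<Rightarrow> ('m, 'w) fmodule \<Rightarrow>
     nat \<Rightarrow> ('v list \<Rightarrow> 'w) \<Rightarrow> bool" where
  "multidifferential At S N p D \<longleftrightarrow>
     multilinear S N p D \<and> (\<exists>k. \<forall>i<p. order_le At S N p i k D)"

section \<open>Anchored faint algebroids\<close>

definition binary_operator :: "('v \<Rightarrow> 'v \<Rightarrow> 'w) \<Rightarrow> 'v list \<Rightarrow> 'w" where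
  "binary_operator br = (\<lambda>Xs. br (Xs ! 0) (Xs ! 1))"

definition anchored_faint_algebroid ::
    "('m, 'b::real_normed_vector) chart set \<Rightarrow> ('m, 'e, 'f::real_normed_vector) vbundle \<Rightarrow>
     (('m \<Rightarrow> 'e) \<Rightarrow> ('m \<Rightarrow> 'e) \<Rightarrow> ('m \<Rightarrow> 'e)) \<Rightarrow> ('e \<Rightarrow> ('m, 'b) tvector) \<Rightarrow> bool" where
  "anchored_faint_algebroid At E br \<rho> \<longleftrightarrow>
     multidifferential At (section_module At E) (section_module At E) 2 (binary_operator br) \<and>
     bundle_morphism At E (tangent_bundle At) \<rho>"

definition pseudoalgebra_bracket ::
    "('m, 'b::real_normed_vector) chart set \<Rightarrow> ('m, 'e, 'f::real_normed_vector) vbundle \<Rightarrow>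
     (('m \<Rightarrow> 'e) \<Rightarrow> ('m \<Rightarrow> 'e) \<Rightarrow> ('m \<Rightarrow> 'e)) \<Rightarrow> ('e \<Rightarrow> ('m, 'b) tvector) \<Rightarrow> bool" where
  "pseudoalgebra_bracket At E br \<rho> \<longleftrightarrow>
     total_order_le At (section_module At E) (section_module At E) 2 1 (binary_operator br) \<and>
     (\<forall>X\<in>sections At E. \<forall>Y\<in>sections At E. \<forall>f\<in>smooth_functions At.
        br X (mscale (section_module At E) f Y) =
        madd (section_module At E)
          (mscale (section_module At E) f (br X Y))
          (mscale (section_module At E) (anchor_action At \<rho> X f) Y))"

section \<open>Shuffle algebras and the Loday operator\<close>

text \<open>Function-valued operators are normalized to be zero off their domain, so that equality of
  operators is equality of functions. Operators in no arguments are identified with functions.\<close>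

type_synonym ('m, 'e) operator = "('m \<Rightarrow> 'e) list \<Rightarrow> 'm \<Rightarrow> real"

definition Dop ::
    "('m, 'b::real_normed_vector) chart set \<Rightarrow> ('m, 'e, 'f::real_normed_vector) vbundle \<Rightarrow> nat \<Rightarrow>
     ('m, 'e) operator set" where
  "Dop At E p = {D. multidifferential At (section_module At E) (function_module At) p D \<and>
     (\<forall>Xs. Xs \<notin> arg_lists (section_module At E) p \<longrightarrow> D Xs = (\<lambda>x. 0))}"

definition reduced_Dop ::
    "('m, 'b::real_normed_vector) chart set \<Rightarrow> ('m, 'e, 'f::real_normed_vector) vbundle \<Rightarrow> nat \<Rightarrow>
     ('m, 'e) operator set" where
  "reduced_Dop At E k = {D \<in> Dop At E k. k \<ge> 1 \<longrightarrow>
     order_le At (section_module At E) (function_module At) k (k - 1) 0 D \<and>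
     total_order_le At (section_module At E) (function_module At) k (k - 1) D}"

definition direct_sum :: "(nat \<Rightarrow> ('m, 'e) operator set) \<Rightarrow> (nat \<Rightarrow> ('m, 'e) operator) set" where
  "direct_sum V = {c. (\<forall>p. c p \<in> V p) \<and> finite {p. c p \<noteq> (\<lambda>Xs x. 0)}}"

definition op_add :: "('m, 'e) operator \<Rightarrow> ('m, 'e) operator \<Rightarrow> ('m, 'e) operator" where
  "op_add c d = (\<lambda>Xs x. c Xs x + d Xs x)"

definition op_scale :: "real \<Rightarrow> ('m, 'e) operator \<Rightarrow> ('m, 'e) operator" where
  "op_scale r c = (\<lambda>Xs x. r * c Xs x)"

definition shuffles_perm :: "nat \<Rightarrow> nat \<Rightarrow> (nat \<Rightarrow> nat) set" where
  "shuffles_perm p q = {\<sigma>. \<sigma> permutes {..<p + q} \<and>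
     strict_mono_on {..<p} \<sigma> \<and> strict_mono_on {p..<p + q} \<sigma>}"

definition shuffle_product ::
    "('m, 'b::real_normed_vector) chart set \<Rightarrow> ('m, 'e, 'f::real_normed_vector) vbundle \<Rightarrow>
     nat \<Rightarrow> nat \<Rightarrow> ('m, 'e) operator \<Rightarrow> ('m, 'e) operator \<Rightarrow> ('m, 'e) operator" where
  "shuffle_product At E p q l l' = (\<lambda>Xs x.
     if Xs \<in> arg_lists (section_module At E) (p + q) then
       (\<Sum>\<sigma>\<in>shuffles_perm p q. real_of_int (sign \<sigma>) *
          l (map (\<lambda>i. Xs ! \<sigma> i) [0..<p]) x * l' (map (\<lambda>i. Xs ! \<sigma> i) [p..<p + q]) x)
     else 0)"

definition omit :: "nat \<Rightarrow> 'v list \<Rightarrow> 'v list" where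
  "omit i Xs = take i Xs @ drop (Suc i) Xs"

text \<open>Since arguments are numbered from 0, the signs of the usual formula are shifted by one.\<close>

definition loday ::
    "('m, 'b::real_normed_vector) chart set \<Rightarrow> ('m, 'e, 'f::real_normed_vector) vbundle \<Rightarrow>
     (('m \<Rightarrow> 'e) \<Rightarrow> ('m \<Rightarrow> 'e) \<Rightarrow> ('m \<Rightarrow> 'e)) \<Rightarrow> ('e \<Rightarrow> ('m, 'b) tvector) \<Rightarrow> nat \<Rightarrow>
     ('m, 'e) operator \<Rightarrow> ('m, 'e) operator" where
  "loday At E br \<rho> p c = (\<lambda>Xs x.
     if Xs \<in> arg_lists (section_module At E) (p + 1) then
       (\<Sum>i<p + 1. (-1) ^ i * anchor_action At \<rho> (Xs ! i) (c (omit i Xs)) x) +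
       (\<Sum>j<p + 1. \<Sum>i<j. (-1) ^ (i + 1) * c (omit i (Xs[j := br (Xs ! i) (Xs ! j)])) x)
     else 0)"

definition loday_sum ::
    "('m, 'b::real_normed_vector) chart set \<Rightarrow> ('m, 'e, 'f::real_normed_vector) vbundle \<Rightarrow>
     (('m \<Rightarrow> 'e) \<Rightarrow> ('m \<Rightarrow> 'e) \<Rightarrow> ('m \<Rightarrow> 'e)) \<Rightarrow> ('e \<Rightarrow> ('m, 'b) tvector) \<Rightarrow>
     (nat \<Rightarrow> ('m, 'e) operator) \<Rightarrow> (nat \<Rightarrow> ('m, 'e) operator)" where
  "loday_sum At E br \<rho> c = (\<lambda>n. case n of 0 \<Rightarrow> (\<lambda>Xs x. 0) | Suc p \<Rightarrow> loday At E br \<rho> p (c p))"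

end

theory Submission
  imports Defs
begin

text \<open>Write \<iota>(X) for insertion of X as first argument and let L(X) c be the derivative of c along X, i.e.
  \<rho>(X) applied to the value of c minus the sum of the terms in which one argument Y is replaced by
  [X, Y]. Then \<iota>(X) is a derivation of the shuffle product of degree -1, L(X) is one of degree 0, and
  the Loday operator is determined by Cartan's formula \<iota>(X) \<partial> + \<partial> \<iota>(X) = L(X), so that the derivation
  property of \<partial> follows by induction on the number of arguments.

  Each summand of \<partial> c is a composite of c with the derivation \<rho>(X) or with the bracket, and orders add
  up under composition. For a pseudoalgebra bracket, replacing the last argument Y by f Y produces the
  defects \<rho>(X)(f) c from the anchor terms and from the bracket terms, with opposite signs.\<close>

section \<open>Shuffle products and the Cartan formula\<close>

text \<open>The sum over shuffles fixes the arities p and q, while inserting an argument lowers one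
  of them. The recursion on the list frees the induction from arities; in exchange it must be
  identified with the sum over permutations, and the sign (-1)^p of a graded derivation becomes the
  twist of c by (-1)^length. This twist anticommutes with \<iota>(X) and \<partial> and commutes
  with L(X); all signs of the induction come from these three facts.

  In the order count, strict bounds n for the bracket and k for c give n + k - 1 for a bracket term.
  A bracket of total order at most 1 has n = 2 and raises the bound by one, as the anchor does. A
  reduced operator with p arguments has strict bound p, so \<partial> c has p + 1, as required with
  p + 1 arguments.

  The analytic obstacle: \<open>Ck_on\<close> differentiates in constant directions only, whereas
  \<rho>(X) differentiates in a direction that varies with the point, and the model spaces are
  merely normed spaces with a finite spanning set. Continuous linear coordinates, constructed from
  such a set, reduce varying directions to constant ones.\<close>

text \<open>The first argument goes to l or to l'; in the second case it passes all arguments of l, which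
  gives the sign. Without reference to the arities, the sign is read off the number of arguments.\<close>

primrec shuffle_rec ::
    "('v list \<Rightarrow> 'm \<Rightarrow> real) \<Rightarrow> ('v list \<Rightarrow> 'm \<Rightarrow> real) \<Rightarrow> 'v list \<Rightarrow> 'm \<Rightarrow> real" where
  "shuffle_rec l l' [] = (\<lambda>x. l [] x * l' [] x)"
| "shuffle_rec l l' (X # Xs) = (\<lambda>x. shuffle_rec (\<lambda>Ys. l (X # Ys)) l' Xs x +
     shuffle_rec (\<lambda>Ys x. (-1) ^ length Ys * l Ys x) (\<lambda>Ys. l' (X # Ys)) Xs x)"

text \<open>The recursion calls the operators only on lists of entries of \<open>Xs\<close>.
  Identities that hold for lists over V alone, such as the sign rule for \<partial>, can thus be
  used inside a product.\<close>

lemma shuffle_rec_cong: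
  assumes "\<And>Ys. set Ys \<subseteq> V \<Longrightarrow> l Ys = m Ys" "\<And>Ys. set Ys \<subseteq> V \<Longrightarrow> l' Ys = m' Ys" "set Xs \<subseteq> V"
  shows "shuffle_rec l l' Xs = shuffle_rec m m' Xs"
  using assms
proof (induction Xs arbitrary: l l' m m')
  case (Cons X Xs)
  have "shuffle_rec (\<lambda>Ys. l (X # Ys)) l' Xs = shuffle_rec (\<lambda>Ys. m (X # Ys)) m' Xs"
    using Cons.prems by (intro Cons.IH) auto
  moreover have "shuffle_rec (\<lambda>Ys x. (-1) ^ length Ys * l Ys x) (\<lambda>Ys. l' (X # Ys)) Xs =
      shuffle_rec (\<lambda>Ys x. (-1) ^ length Ys * m Ys x) (\<lambda>Ys. m' (X # Ys)) Xs"
    using Cons.prems by (intro Cons.IH) auto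
  ultimately show ?case by simp
qed simp

lemma shuffle_rec_linear_left:
  "shuffle_rec (\<lambda>Ys x. r * l Ys x + s * m Ys x) l' Xs x =
     r * shuffle_rec l l' Xs x + s * shuffle_rec m l' Xs x"
proof (induction Xs arbitrary: l l' m)
  case (Cons X Xs)
  have eq: "(\<lambda>Ys x. (-1) ^ length Ys * (r * l Ys x + s * m Ys x)) =
     (\<lambda>Ys x. r * ((-1) ^ length Ys * l Ys x) + s * ((-1) ^ length Ys * m Ys x))"
    by (simp add: algebra_simps)
  show ?case
    by (simp add: eq Cons.IH) (simp add: algebra_simps)
qed (simp add: algebra_simps)

lemma shuffle_rec_linear_right:
  "shuffle_rec l (\<lambda>Ys x. r * l' Ys x + s * m' Ys x) Xs x =
     r * shuffle_rec l l' Xs x + s * shuffle_rec l m' Xs x"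
  by (induction Xs arbitrary: l l' m') (simp_all add: algebra_simps)

definition lie :: "('v \<Rightarrow> ('m \<Rightarrow> real) \<Rightarrow> 'm \<Rightarrow> real) \<Rightarrow> ('v \<Rightarrow> 'v \<Rightarrow> 'v) \<Rightarrow> 'v \<Rightarrow>
    ('v list \<Rightarrow> 'm \<Rightarrow> real) \<Rightarrow> 'v list \<Rightarrow> 'm \<Rightarrow> real" where
  "lie a b X c Ys = (\<lambda>x. a X (c Ys) x - (\<Sum>j<length Ys. c (Ys[j := b X (Ys ! j)]) x))"

text \<open>Cartan's formula as a definition.\<close>

primrec loday_rec :: "('v \<Rightarrow> ('m \<Rightarrow> real) \<Rightarrow> 'm \<Rightarrow> real) \<Rightarrow> ('v \<Rightarrow> 'v \<Rightarrow> 'v) \<Rightarrow>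
    ('v list \<Rightarrow> 'm \<Rightarrow> real) \<Rightarrow> 'v list \<Rightarrow> 'm \<Rightarrow> real" where
  "loday_rec a b c [] = (\<lambda>x. 0)"
| "loday_rec a b c (X # Xs) = (\<lambda>x. lie a b X c Xs x - loday_rec a b (\<lambda>Ys. c (X # Ys)) Xs x)"

lemma omit_Cons: "omit 0 (X # Xs) = Xs" "omit (Suc i) (X # Xs) = X # omit i Xs"
  by (simp_all add: omit_def)

text \<open>Peel off the first argument. The terms with i = 0 are an anchor term and the brackets
  [X, Y], together \<open>lie\<close>; in all others X stays in first place and i drops by one,
  whence the minus sign in Cartan's formula.\<close>

lemma loday_rec_eq:
  "loday_rec a b c Xs x = (\<Sum>i<length Xs. (-1) ^ i * a (Xs ! i) (c (omit i Xs)) x) +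
     (\<Sum>j<length Xs. \<Sum>i<j. (-1) ^ (i + 1) * c (omit i (Xs[j := b (Xs ! i) (Xs ! j)])) x)"
proof (induction Xs arbitrary: c)
  case (Cons X Xs)
  show ?case
    by (simp del: sum.lessThan_Suc power_Suc
        add: Cons.IH lie_def sum.lessThan_Suc_shift omit_Cons sum.distrib sum_negf)
      (simp add: sum_negf sum_subtractf)
qed simp

text \<open>What the derivation property rests on: each \<open>a X\<close> is a derivation of an
  algebra of functions, and brackets of arguments are again arguments. Manifold and bundle enter
  only when the locale is instantiated.\<close>

locale derivation_action =
  fixes F :: "('m \<Rightarrow> real) set" and V :: "'v set"
    and a :: "'v \<Rightarrow> ('m \<Rightarrow> real) \<Rightarrow> 'm \<Rightarrow> real" and b :: "'v \<Rightarrow> 'v \<Rightarrow> 'v"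
  assumes F_const: "\<And>r. (\<lambda>x. r) \<in> F"
    and F_add: "\<And>f g. f \<in> F \<Longrightarrow> g \<in> F \<Longrightarrow> (\<lambda>x. f x + g x) \<in> F"
    and F_mult: "\<And>f g. f \<in> F \<Longrightarrow> g \<in> F \<Longrightarrow> (\<lambda>x. f x * g x) \<in> F"
    and a_add: "\<And>X f g. X \<in> V \<Longrightarrow> f \<in> F \<Longrightarrow> g \<in> F \<Longrightarrow> a X (\<lambda>x. f x + g x) = (\<lambda>x. a X f x + a X g x)"
    and a_scale: "\<And>X f r. X \<in> V \<Longrightarrow> f \<in> F \<Longrightarrow> a X (\<lambda>x. r * f x) = (\<lambda>x. r * a X f x)"
    and a_mult: "\<And>X f g. X \<in> V \<Longrightarrow> f \<in> F \<Longrightarrow> g \<in> F \<Longrightarrow>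
      a X (\<lambda>x. f x * g x) = (\<lambda>x. a X f x * g x + f x * a X g x)"
    and b_closed: "\<And>X Y. X \<in> V \<Longrightarrow> Y \<in> V \<Longrightarrow> b X Y \<in> V"
begin

text \<open>No arity is fixed, and values lie in F on all lists over V: insertion of an argument and
  twisting by a sign stay within this class.\<close>

definition cochain :: "('v list \<Rightarrow> 'm \<Rightarrow> real) \<Rightarrow> bool" where
  "cochain c \<longleftrightarrow> (\<forall>Ys. set Ys \<subseteq> V \<longrightarrow> c Ys \<in> F)"

lemma cochainD: "cochain c \<Longrightarrow> set Ys \<subseteq> V \<Longrightarrow> c Ys \<in> F"
  by (simp add: cochain_def)

lemma F_scale: "f \<in> F \<Longrightarrow> (\<lambda>x. r * f x) \<in> F"
  using F_mult[OF F_const] .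

lemma cochain_contract: "cochain c \<Longrightarrow> X \<in> V \<Longrightarrow> cochain (\<lambda>Ys. c (X # Ys))"
  by (simp add: cochain_def)

lemma cochain_scale: "cochain c \<Longrightarrow> cochain (\<lambda>Ys x. g (length Ys) * c Ys x)"
  by (simp add: cochain_def F_scale)

lemma cochain_sign: "cochain c \<Longrightarrow> cochain (\<lambda>Ys x. (-1) ^ length Ys * c Ys x)"
  by (rule cochain_scale)

lemma shuffle_rec_in_F:
  "cochain l \<Longrightarrow> cochain l' \<Longrightarrow> set Xs \<subseteq> V \<Longrightarrow> shuffle_rec l l' Xs \<in> F"
proof (induction Xs arbitrary: l l')
  case (Cons X Xs)
  then show ?case
    by (auto intro!: F_add cochain_contract cochain_sign)
qed (simp add: F_mult cochainD)

lemma cochain_shuffle_rec: "cochain l \<Longrightarrow> cochain l' \<Longrightarrow> cochain (shuffle_rec l l')"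
  by (simp add: cochain_def shuffle_rec_in_F)

lemma lie_add:
  assumes "cochain c" "cochain d" "X \<in> V" "set Xs \<subseteq> V"
  shows "lie a b X (\<lambda>Ys x. c Ys x + d Ys x) Xs x = lie a b X c Xs x + lie a b X d Xs x"
  using assms by (simp add: lie_def a_add cochainD sum.distrib)

lemma loday_rec_add:
  assumes "cochain c" "cochain d" "set Xs \<subseteq> V"
  shows "loday_rec a b (\<lambda>Ys x. c Ys x + d Ys x) Xs x = loday_rec a b c Xs x + loday_rec a b d Xs x"
  using assms
  by (induction Xs arbitrary: c d) (simp_all add: lie_add cochain_contract)

lemma lie_scale:
  assumes "cochain c" "X \<in> V" "set Xs \<subseteq> V"
  shows "lie a b X (\<lambda>Ys x. g (length Ys) * c Ys x) Xs x = g (length Xs) * lie a b X c Xs x"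
  using assms by (simp add: lie_def a_scale cochainD sum_distrib_left right_diff_distrib)

text \<open>\<partial> evaluates c on lists that are one shorter, so the factor is read off at the
  length minus one. On the empty list both sides vanish, which makes the truncated difference
  harmless.\<close>

lemma loday_rec_scale:
  assumes "cochain c" "set Xs \<subseteq> V"
  shows "loday_rec a b (\<lambda>Ys x. g (length Ys) * c Ys x) Xs x = g (length Xs - 1) * loday_rec a b c Xs x"
  using assms
proof (induction Xs arbitrary: c g)
  case (Cons X Xs)
  have "loday_rec a b (\<lambda>Ys x. g (Suc (length Ys)) * c (X # Ys) x) Xs x =
      g (Suc (length Xs - 1)) * loday_rec a b (\<lambda>Ys. c (X # Ys)) Xs x"
    using Cons.prems Cons.IH[of "\<lambda>Ys. c (X # Ys)" "\<lambda>n. g (Suc n)"] by (simp add: cochain_contract)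
  also have "\<dots> = g (length Xs) * loday_rec a b (\<lambda>Ys. c (X # Ys)) Xs x"
    by (cases Xs) simp_all
  finally show ?case
    using Cons.prems by (simp add: lie_scale right_diff_distrib)
qed simp

text \<open>The twist depends on the number of arguments, which \<partial> raises by one: twist and
  \<partial> anticommute.\<close>

lemma loday_rec_sign:
  assumes "cochain c" "set Xs \<subseteq> V"
  shows "loday_rec a b (\<lambda>Ys x. (-1) ^ length Ys * c Ys x) Xs x =
    - ((-1) ^ length Xs * loday_rec a b c Xs x)"
  using loday_rec_scale[OF assms, of "\<lambda>n. (-1) ^ n"] by (cases Xs) simp_all

text \<open>The commutation rule \<iota>(Y) L(X) = L(X) \<iota>(Y) - \<iota>([X, Y]): the bracket in
  the first slot is split off from the sum.\<close>

lemma lie_Cons: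
  "lie a b X c (Y # Ys) = (\<lambda>x. lie a b X (\<lambda>Ys. c (Y # Ys)) Ys x - c (b X Y # Ys) x)"
  by (simp add: fun_eq_iff lie_def sum.lessThan_Suc_shift del: sum.lessThan_Suc)

text \<open>Insert Y and commute it past L(X). Both sides reduce to shorter lists, and the terms
  with [X, Y] agree because \<iota>([X, Y]) distributes over the product by the recursion. For the
  empty list the claim is the Leibniz rule of \<open>a X\<close>.\<close>

lemma lie_shuffle_rec:
  assumes "cochain l" "cochain l'" "X \<in> V" "set Xs \<subseteq> V"
  shows "lie a b X (shuffle_rec l l') Xs x =
    shuffle_rec (lie a b X l) l' Xs x + shuffle_rec l (lie a b X l') Xs x"
  using assms
proof (induction Xs arbitrary: l l' x)
  case Nil
  then show ?case by (simp add: lie_def a_mult cochainD)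
next
  case (Cons Y Ys)
  let ?s = "\<lambda>(c::'v list \<Rightarrow> 'm \<Rightarrow> real) Ys x. (-1) ^ length Ys * c Ys x"
  note coch = Cons.prems cochain_contract cochain_sign cochain_shuffle_rec
  have Y: "Y \<in> V" "set Ys \<subseteq> V" using Cons.prems by auto
  have "shuffle_rec (lie a b X l) l' (Y # Ys) x =
      shuffle_rec (\<lambda>Ys x. 1 * lie a b X (\<lambda>Ys. l (Y # Ys)) Ys x + (-1) * l (b X Y # Ys) x) l' Ys x +
      shuffle_rec (?s (lie a b X l)) (\<lambda>Ys. l' (Y # Ys)) Ys x"
    by (simp add: lie_Cons)
  \<comment> \<open>\<open>lie\<close> preserves the number of arguments, so the twist passes it
    without a sign.\<close>
  also have "shuffle_rec (?s (lie a b X l)) (\<lambda>Ys. l' (Y # Ys)) Ys =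
      shuffle_rec (lie a b X (?s l)) (\<lambda>Ys. l' (Y # Ys)) Ys"
    using Cons.prems by (intro shuffle_rec_cong[where V = V]) (auto simp: lie_scale)
  finally have 1: "shuffle_rec (lie a b X l) l' (Y # Ys) x =
      shuffle_rec (lie a b X (\<lambda>Ys. l (Y # Ys))) l' Ys x - shuffle_rec (\<lambda>Ys. l (b X Y # Ys)) l' Ys x +
      shuffle_rec (lie a b X (?s l)) (\<lambda>Ys. l' (Y # Ys)) Ys x"
    unfolding shuffle_rec_linear_left by simp
  have "shuffle_rec l (lie a b X l') (Y # Ys) x =
      shuffle_rec (\<lambda>Ys. l (Y # Ys)) (lie a b X l') Ys x +
      shuffle_rec (?s l) (\<lambda>Ys x. 1 * lie a b X (\<lambda>Ys. l' (Y # Ys)) Ys x + (-1) * l' (b X Y # Ys) x) Ys x"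
    by (simp add: lie_Cons)
  then have 2: "shuffle_rec l (lie a b X l') (Y # Ys) x =
      shuffle_rec (\<lambda>Ys. l (Y # Ys)) (lie a b X l') Ys x +
      shuffle_rec (?s l) (lie a b X (\<lambda>Ys. l' (Y # Ys))) Ys x -
      shuffle_rec (?s l) (\<lambda>Ys. l' (b X Y # Ys)) Ys x"
    unfolding shuffle_rec_linear_right by simp
  have "lie a b X (shuffle_rec l l') (Y # Ys) x =
      lie a b X (shuffle_rec (\<lambda>Ys. l (Y # Ys)) l') Ys x +
      lie a b X (shuffle_rec (?s l) (\<lambda>Ys. l' (Y # Ys))) Ys x -
      (shuffle_rec (\<lambda>Ys. l (b X Y # Ys)) l' Ys x + shuffle_rec (?s l) (\<lambda>Ys. l' (b X Y # Ys)) Ys x)"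
    using Y by (simp add: lie_Cons lie_add coch)
  also have "lie a b X (shuffle_rec (\<lambda>Ys. l (Y # Ys)) l') Ys x =
      shuffle_rec (lie a b X (\<lambda>Ys. l (Y # Ys))) l' Ys x +
      shuffle_rec (\<lambda>Ys. l (Y # Ys)) (lie a b X l') Ys x"
    using Y by (intro Cons.IH coch)
  also have "lie a b X (shuffle_rec (?s l) (\<lambda>Ys. l' (Y # Ys))) Ys x =
      shuffle_rec (lie a b X (?s l)) (\<lambda>Ys. l' (Y # Ys)) Ys x +
      shuffle_rec (?s l) (lie a b X (\<lambda>Ys. l' (Y # Ys))) Ys x"
    using Y by (intro Cons.IH coch)
  finally show ?case
    unfolding 1 2 by simp
qed

text \<open>Insert X. By Cartan's formula \<iota>(X) \<partial> = L(X) - \<partial> \<iota>(X). Here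
  L(X) distributes by \<open>lie_shuffle_rec\<close>, and \<iota>(X) splits the product into two
  products on a shorter list, to which the induction hypothesis applies. The twist on l stands for
  the sign of a derivation of degree 1.\<close>

lemma loday_rec_shuffle_rec:
  assumes "cochain l" "cochain l'" "set Xs \<subseteq> V"
  shows "loday_rec a b (shuffle_rec l l') Xs x =
    shuffle_rec (loday_rec a b l) l' Xs x +
    shuffle_rec (\<lambda>Ys x. (-1) ^ length Ys * l Ys x) (loday_rec a b l') Xs x"
  using assms
proof (induction Xs arbitrary: l l' x)
  case Nil
  then show ?case by simp
next
  case (Cons X Xs)
  let ?s = "\<lambda>(c::'v list \<Rightarrow> 'm \<Rightarrow> real) Ys x. (-1) ^ length Ys * c Ys x"
  let ?i = "\<lambda>(c::'v list \<Rightarrow> 'm \<Rightarrow> real) Ys. c (X # Ys)"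
  note coch = Cons.prems cochain_contract cochain_sign cochain_shuffle_rec
  have X: "X \<in> V" "set Xs \<subseteq> V" using Cons.prems by auto
  have s2: "?s (?s c) = c" for c :: "'v list \<Rightarrow> 'm \<Rightarrow> real"
    by (simp add: fun_eq_iff flip: mult.assoc power_mult_distrib)
  \<comment> \<open>Insertion lowers the length by one, so it anticommutes with the twist. The zero
    summand brings the term into the shape of \<open>shuffle_rec_linear_left\<close>.\<close>
  have si: "(\<lambda>Ys. ?s l (X # Ys)) = (\<lambda>Ys x. (-1) * ?s (?i l) Ys x + 0 * l Ys x)"
    by (simp add: fun_eq_iff)
  have "shuffle_rec (loday_rec a b l) l' (X # Xs) x =
      shuffle_rec (\<lambda>Ys x. 1 * lie a b X l Ys x + (-1) * loday_rec a b (?i l) Ys x) l' Xs x +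
      shuffle_rec (?s (loday_rec a b l)) (?i l') Xs x"
    by simp
  also have "shuffle_rec (?s (loday_rec a b l)) (?i l') Xs =
      shuffle_rec (\<lambda>Ys x. (-1) * loday_rec a b (?s l) Ys x + 0 * l Ys x) (?i l') Xs"
    using Cons.prems by (intro shuffle_rec_cong[where V = V]) (auto simp: loday_rec_sign)
  finally have 1: "shuffle_rec (loday_rec a b l) l' (X # Xs) x =
      shuffle_rec (lie a b X l) l' Xs x - shuffle_rec (loday_rec a b (?i l)) l' Xs x -
      shuffle_rec (loday_rec a b (?s l)) (?i l') Xs x"
    unfolding shuffle_rec_linear_left by simp
  have "shuffle_rec (?s l) (loday_rec a b l') (X # Xs) x =
      shuffle_rec (\<lambda>Ys. ?s l (X # Ys)) (loday_rec a b l') Xs x +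
      shuffle_rec (?s (?s l)) (\<lambda>Ys x. 1 * lie a b X l' Ys x + (-1) * loday_rec a b (?i l') Ys x) Xs x"
    by simp
  also have "\<dots> = - shuffle_rec (?s (?i l)) (loday_rec a b l') Xs x +
      (shuffle_rec l (lie a b X l') Xs x - shuffle_rec l (loday_rec a b (?i l')) Xs x)"
    unfolding shuffle_rec_linear_right si s2 unfolding shuffle_rec_linear_left by simp
  finally have 2: "shuffle_rec (?s l) (loday_rec a b l') (X # Xs) x = \<dots>" .
  have "loday_rec a b (shuffle_rec l l') (X # Xs) x =
      lie a b X (shuffle_rec l l') Xs x -
      (loday_rec a b (shuffle_rec (?i l) l') Xs x + loday_rec a b (shuffle_rec (?s l) (?i l')) Xs x)"
    using X by (simp add: loday_rec_add coch)
  also have "loday_rec a b (shuffle_rec (?i l) l') Xs x =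
      shuffle_rec (loday_rec a b (?i l)) l' Xs x +
      shuffle_rec (?s (?i l)) (loday_rec a b l') Xs x"
    using X by (intro Cons.IH coch)
  also have "loday_rec a b (shuffle_rec (?s l) (?i l')) Xs x =
      shuffle_rec (loday_rec a b (?s l)) (?i l') Xs x +
      shuffle_rec (?s (?s l)) (loday_rec a b (?i l')) Xs x"
    using X by (intro Cons.IH coch)
  also have "lie a b X (shuffle_rec l l') Xs x =
      shuffle_rec (lie a b X l) l' Xs x + shuffle_rec l (lie a b X l') Xs x"
    using X by (intro lie_shuffle_rec coch)
  finally show ?case
    unfolding 1 2 s2 by simp
qed

end

section \<open>Shuffles sorted by the position of the first argument\<close>

definition lift_perm :: "(nat \<Rightarrow> nat) \<Rightarrow> nat \<Rightarrow> nat" where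
  "lift_perm \<sigma> i = (case i of 0 \<Rightarrow> 0 | Suc j \<Rightarrow> Suc (\<sigma> j))"

definition cycle_perm :: "nat \<Rightarrow> nat \<Rightarrow> nat" where
  "cycle_perm k i = (if i < k then Suc i else if i = k then 0 else i)"

text \<open>In one-line notation: the entries of \<sigma> raised by one, with 0 put at position k.
  As a composite, it has the sign of \<sigma> times that of a cycle through k + 1 points.\<close>

definition insert_zero :: "nat \<Rightarrow> (nat \<Rightarrow> nat) \<Rightarrow> nat \<Rightarrow> nat" where
  "insert_zero k \<sigma> = lift_perm \<sigma> \<circ> cycle_perm k"

text \<open>An adjacent transposition lengthens the cycle by one point; permutation property and
  sign follow by induction on k.\<close>

lemma cycle_perm_Suc: "cycle_perm (Suc k) = cycle_perm k \<circ> Transposition.transpose k (Suc k)"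
  by (auto simp: fun_eq_iff cycle_perm_def Transposition.transpose_def)

lemma cycle_perm_0: "cycle_perm 0 = id"
  by (auto simp: fun_eq_iff cycle_perm_def)

lemma cycle_perm_permutes: "cycle_perm k permutes {..k}"
proof (induction k)
  case 0
  show ?case unfolding cycle_perm_0 by (rule permutes_id)
next
  case (Suc k)
  show ?case
    unfolding cycle_perm_Suc
    by (intro permutes_compose permutes_swap_id permutes_subset[OF Suc]) auto
qed

lemma sign_cycle_perm: "sign (cycle_perm k) = (-1) ^ k"
proof (induction k)
  case (Suc k)
  have "permutation (cycle_perm k)"
    using cycle_perm_permutes by (rule permutes_imp_permutation[rotated]) simp
  show ?case
    unfolding cycle_perm_Suc sign_compose[OF \<open>permutation (cycle_perm k)\<close> permutation_swap_id]
    by (simp add: sign_swap_id Suc)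
qed (simp add: cycle_perm_0)

text \<open>Transport of \<sigma> along \<open>Suc\<close> is an instance of
  \<open>map_permutation\<close>, whose rules supply the permutation property and the sign.\<close>

lemma lift_perm_eq_map:
  assumes "\<sigma> permutes {..<n}"
  shows "lift_perm \<sigma> = map_permutation {..<n} Suc \<sigma>"
proof
  fix i
  show "lift_perm \<sigma> i = map_permutation {..<n} Suc \<sigma> i"
  proof (cases "i \<in> Suc ` {..<n}")
    case True
    then obtain j where "i = Suc j" "j < n" by auto
    then show ?thesis by (simp add: lift_perm_def map_permutation_apply)
  next
    case False
    then have "map_permutation {..<n} Suc \<sigma> i = i"
      by (simp add: map_permutation_def)
    moreover have "lift_perm \<sigma> i = i"
    proof (cases i)
      case (Suc j)
      with False have "j \<notin> {..<n}" by auto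
      with Suc show ?thesis using permutes_not_in[OF assms] by (simp add: lift_perm_def)
    qed (simp add: lift_perm_def)
    ultimately show ?thesis by simp
  qed
qed

lemma lift_perm_permutes:
  assumes "\<sigma> permutes {..<n}"
  shows "lift_perm \<sigma> permutes {..<Suc n}"
proof -
  have "map_permutation {..<n} Suc \<sigma> permutes Suc ` {..<n}"
    using assms by (intro map_permutation_permutes) (auto simp: bij_betw_def)
  then show ?thesis
    unfolding lift_perm_eq_map[OF assms] by (rule permutes_subset) auto
qed

lemma sign_lift_perm:
  assumes "\<sigma> permutes {..<n}"
  shows "sign (lift_perm \<sigma>) = sign \<sigma>"
  unfolding lift_perm_eq_map[OF assms] using assms by (intro sign_map_permutation) auto

lemma insert_zero_permutes:
  assumes "\<sigma> permutes {..<n}" "k \<le> n"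
  shows "insert_zero k \<sigma> permutes {..<Suc n}"
  unfolding insert_zero_def
  using assms by (intro permutes_compose lift_perm_permutes permutes_subset[OF cycle_perm_permutes]) auto

lemma sign_insert_zero:
  assumes "\<sigma> permutes {..<n}"
  shows "sign (insert_zero k \<sigma>) = (-1) ^ k * sign \<sigma>"
proof -
  have "permutation (cycle_perm k)" "permutation (lift_perm \<sigma>)"
    using cycle_perm_permutes lift_perm_permutes[OF assms]
    by (auto intro: permutes_imp_permutation[rotated])
  then show ?thesis
    by (simp add: insert_zero_def sign_compose sign_cycle_perm sign_lift_perm[OF assms])
qed

lemma insert_zero_apply:
  "insert_zero k \<sigma> i = (if i < k then Suc (\<sigma> i) else if i = k then 0 else Suc (\<sigma> (i - 1)))"
  by (auto simp: insert_zero_def lift_perm_def cycle_perm_def split: nat.split)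

lemma inj_insert_zero: "inj (insert_zero k)"
proof (rule injI, rule ext)
  fix \<sigma> \<tau> :: "nat \<Rightarrow> nat" and i
  assume eq: "insert_zero k \<sigma> = insert_zero k \<tau>"
  show "\<sigma> i = \<tau> i"
    using fun_cong[OF eq, of i] fun_cong[OF eq, of "Suc i"]
    by (auto simp: insert_zero_apply split: if_splits)
qed

lemma insert_zero_surj:
  assumes "\<tau> permutes {..<Suc n}" "\<tau> k = 0" "k \<le> n"
  obtains \<sigma> where "\<sigma> permutes {..<n}" "\<tau> = insert_zero k \<sigma>"
proof
  \<comment> \<open>Delete the entry 0 at position k and lower the others by one. By
    \<open>pos\<close> these are nonzero, so the truncated subtraction loses nothing.\<close>
  define \<sigma> where "\<sigma> i = \<tau> (if i < k then i else Suc i) - 1" for i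
  have pos: "\<tau> i \<noteq> 0" if "i \<noteq> k" for i
    using permutes_inj[OF assms(1)] assms(2) that by (metis injD)
  show eq: "\<tau> = insert_zero k \<sigma>"
  proof
    fix i show "\<tau> i = insert_zero k \<sigma> i"
      using pos[of i] assms(2) by (auto simp: insert_zero_apply \<sigma>_def)
  qed
  show "\<sigma> permutes {..<n}"
  proof (rule bij_imp_permutes)
    have inj: "inj \<sigma>"
    proof (rule injI)
      fix i j assume "\<sigma> i = \<sigma> j"
      then have "\<tau> (if i < k then i else Suc i) = \<tau> (if j < k then j else Suc j)"
        using pos[of "if i < k then i else Suc i"] pos[of "if j < k then j else Suc j"]
        by (auto simp: \<sigma>_def split: if_splits)
      then show "i = j"
        using permutes_inj[OF assms(1)] by (auto dest!: injD split: if_splits)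
    qed
    have "\<sigma> ` {..<n} \<subseteq> {..<n}"
    proof
      fix y assume "y \<in> \<sigma> ` {..<n}"
      then obtain i where i: "i < n" "y = \<tau> (if i < k then i else Suc i) - 1"
        by (auto simp: \<sigma>_def)
      then have "\<tau> (if i < k then i else Suc i) < Suc n"
        using permutes_in_image[OF assms(1), of "if i < k then i else Suc i"] by auto
      moreover have "\<tau> (if i < k then i else Suc i) \<noteq> 0" by (rule pos) auto
      ultimately show "y \<in> {..<n}" using i(2) by simp
    qed
    then show "bij_betw \<sigma> {..<n} {..<n}"
      using inj by (metis bij_betw_def endo_inj_surj finite_lessThan inj_on_subset subset_UNIV)
    show "\<sigma> i = i" if "i \<notin> {..<n}" for i
      using that assms(3) permutes_not_in[OF assms(1), of "Suc i"] by (simp add: \<sigma>_def)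
  qed
qed

lemma finite_shuffles_perm: "finite (shuffles_perm p q)"
  by (rule finite_subset[OF _ finite_permutations[of "{..<p + q}"]]) (auto simp: shuffles_perm_def)

lemma shuffles_perm_00: "shuffles_perm 0 0 = {id}"
  by (auto simp: shuffles_perm_def monotone_on_def)

text \<open>0 is the least value, so it stands first in whichever of the two increasing runs
  contains it.\<close>

lemma shuffles_perm_zero:
  assumes "\<tau> \<in> shuffles_perm p q" "p + q > 0"
  shows "p > 0 \<and> \<tau> 0 = 0 \<or> q > 0 \<and> \<tau> p = 0"
proof -
  have \<tau>: "\<tau> permutes {..<p + q}" "strict_mono_on {..<p} \<tau>" "strict_mono_on {p..<p + q} \<tau>"
    using assms by (auto simp: shuffles_perm_def)
  obtain k where k: "k < p + q" "\<tau> k = 0"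
    using permutes_image[OF \<tau>(1)] assms(2) by (metis imageE lessThan_iff)
  show ?thesis
  proof (cases "k < p")
    case True
    have "k = 0"
    proof (rule ccontr)
      assume "k \<noteq> 0"
      then have "\<tau> 0 < \<tau> k" using True by (intro strict_mono_onD[OF \<tau>(2)]) auto
      then show False using k by simp
    qed
    with True k show ?thesis by auto
  next
    case False
    have "k = p"
    proof (rule ccontr)
      assume "k \<noteq> p"
      then have "\<tau> p < \<tau> k" using False k by (intro strict_mono_onD[OF \<tau>(3)]) auto
      then show False using k by simp
    qed
    with False k show ?thesis by auto
  qed
qed

text \<open>Where the inserted 0 belongs to the run, it stands at its head, below all raised
  entries. The other values, and in part their positions, are shifted by one, which preserves the
  order.\<close>

lemma strict_mono_on_insert_zero:
  "strict_mono_on {..<Suc p} (insert_zero 0 \<sigma>) \<longleftrightarrow> strict_mono_on {..<p} \<sigma>"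
  "strict_mono_on {Suc p..<Suc n} (insert_zero 0 \<sigma>) \<longleftrightarrow> strict_mono_on {p..<n} \<sigma>"
  "strict_mono_on {..<p} (insert_zero p \<sigma>) \<longleftrightarrow> strict_mono_on {..<p} \<sigma>"
  "strict_mono_on {p..<Suc n} (insert_zero p \<sigma>) \<longleftrightarrow> strict_mono_on {p..<n} \<sigma>"
proof -
  show "strict_mono_on {..<Suc p} (insert_zero 0 \<sigma>) \<longleftrightarrow> strict_mono_on {..<p} \<sigma>"
  proof
    assume *: "strict_mono_on {..<Suc p} (insert_zero 0 \<sigma>)"
    show "strict_mono_on {..<p} \<sigma>"
    proof (rule monotone_onI)
      fix i j assume "i \<in> {..<p}" "j \<in> {..<p}" "i < j"
      then show "\<sigma> i < \<sigma> j"
        using strict_mono_onD[OF *, of "Suc i" "Suc j"] by (simp add: insert_zero_apply)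
    qed
  next
    assume *: "strict_mono_on {..<p} \<sigma>"
    show "strict_mono_on {..<Suc p} (insert_zero 0 \<sigma>)"
    proof (rule monotone_onI)
      fix i j assume "i \<in> {..<Suc p}" "j \<in> {..<Suc p}" "i < j"
      then show "insert_zero 0 \<sigma> i < insert_zero 0 \<sigma> j"
        using strict_mono_onD[OF *, of "i - 1" "j - 1"] by (cases i; cases j) (auto simp: insert_zero_apply)
    qed
  qed
  show "strict_mono_on {Suc p..<Suc n} (insert_zero 0 \<sigma>) \<longleftrightarrow> strict_mono_on {p..<n} \<sigma>"
  proof
    assume *: "strict_mono_on {Suc p..<Suc n} (insert_zero 0 \<sigma>)"
    show "strict_mono_on {p..<n} \<sigma>"
    proof (rule monotone_onI)
      fix i j assume "i \<in> {p..<n}" "j \<in> {p..<n}" "i < j"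
      then show "\<sigma> i < \<sigma> j"
        using strict_mono_onD[OF *, of "Suc i" "Suc j"] by (simp add: insert_zero_apply)
    qed
  next
    assume *: "strict_mono_on {p..<n} \<sigma>"
    show "strict_mono_on {Suc p..<Suc n} (insert_zero 0 \<sigma>)"
    proof (rule monotone_onI)
      fix i j assume "i \<in> {Suc p..<Suc n}" "j \<in> {Suc p..<Suc n}" "i < j"
      then show "insert_zero 0 \<sigma> i < insert_zero 0 \<sigma> j"
        using strict_mono_onD[OF *, of "i - 1" "j - 1"] by (cases i; cases j) (auto simp: insert_zero_apply)
    qed
  qed
  show "strict_mono_on {..<p} (insert_zero p \<sigma>) \<longleftrightarrow> strict_mono_on {..<p} \<sigma>"
    by (auto simp: monotone_on_def insert_zero_apply)
  show "strict_mono_on {p..<Suc n} (insert_zero p \<sigma>) \<longleftrightarrow> strict_mono_on {p..<n} \<sigma>"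
  proof
    assume *: "strict_mono_on {p..<Suc n} (insert_zero p \<sigma>)"
    show "strict_mono_on {p..<n} \<sigma>"
    proof (rule monotone_onI)
      fix i j assume "i \<in> {p..<n}" "j \<in> {p..<n}" "i < j"
      then show "\<sigma> i < \<sigma> j"
        using strict_mono_onD[OF *, of "Suc i" "Suc j"] by (simp add: insert_zero_apply)
    qed
  next
    assume *: "strict_mono_on {p..<n} \<sigma>"
    show "strict_mono_on {p..<Suc n} (insert_zero p \<sigma>)"
    proof (rule monotone_onI)
      fix i j assume "i \<in> {p..<Suc n}" "j \<in> {p..<Suc n}" "i < j"
      then show "insert_zero p \<sigma> i < insert_zero p \<sigma> j"
        using strict_mono_onD[OF *, of "i - 1" "j - 1"] by (cases i; cases j) (auto simp: insert_zero_apply)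
    qed
  qed
qed

lemma insert_zero_permutes_iff:
  assumes "k \<le> n"
  shows "insert_zero k \<sigma> permutes {..<Suc n} \<longleftrightarrow> \<sigma> permutes {..<n}"
proof
  assume "insert_zero k \<sigma> permutes {..<Suc n}"
  moreover have "insert_zero k \<sigma> k = 0" by (simp add: insert_zero_apply)
  ultimately obtain \<tau> where "\<tau> permutes {..<n}" "insert_zero k \<sigma> = insert_zero k \<tau>"
    using insert_zero_surj assms by metis
  then show "\<sigma> permutes {..<n}" using inj_insert_zero by (metis injD)
qed (rule insert_zero_permutes[OF _ assms])

text \<open>Removal of the leading 0 is a bijection onto the shuffles with one argument fewer for
  the first factor; \<open>shuffles_perm_second\<close> is the counterpart for the second
  factor.\<close>

lemma shuffles_perm_first:
  "{\<tau> \<in> shuffles_perm (Suc p) q. \<tau> 0 = 0} = insert_zero 0 ` shuffles_perm p q"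
proof -
  have mem: "insert_zero 0 \<sigma> \<in> shuffles_perm (Suc p) q \<longleftrightarrow> \<sigma> \<in> shuffles_perm p q" for \<sigma>
    by (simp add: shuffles_perm_def insert_zero_permutes_iff strict_mono_on_insert_zero)
  have ex: "\<exists>\<sigma>. \<tau> = insert_zero 0 \<sigma>" if "\<tau> \<in> shuffles_perm (Suc p) q" "\<tau> 0 = 0" for \<tau>
    using that insert_zero_surj[of \<tau> "p + q" 0] by (auto simp: shuffles_perm_def)
  show ?thesis
  proof (intro set_eqI iffI)
    fix \<tau> assume "\<tau> \<in> {\<tau> \<in> shuffles_perm (Suc p) q. \<tau> 0 = 0}"
    moreover from this obtain \<sigma> where "\<tau> = insert_zero 0 \<sigma>" using ex by blast
    ultimately show "\<tau> \<in> insert_zero 0 ` shuffles_perm p q" using mem by simp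
  next
    fix \<tau> assume "\<tau> \<in> insert_zero 0 ` shuffles_perm p q"
    then obtain \<sigma> where "\<sigma> \<in> shuffles_perm p q" "\<tau> = insert_zero 0 \<sigma>" by blast
    then show "\<tau> \<in> {\<tau> \<in> shuffles_perm (Suc p) q. \<tau> 0 = 0}" using mem by (simp add: insert_zero_apply)
  qed
qed

lemma shuffles_perm_second:
  "{\<tau> \<in> shuffles_perm p (Suc q). \<tau> p = 0} = insert_zero p ` shuffles_perm p q"
proof -
  have mem: "insert_zero p \<sigma> \<in> shuffles_perm p (Suc q) \<longleftrightarrow> \<sigma> \<in> shuffles_perm p q" for \<sigma>
    by (simp add: shuffles_perm_def insert_zero_permutes_iff strict_mono_on_insert_zero)
  have ex: "\<exists>\<sigma>. \<tau> = insert_zero p \<sigma>" if "\<tau> \<in> shuffles_perm p (Suc q)" "\<tau> p = 0" for \<tau>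
    using that insert_zero_surj[of \<tau> "p + q" p] by (auto simp: shuffles_perm_def)
  show ?thesis
  proof (intro set_eqI iffI)
    fix \<tau> assume "\<tau> \<in> {\<tau> \<in> shuffles_perm p (Suc q). \<tau> p = 0}"
    moreover from this obtain \<sigma> where "\<tau> = insert_zero p \<sigma>" using ex by blast
    ultimately show "\<tau> \<in> insert_zero p ` shuffles_perm p q" using mem by simp
  next
    fix \<tau> assume "\<tau> \<in> insert_zero p ` shuffles_perm p q"
    then obtain \<sigma> where "\<sigma> \<in> shuffles_perm p q" "\<tau> = insert_zero p \<sigma>" by blast
    then show "\<tau> \<in> {\<tau> \<in> shuffles_perm p (Suc q). \<tau> p = 0}" using mem by (simp add: insert_zero_apply)
  qed
qed

text \<open>The sum inside \<open>shuffle_product\<close>, detached from the bundle and from the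
  test of the domain, so that an induction may run over arbitrary lists.\<close>

definition shuffle_sum ::
    "nat \<Rightarrow> nat \<Rightarrow> ('v list \<Rightarrow> 'm \<Rightarrow> real) \<Rightarrow> ('v list \<Rightarrow> 'm \<Rightarrow> real) \<Rightarrow> 'v list \<Rightarrow> 'm \<Rightarrow> real" where
  "shuffle_sum p q l l' Xs x = (\<Sum>\<sigma>\<in>shuffles_perm p q. real_of_int (sign \<sigma>) *
     l (map (\<lambda>i. Xs ! \<sigma> i) [0..<p]) x * l' (map (\<lambda>i. Xs ! \<sigma> i) [p..<p + q]) x)"

lemma shuffle_sum_first:
  "(\<Sum>\<sigma> | \<sigma> \<in> shuffles_perm (Suc p) q \<and> \<sigma> 0 = 0. real_of_int (sign \<sigma>) *
     l (map (\<lambda>i. (X # Xs) ! \<sigma> i) [0..<Suc p]) x * l' (map (\<lambda>i. (X # Xs) ! \<sigma> i) [Suc p..<Suc p + q]) x) =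
   shuffle_sum p q (\<lambda>Ys. l (X # Ys)) l' Xs x"
  unfolding shuffles_perm_first shuffle_sum_def
proof (subst sum.reindex[OF inj_on_subset[OF inj_insert_zero subset_UNIV]], rule sum.cong[OF refl])
  fix \<sigma> assume "\<sigma> \<in> shuffles_perm p q"
  then have s: "sign (insert_zero 0 \<sigma>) = sign \<sigma>"
    using sign_insert_zero[of \<sigma> "p + q"] by (simp add: shuffles_perm_def)
  have l: "map (\<lambda>i. (X # Xs) ! insert_zero 0 \<sigma> i) [0..<Suc p] = X # map (\<lambda>i. Xs ! \<sigma> i) [0..<p]"
    by (rule nth_equalityI) (auto simp: nth_Cons insert_zero_apply simp del: upt_Suc split: nat.split)
  have l': "map (\<lambda>i. (X # Xs) ! insert_zero 0 \<sigma> i) [Suc p..<Suc p + q] = map (\<lambda>i. Xs ! \<sigma> i) [p..<p + q]"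
    by (rule nth_equalityI) (auto simp: insert_zero_apply simp del: upt_Suc)
  show "((\<lambda>\<sigma>. real_of_int (sign \<sigma>) *
     l (map (\<lambda>i. (X # Xs) ! \<sigma> i) [0..<Suc p]) x * l' (map (\<lambda>i. (X # Xs) ! \<sigma> i) [Suc p..<Suc p + q]) x)
       \<circ> insert_zero 0) \<sigma> =
    real_of_int (sign \<sigma>) * l (X # map (\<lambda>i. Xs ! \<sigma> i) [0..<p]) x * l' (map (\<lambda>i. Xs ! \<sigma> i) [p..<p + q]) x"
    by (simp only: o_def s l l')
qed

lemma shuffle_sum_second:
  "(\<Sum>\<sigma> | \<sigma> \<in> shuffles_perm p (Suc q) \<and> \<sigma> p = 0. real_of_int (sign \<sigma>) *
     l (map (\<lambda>i. (X # Xs) ! \<sigma> i) [0..<p]) x * l' (map (\<lambda>i. (X # Xs) ! \<sigma> i) [p..<p + Suc q]) x) =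
   (-1) ^ p * shuffle_sum p q l (\<lambda>Ys. l' (X # Ys)) Xs x"
  unfolding shuffles_perm_second shuffle_sum_def sum_distrib_left
proof (subst sum.reindex[OF inj_on_subset[OF inj_insert_zero subset_UNIV]], rule sum.cong[OF refl])
  fix \<sigma> assume "\<sigma> \<in> shuffles_perm p q"
  then have s: "sign (insert_zero p \<sigma>) = (-1) ^ p * sign \<sigma>"
    using sign_insert_zero[of \<sigma> "p + q"] by (simp add: shuffles_perm_def)
  have l: "map (\<lambda>i. (X # Xs) ! insert_zero p \<sigma> i) [0..<p] = map (\<lambda>i. Xs ! \<sigma> i) [0..<p]"
    by (simp add: insert_zero_apply)
  have l': "map (\<lambda>i. (X # Xs) ! insert_zero p \<sigma> i) [p..<p + Suc q] = X # map (\<lambda>i. Xs ! \<sigma> i) [p..<p + q]"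
    by (rule nth_equalityI) (auto simp: nth_Cons insert_zero_apply simp del: upt_Suc split: nat.split)
  show "((\<lambda>\<sigma>. real_of_int (sign \<sigma>) *
     l (map (\<lambda>i. (X # Xs) ! \<sigma> i) [0..<p]) x * l' (map (\<lambda>i. (X # Xs) ! \<sigma> i) [p..<p + Suc q]) x)
       \<circ> insert_zero p) \<sigma> =
    (-1) ^ p * (real_of_int (sign \<sigma>) * l (map (\<lambda>i. Xs ! \<sigma> i) [0..<p]) x *
      l' (X # map (\<lambda>i. Xs ! \<sigma> i) [p..<p + q]) x)"
    unfolding o_def s l l' by simp
qed

text \<open>Shuffles are split by the run that contains 0. The case distinctions on p and q guard
  the truncated differences p - 1 and q - 1.\<close>

lemma shuffle_sum_Cons:
  assumes "p + q > 0"
  shows "shuffle_sum p q l l' (X # Xs) x =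
    (if p > 0 then shuffle_sum (p - 1) q (\<lambda>Ys. l (X # Ys)) l' Xs x else 0) +
    (if q > 0 then (-1) ^ p * shuffle_sum p (q - 1) l (\<lambda>Ys. l' (X # Ys)) Xs x else 0)"
proof -
  let ?A = "{\<tau> \<in> shuffles_perm p q. p > 0 \<and> \<tau> 0 = 0}" and ?B = "{\<tau> \<in> shuffles_perm p q. q > 0 \<and> \<tau> p = 0}"
  let ?t = "\<lambda>\<sigma>. real_of_int (sign \<sigma>) *
     l (map (\<lambda>i. (X # Xs) ! \<sigma> i) [0..<p]) x * l' (map (\<lambda>i. (X # Xs) ! \<sigma> i) [p..<p + q]) x"
  have split: "shuffles_perm p q = ?A \<union> ?B"
    using shuffles_perm_zero[OF _ assms] by blast
  \<comment> \<open>0 has only one position, so \<tau> 0 = 0 = \<tau> p forces p = 0, which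
    \<open>?A\<close> excludes.\<close>
  have disj: "?A \<inter> ?B = {}"
  proof -
    have "p = 0" if "\<tau> permutes {..<p + q}" "\<tau> 0 = 0" "\<tau> p = 0" for \<tau>
      using permutes_inj[OF that(1)] that by (metis injD)
    then show ?thesis by (fastforce simp: shuffles_perm_def)
  qed
  have "shuffle_sum p q l l' (X # Xs) x = sum ?t (?A \<union> ?B)"
    unfolding shuffle_sum_def split[symmetric] ..
  also have "\<dots> = sum ?t ?A + sum ?t ?B"
    using finite_shuffles_perm disj by (intro sum.union_disjoint) auto
  also have "sum ?t ?A = (if p > 0 then shuffle_sum (p - 1) q (\<lambda>Ys. l (X # Ys)) l' Xs x else 0)"
    using shuffle_sum_first[where p = "p - 1" and q = q and l = l and l' = l' and X = X and Xs = Xs and x = x] by (cases p) (simp_all del: upt_Suc)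
  also have "sum ?t ?B = (if q > 0 then (-1) ^ p * shuffle_sum p (q - 1) l (\<lambda>Ys. l' (X # Ys)) Xs x else 0)"
    using shuffle_sum_second[where p = p and q = "q - 1" and l = l and l' = l' and X = X and Xs = Xs and x = x] by (cases q) (simp_all del: upt_Suc)
  finally show ?thesis .
qed

lemma shuffle_rec_zero_left:
  assumes "\<And>Ys. l Ys = (\<lambda>x. 0)"
  shows "shuffle_rec l l' Xs x = 0"
  using shuffle_rec_linear_left[of 0 l 0 l l' Xs x] ext[of l "\<lambda>Ys x. 0", OF assms] by simp

lemma shuffle_rec_zero_right:
  assumes "\<And>Ys. l' Ys = (\<lambda>x. 0)"
  shows "shuffle_rec l l' Xs x = 0"
  using shuffle_rec_linear_right[of l 0 l' 0 l' Xs x] ext[of l' "\<lambda>Ys x. 0", OF assms] by simp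

text \<open>The recursion distributes the arguments over the factors in every possible way. As l and
  l' vanish off the lengths p and q, only distributions of these sizes survive, and on them the
  twist is the constant (-1)^p.\<close>

lemma shuffle_rec_eq_shuffle_sum:
  assumes "\<And>Ys. length Ys \<noteq> p \<Longrightarrow> l Ys = (\<lambda>x. 0)" "\<And>Ys. length Ys \<noteq> q \<Longrightarrow> l' Ys = (\<lambda>x. 0)"
    and "length Xs = p + q"
  shows "shuffle_rec l l' Xs x = shuffle_sum p q l l' Xs x"
  using assms
proof (induction Xs arbitrary: p q l l')
  case Nil
  then show ?case by (simp add: shuffle_sum_def shuffles_perm_00)
next
  case (Cons X Xs)
  have 1: "shuffle_rec (\<lambda>Ys. l (X # Ys)) l' Xs x =
      (if p > 0 then shuffle_sum (p - 1) q (\<lambda>Ys. l (X # Ys)) l' Xs x else 0)"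
  proof (cases p)
    case 0
    then show ?thesis using Cons.prems by (simp add: shuffle_rec_zero_left)
  next
    case (Suc p')
    then show ?thesis using Cons.prems Cons.IH[of p' "\<lambda>Ys. l (X # Ys)" q l'] by auto
  qed
  have s: "(\<lambda>Ys x. (-1) ^ length Ys * l Ys x) = (\<lambda>Ys x. (-1) ^ p * l Ys x + 0 * l Ys x)"
    using Cons.prems(1) by (fastforce simp: fun_eq_iff)
  have 2: "shuffle_rec (\<lambda>Ys x. (-1) ^ length Ys * l Ys x) (\<lambda>Ys. l' (X # Ys)) Xs x =
      (if q > 0 then (-1) ^ p * shuffle_sum p (q - 1) l (\<lambda>Ys. l' (X # Ys)) Xs x else 0)"
    unfolding s shuffle_rec_linear_left
  proof (cases q)
    case 0
    then show "(-1) ^ p * shuffle_rec l (\<lambda>Ys. l' (X # Ys)) Xs x + 0 * shuffle_rec l (\<lambda>Ys. l' (X # Ys)) Xs x =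
      (if q > 0 then (-1) ^ p * shuffle_sum p (q - 1) l (\<lambda>Ys. l' (X # Ys)) Xs x else 0)"
      using Cons.prems by (simp add: shuffle_rec_zero_right)
  next
    case (Suc q')
    then show "(-1) ^ p * shuffle_rec l (\<lambda>Ys. l' (X # Ys)) Xs x + 0 * shuffle_rec l (\<lambda>Ys. l' (X # Ys)) Xs x =
      (if q > 0 then (-1) ^ p * shuffle_sum p (q - 1) l (\<lambda>Ys. l' (X # Ys)) Xs x else 0)"
      using Cons.prems Cons.IH[of p l q' "\<lambda>Ys. l' (X # Ys)"] by auto
  qed
  have "p + q > 0" using Cons.prems by (metis length_greater_0_conv list.discI)
  then show ?case
    unfolding shuffle_sum_Cons[OF \<open>p + q > 0\<close>] by (simp only: shuffle_rec.simps 1 2)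
qed

section \<open>Orders of the terms of the Loday operator\<close>

text \<open>Order strictly less than k with respect to the variables in I. With strict bounds the zero
  operator has order less than 0, which starts the inductions.\<close>

primrec order_less ::
    "('m, 'b::real_normed_vector) chart set \<Rightarrow> ('m, 'v) fmodule \<Rightarrow> ('m, 'w) fmodule \<Rightarrow>
     nat \<Rightarrow> nat set \<Rightarrow> nat \<Rightarrow> ('v list \<Rightarrow> 'w) \<Rightarrow> bool" where
  "order_less At S N p I 0 D \<longleftrightarrow> (\<forall>Xs\<in>arg_lists S p. D Xs = mzero N)"
| "order_less At S N p I (Suc k) D \<longleftrightarrow>
     (\<forall>i\<in>I. \<forall>f\<in>smooth_functions At. order_less At S N p I k (delta S N i f D))"

text \<open>Bridge to the lists in the definitions of order. \<open>foldr\<close> applies the last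
  entry of the list first, so the outermost layer of \<open>order_less\<close> corresponds to the
  end of the list.\<close>

lemma order_less_iff_foldr:
  "order_less At S N p I k D \<longleftrightarrow>
     (\<forall>ifs. length ifs = k \<and> set ifs \<subseteq> I \<times> smooth_functions At \<longrightarrow>
        (\<forall>Xs\<in>arg_lists S p. foldr (\<lambda>(i, f). delta S N i f) ifs D Xs = mzero N))"
proof (induction k arbitrary: D)
  case (Suc k)
  show ?case
  proof
    assume D: "order_less At S N p I (Suc k) D"
    show "\<forall>ifs. length ifs = Suc k \<and> set ifs \<subseteq> I \<times> smooth_functions At \<longrightarrow>
        (\<forall>Xs\<in>arg_lists S p. foldr (\<lambda>(i, f). delta S N i f) ifs D Xs = mzero N)"
    proof (intro allI impI)
      fix ifs assume ifs: "length ifs = Suc k \<and> set ifs \<subseteq> I \<times> smooth_functions At"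
      then obtain js i f where js: "ifs = js @ [(i, f)]"
        by (metis length_Suc_conv_rev surj_pair)
      with ifs have "order_less At S N p I k (delta S N i f D)"
        using D by auto
      with ifs js show "\<forall>Xs\<in>arg_lists S p. foldr (\<lambda>(i, f). delta S N i f) ifs D Xs = mzero N"
        unfolding Suc.IH by auto
    qed
  next
    assume *: "\<forall>ifs. length ifs = Suc k \<and> set ifs \<subseteq> I \<times> smooth_functions At \<longrightarrow>
        (\<forall>Xs\<in>arg_lists S p. foldr (\<lambda>(i, f). delta S N i f) ifs D Xs = mzero N)"
    have "order_less At S N p I k (delta S N i f D)" if "i \<in> I" "f \<in> smooth_functions At" for i f
      unfolding Suc.IH
    proof (intro allI impI)
      fix js assume "length js = k \<and> set js \<subseteq> I \<times> smooth_functions At"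
      with that show "\<forall>Xs\<in>arg_lists S p. foldr (\<lambda>(i, f). delta S N i f) js (delta S N i f D) Xs = mzero N"
        using *[rule_format, of "js @ [(i, f)]"] by auto
    qed
    then show "order_less At S N p I (Suc k) D" by simp
  qed
qed simp

lemma total_order_le_iff: "total_order_le At S N p k D \<longleftrightarrow> order_less At S N p {..<p} (Suc k) D"
  unfolding total_order_le_def order_less_iff_foldr by simp

lemma order_le_iff: "order_le At S N p i k D \<longleftrightarrow> order_less At S N p {i} (Suc k) D"
proof -
  have f: "foldr (\<lambda>(i, f). delta S N i f) (map (Pair i) fs) D = foldr (delta S N i) fs D" for fs
    by (simp add: foldr_map comp_def)
  have m: "\<exists>fs. ifs = map (Pair i) fs \<and> set fs \<subseteq> smooth_functions At"
    if "set ifs \<subseteq> {i} \<times> smooth_functions At" for ifs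
    using that by (intro exI[of _ "map snd ifs"]) (force intro!: map_idI[symmetric])
  show ?thesis
    unfolding order_le_def order_less_iff_foldr
  proof (intro iffI allI impI)
    fix ifs
    assume *: "\<forall>fs. length fs = k + 1 \<and> set fs \<subseteq> smooth_functions At \<longrightarrow>
        (\<forall>Xs\<in>arg_lists S p. foldr (delta S N i) fs D Xs = mzero N)"
      and ifs: "length ifs = Suc k \<and> set ifs \<subseteq> {i} \<times> smooth_functions At"
    from ifs m obtain fs where fs: "ifs = map (Pair i) fs" "set fs \<subseteq> smooth_functions At" by blast
    show "\<forall>Xs\<in>arg_lists S p. foldr (\<lambda>(i, f). delta S N i f) ifs D Xs = mzero N"
      using * fs ifs unfolding fs(1) f by simp
  next
    fix fs
    assume *: "\<forall>ifs. length ifs = Suc k \<and> set ifs \<subseteq> {i} \<times> smooth_functions At \<longrightarrow>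
        (\<forall>Xs\<in>arg_lists S p. foldr (\<lambda>(i, f). delta S N i f) ifs D Xs = mzero N)"
      and fs: "length fs = k + 1 \<and> set fs \<subseteq> smooth_functions At"
    then show "\<forall>Xs\<in>arg_lists S p. foldr (delta S N i) fs D Xs = mzero N"
      using *[rule_format, of "map (Pair i) fs"] unfolding f by auto
  qed
qed

lemma mdiff_function_module: "mdiff (function_module At) f g = (\<lambda>x. f x - g x)"
  by (simp add: mdiff_def function_module_def)

lemma function_module_simps:
  "mcarrier (function_module At) = smooth_functions At"
  "mzero (function_module At) = (\<lambda>x. 0)"
  "madd (function_module At) f g = (\<lambda>x. f x + g x)"
  "mscale (function_module At) f g = (\<lambda>x. f x * g x)"
  by (simp_all add: function_module_def)

lemma delta_function_module:
  "delta S (function_module At) i f D Xs = (\<lambda>x. D (Xs[i := mscale S f (Xs ! i)]) x - f x * D Xs x)"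
  by (simp add: delta_def mdiff_function_module function_module_simps)

section \<open>Omission of an argument\<close>

definition omit_index :: "nat \<Rightarrow> nat \<Rightarrow> nat" where
  "omit_index i m = (if m < i then m else m - 1)"

lemma length_omit: "i < length Xs \<Longrightarrow> length (omit i Xs) = length Xs - 1"
  by (auto simp: omit_def)

lemma set_omit: "set (omit i Xs) \<subseteq> set Xs"
  by (auto simp: omit_def dest: in_set_takeD in_set_dropD)

lemma omit_update_same: "omit i (Xs[i := Y]) = omit i Xs"
  by (simp add: omit_def)

lemma omit_update: "m \<noteq> i \<Longrightarrow> m < length Xs \<Longrightarrow> omit i (Xs[m := Y]) = (omit i Xs)[omit_index i m := Y]"
  by (auto simp: omit_def omit_index_def list_update_append drop_update_swap take_update_swap list_update_beyond)

lemma nth_omit: "m \<noteq> i \<Longrightarrow> m < length Xs \<Longrightarrow> i < length Xs \<Longrightarrow> omit i Xs ! omit_index i m = Xs ! m"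
  by (auto simp: omit_def omit_index_def nth_append min_def)

lemma omit_index_less: "m \<noteq> i \<Longrightarrow> m < Suc p \<Longrightarrow> i < Suc p \<Longrightarrow> omit_index i m < p"
  by (auto simp: omit_index_def)

lemma omit_index_eq_iff: "m \<noteq> i \<Longrightarrow> n \<noteq> i \<Longrightarrow> omit_index i m = omit_index i n \<longleftrightarrow> m = n"
  by (auto simp: omit_index_def)

lemma arg_lists_omit: "Xs \<in> arg_lists S (Suc p) \<Longrightarrow> i < Suc p \<Longrightarrow> omit i Xs \<in> arg_lists S p"
  using set_omit by (fastforce simp: arg_lists_def length_omit)

lemma arg_lists_update: "Xs \<in> arg_lists S p \<Longrightarrow> Y \<in> mcarrier S \<Longrightarrow> Xs[i := Y] \<in> arg_lists S p"
  using set_update_subset_insert by (fastforce simp: arg_lists_def)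

lemma arg_lists_nth: "Xs \<in> arg_lists S p \<Longrightarrow> i < p \<Longrightarrow> Xs ! i \<in> mcarrier S"
  by (auto simp: arg_lists_def)

lemma arg_lists_length: "Xs \<in> arg_lists S p \<Longrightarrow> length Xs = p"
  by (simp add: arg_lists_def)

lemma arg_lists_pair: "X \<in> mcarrier S \<Longrightarrow> Y \<in> mcarrier S \<Longrightarrow> [X, Y] \<in> arg_lists S 2"
  by (simp add: arg_lists_def)

text \<open>The facts on sections and anchor behind the order estimates, stated for an abstract
  module S over the smooth functions. \<open>a_mscale\<close> makes the anchor linear over
  functions; \<open>madd_mdiff\<close> recovers a value from its \<open>delta\<close>
  defect.\<close>

locale loday_module = derivation_action "smooth_functions At" "mcarrier S" a b
  for At :: "('m, 'b::real_normed_vector) chart set" and S :: "('m, 'v) fmodule" and a b +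
  assumes a_closed: "\<And>X f. X \<in> mcarrier S \<Longrightarrow> f \<in> smooth_functions At \<Longrightarrow> a X f \<in> smooth_functions At"
    and a_madd: "\<And>X Y f. X \<in> mcarrier S \<Longrightarrow> Y \<in> mcarrier S \<Longrightarrow> f \<in> smooth_functions At \<Longrightarrow>
      a (madd S X Y) f = (\<lambda>x. a X f x + a Y f x)"
    and a_mscale: "\<And>X f g. X \<in> mcarrier S \<Longrightarrow> f \<in> smooth_functions At \<Longrightarrow> g \<in> smooth_functions At \<Longrightarrow>
      a (mscale S f X) g = (\<lambda>x. f x * a X g x)"
    and madd_closed: "\<And>X Y. X \<in> mcarrier S \<Longrightarrow> Y \<in> mcarrier S \<Longrightarrow> madd S X Y \<in> mcarrier S"
    and mscale_closed: "\<And>X f. X \<in> mcarrier S \<Longrightarrow> f \<in> smooth_functions At \<Longrightarrow> mscale S f X \<in> mcarrier S"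
    and mzero_closed: "mzero S \<in> mcarrier S"
    and madd_mzero: "madd S (mzero S) (mzero S) = mzero S"
    and mscale_madd: "\<And>X Y f. X \<in> mcarrier S \<Longrightarrow> Y \<in> mcarrier S \<Longrightarrow> f \<in> smooth_functions At \<Longrightarrow>
      mscale S f (madd S X Y) = madd S (mscale S f X) (mscale S f Y)"
    and madd_mdiff: "\<And>X Y. X \<in> mcarrier S \<Longrightarrow> Y \<in> mcarrier S \<Longrightarrow> madd S (mdiff S X Y) Y = X"
    and b_multilinear: "multilinear S S 2 (binary_operator b)"
begin

abbreviation "FN \<equiv> function_module At"
abbreviation "fun_order_less \<equiv> order_less At S FN"

lemma mdiff_closed: "X \<in> mcarrier S \<Longrightarrow> Y \<in> mcarrier S \<Longrightarrow> mdiff S X Y \<in> mcarrier S"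
  by (simp add: mdiff_def madd_closed mscale_closed F_const)

lemma F_diff: "f \<in> smooth_functions At \<Longrightarrow> g \<in> smooth_functions At \<Longrightarrow> (\<lambda>x. f x - g x) \<in> smooth_functions At"
  using F_add[of f "\<lambda>x. - 1 * g x"] F_scale[of g "-1"] by simp

lemma arg_lists_mscale:
  "Xs \<in> arg_lists S p \<Longrightarrow> i < p \<Longrightarrow> f \<in> smooth_functions At \<Longrightarrow> Xs[i := mscale S f (Xs ! i)] \<in> arg_lists S p"
  by (simp add: arg_lists_update mscale_closed arg_lists_nth)

text \<open>Operators are compared on lists over S of length p only. Indices below p guarantee that
  \<open>delta\<close> evaluates on such lists again.\<close>

lemma order_less_cong:
  assumes "\<And>Xs. Xs \<in> arg_lists S p \<Longrightarrow> D Xs = D' Xs" "I \<subseteq> {..<p}" "fun_order_less p I k D"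
  shows "fun_order_less p I k D'"
  using assms
proof (induction k arbitrary: D D')
  case (Suc k)
  show ?case
    unfolding order_less.simps
  proof (intro ballI)
    fix i f assume i: "i \<in> I" "f \<in> smooth_functions At"
    show "fun_order_less p I k (delta S FN i f D')"
    proof (rule Suc.IH)
      show "fun_order_less p I k (delta S FN i f D)" using Suc.prems i by simp
      show "delta S FN i f D Xs = delta S FN i f D' Xs" if "Xs \<in> arg_lists S p" for Xs
        using Suc.prems(1)[OF that] Suc.prems(1)[OF arg_lists_mscale[OF that _ i(2)]] Suc.prems(2) i(1)
        by (auto simp: delta_function_module)
    qed fact
  qed
qed simp

lemma order_less_zero:
  assumes "\<And>Xs. Xs \<in> arg_lists S p \<Longrightarrow> D Xs = (\<lambda>x. 0)" "I \<subseteq> {..<p}"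
  shows "fun_order_less p I k D"
  using assms
proof (induction k arbitrary: D)
  case (Suc k)
  have "delta S FN i f D Xs = (\<lambda>x. 0)" if "i \<in> I" "f \<in> smooth_functions At" "Xs \<in> arg_lists S p" for i f Xs
    using Suc.prems(1)[OF that(3)] Suc.prems(1)[OF arg_lists_mscale[OF that(3) _ that(2)]] Suc.prems(2) that(1)
    by (auto simp: delta_function_module)
  then show ?case using Suc.IH Suc.prems(2) by simp
qed (simp add: function_module_simps)

lemma order_less_Suc: "I \<subseteq> {..<p} \<Longrightarrow> fun_order_less p I k D \<Longrightarrow> fun_order_less p I (Suc k) D"
proof (induction k arbitrary: D)
  case 0
  then show ?case using order_less_zero[of p D I 1] by (simp add: function_module_simps)
next
  case (Suc k)
  then show ?case by (metis order_less.simps(2))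
qed

lemma order_less_mono: "k \<le> k' \<Longrightarrow> I \<subseteq> {..<p} \<Longrightarrow> fun_order_less p I k D \<Longrightarrow> fun_order_less p I k' D"
  by (induction k' rule: dec_induct) (auto simp del: order_less.simps intro: order_less_Suc)

lemma order_less_add:
  "fun_order_less p I k D \<Longrightarrow> fun_order_less p I k D' \<Longrightarrow> fun_order_less p I k (\<lambda>Xs x. D Xs x + D' Xs x)"
proof (induction k arbitrary: D D')
  case (Suc k)
  have "delta S FN i f (\<lambda>Xs x. D Xs x + D' Xs x) =
      (\<lambda>Xs x. delta S FN i f D Xs x + delta S FN i f D' Xs x)" for i f
    by (simp add: fun_eq_iff delta_function_module algebra_simps)
  then show ?case using Suc by simp
qed (simp add: function_module_simps)

lemma order_less_scale: "fun_order_less p I k D \<Longrightarrow> fun_order_less p I k (\<lambda>Xs x. r * D Xs x)"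
proof (induction k arbitrary: D)
  case (Suc k)
  have "delta S FN i f (\<lambda>Xs x. r * D Xs x) = (\<lambda>Xs x. r * delta S FN i f D Xs x)" for i f
    by (simp add: fun_eq_iff delta_function_module algebra_simps)
  then show ?case using Suc by simp
qed (simp add: function_module_simps)

lemma order_less_sum:
  assumes "finite A" "I \<subseteq> {..<p}" "\<And>i. i \<in> A \<Longrightarrow> fun_order_less p I k (D i)"
  shows "fun_order_less p I k (\<lambda>Xs x. \<Sum>i\<in>A. D i Xs x)"
  using assms by (induction A rule: finite_induct) (simp_all add: order_less_zero order_less_add)

text \<open>The part of multilinearity that splits c at a sum inserted in a slot. It is inherited by
  \<open>delta\<close>, hence can be carried through inductions on the order.\<close>

definition additive_operator :: "nat \<Rightarrow> ('v list \<Rightarrow> 'm \<Rightarrow> real) \<Rightarrow> bool" where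
  "additive_operator p c \<longleftrightarrow> (\<forall>Xs\<in>arg_lists S p. c Xs \<in> smooth_functions At) \<and>
     (\<forall>Xs\<in>arg_lists S p. \<forall>i<p. \<forall>Y\<in>mcarrier S.
        c (Xs[i := madd S (Xs ! i) Y]) = (\<lambda>x. c Xs x + c (Xs[i := Y]) x))"

lemma additiveD:
  assumes "additive_operator p c" "Xs \<in> arg_lists S p"
  shows "c Xs \<in> smooth_functions At"
    and "i < p \<Longrightarrow> Y \<in> mcarrier S \<Longrightarrow> c (Xs[i := madd S (Xs ! i) Y]) = (\<lambda>x. c Xs x + c (Xs[i := Y]) x)"
  using assms by (auto simp: additive_operator_def)

lemma multilinear_imp_additive: "multilinear S FN p c \<Longrightarrow> additive_operator p c"
  by (simp add: multilinear_def additive_operator_def function_module_simps)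

lemma additive_madd:
  assumes "additive_operator p c" "Xs \<in> arg_lists S p" "i < p" "Y \<in> mcarrier S" "Z \<in> mcarrier S"
  shows "c (Xs[i := madd S Y Z]) = (\<lambda>x. c (Xs[i := Y]) x + c (Xs[i := Z]) x)"
  using additiveD(2)[OF assms(1) arg_lists_update[OF assms(2,4), of i] assms(3,5)] assms
  by (simp add: arg_lists_length)

lemma additive_mzero:
  assumes "additive_operator p c" "Xs \<in> arg_lists S p" "i < p"
  shows "c (Xs[i := mzero S]) = (\<lambda>x. 0)"
  using fun_cong[OF additive_madd[OF assms mzero_closed mzero_closed]]
  by (simp add: madd_mzero fun_eq_iff)

text \<open>In slot m itself, multiplication by f is additive; in any other slot the two
  replacements commute.\<close>

lemma additive_delta:
  assumes "additive_operator p c" "m < p" "f \<in> smooth_functions At"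
  shows "additive_operator p (delta S FN m f c)"
  unfolding additive_operator_def
proof (intro conjI ballI allI impI)
  fix Xs assume Xs: "Xs \<in> arg_lists S p"
  then show "delta S FN m f c Xs \<in> smooth_functions At"
    unfolding delta_function_module
    using assms by (auto intro!: F_diff F_mult additiveD(1)[OF assms(1)] arg_lists_mscale)
  fix i Y assume i: "i < p" and Y: "Y \<in> mcarrier S"
  note len = arg_lists_length[OF Xs]
  have Xi: "Xs ! i \<in> mcarrier S" and Xm: "Xs ! m \<in> mcarrier S"
    using Xs i assms(2) by (auto intro: arg_lists_nth)
  show "delta S FN m f c (Xs[i := madd S (Xs ! i) Y]) =
     (\<lambda>x. delta S FN m f c Xs x + delta S FN m f c (Xs[i := Y]) x)"
  proof (cases "i = m")
    case True
    have "c (Xs[m := madd S (mscale S f (Xs ! m)) (mscale S f Y)]) =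
        (\<lambda>x. c (Xs[m := mscale S f (Xs ! m)]) x + c (Xs[m := mscale S f Y]) x)"
      using assms Xs Xm Y by (intro additive_madd mscale_closed) auto
    moreover have "c (Xs[m := madd S (Xs ! m) Y]) = (\<lambda>x. c Xs x + c (Xs[m := Y]) x)"
      using assms Xs Y by (intro additiveD) auto
    ultimately show ?thesis
      using True i len Xm Y assms(3)
      by (simp add: delta_function_module mscale_madd fun_eq_iff algebra_simps)
  next
    case False
    have "c ((Xs[m := mscale S f (Xs ! m)])[i := madd S (Xs ! i) Y]) =
        (\<lambda>x. c ((Xs[m := mscale S f (Xs ! m)])[i := Xs ! i]) x + c ((Xs[m := mscale S f (Xs ! m)])[i := Y]) x)"
      using assms Xs Xi Y i by (intro additive_madd arg_lists_mscale) auto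
    moreover have "(Xs[m := mscale S f (Xs ! m)])[i := Xs ! i] = Xs[m := mscale S f (Xs ! m)]"
      using False by (metis list_update_id nth_list_update_neq)
    moreover have "c (Xs[i := madd S (Xs ! i) Y]) = (\<lambda>x. c Xs x + c (Xs[i := Y]) x)"
      using assms Xs Y i by (intro additiveD) auto
    ultimately show ?thesis
      using False by (simp add: delta_function_module fun_eq_iff algebra_simps list_update_swap)
  qed
qed

section \<open>Anchor terms and bracket terms\<close>

definition anchor_term :: "nat \<Rightarrow> ('v list \<Rightarrow> 'm \<Rightarrow> real) \<Rightarrow> 'v list \<Rightarrow> 'm \<Rightarrow> real" where
  "anchor_term i c Xs = a (Xs ! i) (c (omit i Xs))"

text \<open>The commutator of \<rho>(X) with multiplication by f is multiplication by \<rho>(X)(f),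
  the symbol of \<rho>(X) at f.\<close>

definition symbol_term :: "nat \<Rightarrow> ('m \<Rightarrow> real) \<Rightarrow> ('v list \<Rightarrow> 'm \<Rightarrow> real) \<Rightarrow> 'v list \<Rightarrow> 'm \<Rightarrow> real" where
  "symbol_term i f c Xs = (\<lambda>x. a (Xs ! i) f x * c (omit i Xs) x)"

text \<open>Omission of i < j moves slot j to j - 1. The bracket is a parameter B on lists because
  the order estimate replaces it by its own \<open>delta\<close>.\<close>

definition bracket_term ::
    "nat \<Rightarrow> nat \<Rightarrow> ('v list \<Rightarrow> 'v) \<Rightarrow> ('v list \<Rightarrow> 'm \<Rightarrow> real) \<Rightarrow> 'v list \<Rightarrow> 'm \<Rightarrow> real" where
  "bracket_term i j B c Xs = c ((omit i Xs)[j - 1 := B [Xs ! i, Xs ! j]])"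

lemma delta_symbol_term_same:
  assumes "Xs \<in> arg_lists S (Suc p)" "i < Suc p" "f \<in> smooth_functions At" "g \<in> smooth_functions At"
  shows "delta S FN i g (symbol_term i f c) Xs = (\<lambda>x. 0)"
  using assms by (simp add: delta_function_module symbol_term_def omit_update_same arg_lists_length
      a_mscale arg_lists_nth)

lemma delta_symbol_term:
  assumes "Xs \<in> arg_lists S (Suc p)" "i < Suc p" "m < Suc p" "m \<noteq> i"
  shows "delta S FN m g (symbol_term i f c) Xs = symbol_term i f (delta S FN (omit_index i m) g c) Xs"
  using assms
  by (simp add: delta_function_module symbol_term_def omit_update nth_omit arg_lists_length algebra_simps)

text \<open>\<rho> is linear over functions, so the anchor term has order 0 in the argument that is
  fed to the anchor.\<close>

lemma delta_anchor_term_same: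
  assumes "Xs \<in> arg_lists S (Suc p)" "i < Suc p" "g \<in> smooth_functions At" "additive_operator p c"
  shows "delta S FN i g (anchor_term i c) Xs = (\<lambda>x. 0)"
  using assms by (simp add: delta_function_module anchor_term_def omit_update_same arg_lists_length
      a_mscale arg_lists_nth additiveD arg_lists_omit)

text \<open>With d the defect of c, the Leibniz rule is applied to \<rho>(X)(d + g c), and g
  \<rho>(X)(c) is subtracted again.\<close>

lemma delta_anchor_term:
  assumes "Xs \<in> arg_lists S (Suc p)" "i < Suc p" "m < Suc p" "m \<noteq> i" "g \<in> smooth_functions At" "additive_operator p c"
  shows "delta S FN m g (anchor_term i c) Xs =
    (\<lambda>x. anchor_term i (delta S FN (omit_index i m) g c) Xs x + symbol_term i g c Xs x)"
proof -
  let ?Ys = "omit i Xs" and ?m = "omit_index i m"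
  let ?d = "delta S FN ?m g c ?Ys"
  have Ys: "?Ys \<in> arg_lists S p" using assms by (simp add: arg_lists_omit)
  have m: "?m < p" using assms by (simp add: omit_index_less)
  have Xi: "Xs ! i \<in> mcarrier S" using assms by (simp add: arg_lists_nth)
  have dF: "?d \<in> smooth_functions At" using assms Ys m by (intro additiveD(1)[OF additive_delta])
  have cF: "c ?Ys \<in> smooth_functions At" using assms Ys by (intro additiveD(1))
  have "c (omit i (Xs[m := mscale S g (Xs ! m)])) = (\<lambda>x. ?d x + g x * c ?Ys x)"
    using assms by (simp add: delta_function_module omit_update nth_omit arg_lists_length)
  moreover have "a (Xs ! i) (\<lambda>x. ?d x + g x * c ?Ys x) =
      (\<lambda>x. a (Xs ! i) ?d x + (a (Xs ! i) g x * c ?Ys x + g x * a (Xs ! i) (c ?Ys) x))"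
    using Xi dF cF assms(5) by (simp add: a_add a_mult F_mult)
  ultimately show ?thesis
    using assms by (simp add: delta_function_module[of _ _ m] anchor_term_def symbol_term_def)
qed

text \<open>Multiplication by a function commutes with \<open>delta\<close> in the variables of c,
  and in the i-th argument the coefficient is linear over functions, so no order is gained. I' is a
  set of variables of c that receives those of I after the omission.\<close>

lemma order_less_symbol_term:
  assumes "i < Suc p" "I \<subseteq> {..<Suc p}" "\<And>m. m \<in> I \<Longrightarrow> m \<noteq> i \<Longrightarrow> omit_index i m \<in> I'"
    and "f \<in> smooth_functions At" "fun_order_less p I' k c"
  shows "fun_order_less (Suc p) I k (symbol_term i f c)"
  using assms(5)
proof (induction k arbitrary: c)
  case 0
  then show ?case using assms(1) by (simp add: symbol_term_def function_module_simps arg_lists_omit)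
next
  case (Suc k)
  show ?case
    unfolding order_less.simps
  proof (intro ballI)
    fix m g assume m: "m \<in> I" and g: "g \<in> smooth_functions At"
    show "fun_order_less (Suc p) I k (delta S FN m g (symbol_term i f c))"
    proof (cases "m = i")
      case True
      then show ?thesis
        using assms g by (intro order_less_zero) (auto simp: delta_symbol_term_same)
    next
      case False
      have "fun_order_less (Suc p) I k (symbol_term i f (delta S FN (omit_index i m) g c))"
        using Suc assms(3) m g False by simp
      then show ?thesis
        by (rule order_less_cong[rotated 2]) (use assms m False in \<open>auto simp: delta_symbol_term\<close>)
    qed
  qed
qed

text \<open>The extra order is due to the symbol term: \<open>delta\<close> turns the anchor term of
  c into that of an operator of lower order, covered by induction, plus a symbol term, which has the
  bound of c itself.\<close>

lemma order_less_anchor_term: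
  assumes "i < Suc p" "I \<subseteq> {..<Suc p}" "\<And>m. m \<in> I \<Longrightarrow> m \<noteq> i \<Longrightarrow> omit_index i m \<in> I'"
    and "additive_operator p c" "fun_order_less p I' k c"
  shows "fun_order_less (Suc p) I (Suc k) (anchor_term i c)"
  using assms(4,5)
proof (induction k arbitrary: c)
  case 0
  have "anchor_term i c Xs = (\<lambda>x. 0)" if "Xs \<in> arg_lists S (Suc p)" for Xs
    using a_scale[OF arg_lists_nth[OF that assms(1)] F_const, of 0 0] 0 arg_lists_omit[OF that assms(1)]
    by (simp add: anchor_term_def function_module_simps)
  then show ?case by (intro order_less_zero assms)
next
  case (Suc k)
  have "fun_order_less (Suc p) I (Suc k) (delta S FN m g (anchor_term i c))"
    if m: "m \<in> I" and g: "g \<in> smooth_functions At" for m g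
  proof (cases "m = i")
    case True
    then show ?thesis
      using assms g Suc.prems by (intro order_less_zero) (auto simp: delta_anchor_term_same)
  next
    case False
    have m': "omit_index i m < p" using assms m False by (intro omit_index_less) auto
    have "fun_order_less (Suc p) I (Suc k) (anchor_term i (delta S FN (omit_index i m) g c))"
      using Suc.prems m g False assms(3) m' by (intro Suc.IH additive_delta) auto
    moreover have "fun_order_less (Suc p) I (Suc k) (symbol_term i g c)"
      using assms(1-3) g Suc.prems(2) by (rule order_less_symbol_term)
    ultimately have "fun_order_less (Suc p) I (Suc k)
        (\<lambda>Xs x. anchor_term i (delta S FN (omit_index i m) g c) Xs x + symbol_term i g c Xs x)"
      by (rule order_less_add)
    then show ?thesis
      by (rule order_less_cong[rotated 2]) (use assms m False g Suc.prems in \<open>auto simp: delta_anchor_term\<close>)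
  qed
  then show ?case unfolding order_less.simps(2)[of _ _ _ _ _ "Suc k"] by blast
qed


lemma delta_bracket_term_other:
  assumes "Xs \<in> arg_lists S (Suc p)" "i < j" "j < Suc p" "m < Suc p" "m \<noteq> i" "m \<noteq> j"
  shows "delta S FN m g (bracket_term i j B c) Xs = bracket_term i j B (delta S FN (omit_index i m) g c) Xs"
proof -
  have j: "j - Suc 0 = omit_index i j" using assms by (simp add: omit_index_def)
  have ne: "omit_index i m \<noteq> omit_index i j" using assms by (simp add: omit_index_eq_iff)
  show ?thesis
    using assms ne
    by (simp add: delta_function_module bracket_term_def j omit_update nth_omit arg_lists_length list_update_swap)
qed

lemma additive_mdiff:
  assumes "additive_operator p c" "Ys \<in> arg_lists S p" "j < p" "Y \<in> mcarrier S" "Z \<in> mcarrier S"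
  shows "c (Ys[j := Y]) = (\<lambda>x. c (Ys[j := mdiff S Y Z]) x + c (Ys[j := Z]) x)"
  using additive_madd[OF assms(1-3) mdiff_closed[OF assms(4,5)] assms(5)] assms(4,5)
  by (simp add: madd_mdiff)

text \<open>[f X, Y] is the defect of the bracket plus f [X, Y]. Additivity of c separates the two,
  and the factor f of the latter sits in slot j - 1 of c, where it leaves a defect of c.\<close>

lemma delta_bracket_term_left:
  assumes "Xs \<in> arg_lists S (Suc p)" "i < j" "j < Suc p" "f \<in> smooth_functions At" "additive_operator p c"
    and "\<And>Ys. Ys \<in> arg_lists S 2 \<Longrightarrow> B Ys \<in> mcarrier S"
  shows "delta S FN i f (bracket_term i j B c) Xs =
    (\<lambda>x. bracket_term i j (delta S S 0 f B) c Xs x + bracket_term i j B (delta S FN (j - 1) f c) Xs x)"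
proof -
  let ?Ys = "omit i Xs"
  have Ys: "?Ys \<in> arg_lists S p" using assms by (simp add: arg_lists_omit)
  have X: "Xs ! i \<in> mcarrier S" "Xs ! j \<in> mcarrier S" using assms by (auto intro: arg_lists_nth)
  have B: "B [Xs ! i, Xs ! j] \<in> mcarrier S" "B [mscale S f (Xs ! i), Xs ! j] \<in> mcarrier S"
    using X assms(4) by (auto intro!: assms(6) arg_lists_pair mscale_closed)
  have "c (?Ys[j - 1 := B [mscale S f (Xs ! i), Xs ! j]]) =
      (\<lambda>x. c (?Ys[j - 1 := delta S S 0 f B [Xs ! i, Xs ! j]]) x +
        c (?Ys[j - 1 := mscale S f (B [Xs ! i, Xs ! j])]) x)"
    unfolding delta_def using assms Ys B
    by (subst additive_mdiff[where Z = "mscale S f (B [Xs ! i, Xs ! j])"]) (auto intro: mscale_closed)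
  then show ?thesis
    using assms arg_lists_length[OF Ys]
    by (simp add: delta_function_module bracket_term_def omit_update_same arg_lists_length fun_eq_iff)
qed

lemma delta_bracket_term_right:
  assumes "Xs \<in> arg_lists S (Suc p)" "i < j" "j < Suc p" "f \<in> smooth_functions At" "additive_operator p c"
    and "\<And>Ys. Ys \<in> arg_lists S 2 \<Longrightarrow> B Ys \<in> mcarrier S"
  shows "delta S FN j f (bracket_term i j B c) Xs =
    (\<lambda>x. bracket_term i j (delta S S 1 f B) c Xs x + bracket_term i j B (delta S FN (j - 1) f c) Xs x)"
proof -
  let ?Ys = "omit i Xs"
  have Ys: "?Ys \<in> arg_lists S p" using assms by (simp add: arg_lists_omit)
  have X: "Xs ! i \<in> mcarrier S" "Xs ! j \<in> mcarrier S" using assms by (auto intro: arg_lists_nth)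
  have B: "B [Xs ! i, Xs ! j] \<in> mcarrier S" "B [Xs ! i, mscale S f (Xs ! j)] \<in> mcarrier S"
    using X assms(4) by (auto intro!: assms(6) arg_lists_pair mscale_closed)
  have "c (?Ys[j - 1 := B [Xs ! i, mscale S f (Xs ! j)]]) =
      (\<lambda>x. c (?Ys[j - 1 := delta S S 1 f B [Xs ! i, Xs ! j]]) x +
        c (?Ys[j - 1 := mscale S f (B [Xs ! i, Xs ! j])]) x)"
    unfolding delta_def using assms Ys B
    by (subst additive_mdiff[where Z = "mscale S f (B [Xs ! i, Xs ! j])"]) (auto intro: mscale_closed)
  moreover have "omit_index i j = j - 1" using assms by (simp add: omit_index_def)
  ultimately show ?thesis
    using assms arg_lists_length[OF Ys]
    by (simp add: delta_function_module bracket_term_def omit_update arg_lists_length fun_eq_iff)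
qed

lemma delta_closed:
  assumes "\<And>Ys. Ys \<in> arg_lists S p \<Longrightarrow> B Ys \<in> mcarrier S" "m < p" "f \<in> smooth_functions At"
    and "Ys \<in> arg_lists S p"
  shows "delta S S m f B Ys \<in> mcarrier S"
  unfolding delta_def using assms by (intro mdiff_closed mscale_closed arg_lists_mscale assms(1))

text \<open>Each \<open>delta\<close> falls on the bracket or on c and lowers one of the two strict
  bounds by one; the term vanishes as soon as one bound is 0. J holds the variables of B. A factor
  at argument i or j may also pass through B into slot j - 1 of c, which explains the conditions on
  I'.\<close>

lemma order_less_bracket_term:
  assumes ij: "i < j" "j < Suc p" and I: "I \<subseteq> {..<Suc p}"
    and other: "\<And>m. m \<in> I \<Longrightarrow> m \<noteq> i \<Longrightarrow> omit_index i m \<in> I'"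
    and left: "i \<in> I \<Longrightarrow> j - 1 \<in> I' \<and> 0 \<in> J" and right: "j \<in> I \<Longrightarrow> 1 \<in> J"
    and c: "additive_operator p c" "fun_order_less p I' k c"
    and B: "\<And>Ys. Ys \<in> arg_lists S 2 \<Longrightarrow> B Ys \<in> mcarrier S" "order_less At S S 2 J n B"
  shows "fun_order_less (Suc p) I (n + k - 1) (bracket_term i j B c)"
  using c B
proof (induction "n + k" arbitrary: n k B c rule: less_induct)
  case less
  note c = less.prems(1,2) and B = less.prems(3,4)
  have mem: "omit i Xs \<in> arg_lists S p" "[Xs ! i, Xs ! j] \<in> arg_lists S 2" if "Xs \<in> arg_lists S (Suc p)" for Xs
    using that ij by (auto intro!: arg_lists_omit arg_lists_pair arg_lists_nth)
  show ?case
  proof (cases "n = 0 \<or> k = 0")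
    case True
    have "bracket_term i j B c Xs = (\<lambda>x. 0)" if "Xs \<in> arg_lists S (Suc p)" for Xs
    proof (cases "n = 0")
      case True
      then have "B [Xs ! i, Xs ! j] = mzero S" using B(2) mem(2)[OF that] by simp
      then show ?thesis
        using additive_mzero[OF c(1) mem(1)[OF that], of "j - 1"] ij by (simp add: bracket_term_def)
    next
      case False
      then show ?thesis
        using \<open>n = 0 \<or> k = 0\<close> c(2) arg_lists_update[OF mem(1)[OF that] B(1)[OF mem(2)[OF that]]]
        by (simp add: bracket_term_def function_module_simps)
    qed
    then show ?thesis by (intro order_less_zero I)
  next
    case False
    then obtain n' k' where nk: "n = Suc n'" "k = Suc k'" by (metis not0_implies_Suc)
    have "fun_order_less (Suc p) I (n' + k') (delta S FN m f (bracket_term i j B c))"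
      if m: "m \<in> I" and f: "f \<in> smooth_functions At" for m f
    proof -
      have c': "additive_operator p (delta S FN m' f c)" "fun_order_less p I' k' (delta S FN m' f c)" if "m' \<in> I'" "m' < p" for m'
        using c that f nk by (auto intro: additive_delta)
      have B': "\<And>Ys. Ys \<in> arg_lists S 2 \<Longrightarrow> delta S S m' f B Ys \<in> mcarrier S"
        "order_less At S S 2 J n' (delta S S m' f B)" if "m' \<in> J" "m' < 2" for m'
        using B that f nk by (auto intro: delta_closed)
      have c_step: "fun_order_less (Suc p) I (n' + k') (bracket_term i j B (delta S FN m' f c))"
        if "m' \<in> I'" "m' < p" for m'
        using less.hyps[of n k' "delta S FN m' f c" B] c'[OF that] B nk by simp
      have B_step: "fun_order_less (Suc p) I (n' + k') (bracket_term i j (delta S S m' f B) c)"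
        if "m' \<in> J" "m' < 2" for m'
        using less.hyps[of n' k c "delta S S m' f B"] B'[OF that] c nk by simp
      consider "m = i" | "m = j" | "m \<noteq> i" "m \<noteq> j" by blast
      then show ?thesis
      proof cases
        case 1
        have "fun_order_less (Suc p) I (n' + k') (\<lambda>Xs x. bracket_term i j (delta S S 0 f B) c Xs x +
            bracket_term i j B (delta S FN (j - 1) f c) Xs x)"
          using left m 1 ij by (intro order_less_add B_step c_step) auto
        then show ?thesis
          by (rule order_less_cong[rotated 2])
            (use ij f c B I 1 in \<open>auto simp: delta_bracket_term_left\<close>)
      next
        case 2
        have "omit_index i j = j - 1" using ij by (simp add: omit_index_def)
        then have "fun_order_less (Suc p) I (n' + k') (\<lambda>Xs x. bracket_term i j (delta S S 1 f B) c Xs x +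
            bracket_term i j B (delta S FN (j - 1) f c) Xs x)"
          using right other[of j] m 2 ij by (intro order_less_add B_step c_step) auto
        then show ?thesis
          by (rule order_less_cong[rotated 2])
            (use ij f c B I 2 in \<open>auto simp: delta_bracket_term_right simp del: One_nat_def\<close>)
      next
        case 3
        have "fun_order_less (Suc p) I (n' + k') (bracket_term i j B (delta S FN (omit_index i m) f c))"
          using 3 other m I ij by (intro c_step omit_index_less) auto
        then show ?thesis
          by (rule order_less_cong[rotated 2])
            (use ij m I 3 in \<open>auto simp: delta_bracket_term_other\<close>)
      qed
    qed
    then show ?thesis by (simp add: nk)
  qed
qed

section \<open>Multilinearity of the terms\<close>

lemma multilinear_function_module:
  "multilinear S FN p c \<longleftrightarrow> additive_operator p c \<and>
     (\<forall>Xs\<in>arg_lists S p. \<forall>i<p. \<forall>r::real. c (Xs[i := mscale S (\<lambda>x. r) (Xs ! i)]) = (\<lambda>x. r * c Xs x))"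
  by (simp add: multilinear_def additive_operator_def function_module_simps)

lemma multilinear_mscale:
  assumes "multilinear S FN p c" "Xs \<in> arg_lists S p" "i < p" "Y \<in> mcarrier S"
  shows "c (Xs[i := mscale S (\<lambda>x. r) Y]) = (\<lambda>x. r * c (Xs[i := Y]) x)"
proof -
  have "c ((Xs[i := Y])[i := mscale S (\<lambda>x. r) (Xs[i := Y] ! i)]) = (\<lambda>x. r * c (Xs[i := Y]) x)"
    using assms arg_lists_update[OF assms(2,4)] unfolding multilinear_function_module by blast
  then show ?thesis using assms(2,3) by (simp add: arg_lists_length)
qed

lemma multilinear_cong:
  assumes "\<And>Xs. Xs \<in> arg_lists S p \<Longrightarrow> c Xs = d Xs" "multilinear S FN p c"
  shows "multilinear S FN p d"
proof -
  have "d (Xs[i := Y]) = c (Xs[i := Y])" if "Xs \<in> arg_lists S p" "Y \<in> mcarrier S" for Xs i Y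
    using assms(1)[OF arg_lists_update[OF that]] by simp
  then show ?thesis
    using assms(2) by (simp add: multilinear_def assms(1)[symmetric] madd_closed mscale_closed F_const arg_lists_nth)
qed

lemma multilinear_add:
  "multilinear S FN p c \<Longrightarrow> multilinear S FN p d \<Longrightarrow> multilinear S FN p (\<lambda>Xs x. c Xs x + d Xs x)"
  by (simp add: multilinear_def function_module_simps F_add algebra_simps)

lemma multilinear_scale:
  "multilinear S FN p c \<Longrightarrow> multilinear S FN p (\<lambda>Xs x. r * c Xs x)"
  by (simp add: multilinear_def function_module_simps F_scale algebra_simps)

lemma multilinear_zero: "multilinear S FN p (\<lambda>Xs x. 0)"
  by (simp add: multilinear_def function_module_simps F_const)

lemma multilinear_sum:
  assumes "finite A" "\<And>i. i \<in> A \<Longrightarrow> multilinear S FN p (c i)"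
  shows "multilinear S FN p (\<lambda>Xs x. \<Sum>i\<in>A. c i Xs x)"
  using assms by (induction A rule: finite_induct) (simp_all add: multilinear_zero multilinear_add)

lemma multilinear_anchor_term:
  assumes c: "multilinear S FN p c" and i: "i < Suc p"
  shows "multilinear S FN (Suc p) (anchor_term i c)"
  unfolding multilinear_function_module additive_operator_def
proof (intro conjI ballI allI impI)
  note ca = multilinear_imp_additive[OF c]
  fix Xs assume Xs: "Xs \<in> arg_lists S (Suc p)"
  note len = arg_lists_length[OF Xs]
  let ?Ys = "omit i Xs"
  have Ys: "?Ys \<in> arg_lists S p" using Xs i by (simp add: arg_lists_omit)
  have Xi: "Xs ! i \<in> mcarrier S" using Xs i by (simp add: arg_lists_nth)
  have cF: "c ?Ys \<in> smooth_functions At" using ca Ys by (rule additiveD)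
  show "anchor_term i c Xs \<in> smooth_functions At"
    unfolding anchor_term_def using Xi cF by (rule a_closed)
  fix m assume m: "m < Suc p"
  show "anchor_term i c (Xs[m := madd S (Xs ! m) Y]) =
      (\<lambda>x. anchor_term i c Xs x + anchor_term i c (Xs[m := Y]) x)" if Y: "Y \<in> mcarrier S" for Y
  proof (cases "m = i")
    case True
    then show ?thesis using i len Xi Y cF by (simp add: anchor_term_def omit_update_same a_madd)
  next
    case False
    have m': "omit_index i m < p" using m i False by (simp add: omit_index_less)
    have "c (?Ys[omit_index i m := Y]) \<in> smooth_functions At"
      using Ys Y by (intro additiveD(1)[OF ca] arg_lists_update)
    then show ?thesis
      using additiveD(2)[OF ca Ys m' Y] False i m len Xi cF
      by (simp add: anchor_term_def omit_update nth_omit a_add)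
  qed
  show "anchor_term i c (Xs[m := mscale S (\<lambda>x. r) (Xs ! m)]) = (\<lambda>x. r * anchor_term i c Xs x)" for r
  proof (cases "m = i")
    case True
    then show ?thesis using i len Xi cF by (simp add: anchor_term_def omit_update_same a_mscale F_const)
  next
    case False
    have m': "omit_index i m < p" using m i False by (simp add: omit_index_less)
    then show ?thesis
      using c[unfolded multilinear_function_module, THEN conjunct2, rule_format, OF Ys m', of r]
        False i m len Xi cF
      by (simp add: anchor_term_def omit_update nth_omit a_scale)
  qed
qed

lemma multilinear_bracket_term:
  assumes c: "multilinear S FN p c" and ij: "i < j" "j < Suc p" and B: "multilinear S S 2 B"
  shows "multilinear S FN (Suc p) (bracket_term i j B c)"
  unfolding multilinear_function_module additive_operator_def
proof (intro conjI ballI allI impI)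
  note ca = multilinear_imp_additive[OF c]
  have B_closed: "B [X, Y] \<in> mcarrier S" if "X \<in> mcarrier S" "Y \<in> mcarrier S" for X Y
    using B that unfolding multilinear_def by (metis arg_lists_pair)
  have B_add: "B [madd S X X', Y] = madd S (B [X, Y]) (B [X', Y])"
    "B [Y, madd S X X'] = madd S (B [Y, X]) (B [Y, X'])"
    if "X \<in> mcarrier S" "X' \<in> mcarrier S" "Y \<in> mcarrier S" for X X' Y
  proof -
    have *: "\<forall>Xs\<in>arg_lists S 2. \<forall>i<2. \<forall>Y\<in>mcarrier S.
        B (Xs[i := madd S (Xs ! i) Y]) = madd S (B Xs) (B (Xs[i := Y]))"
      using B unfolding multilinear_def by blast
    show "B [madd S X X', Y] = madd S (B [X, Y]) (B [X', Y])"
      using *[rule_format, of "[X, Y]" 0 X'] that by (simp add: arg_lists_pair)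
    show "B [Y, madd S X X'] = madd S (B [Y, X]) (B [Y, X'])"
      using *[rule_format, of "[Y, X]" 1 X'] that by (simp add: arg_lists_pair)
  qed
  have B_scale: "B [mscale S (\<lambda>x. r) X, Y] = mscale S (\<lambda>x. r) (B [X, Y])"
    "B [X, mscale S (\<lambda>x. r) Y] = mscale S (\<lambda>x. r) (B [X, Y])"
    if "X \<in> mcarrier S" "Y \<in> mcarrier S" for X Y r
  proof -
    have *: "\<forall>Xs\<in>arg_lists S 2. \<forall>i<2. \<forall>r::real.
        B (Xs[i := mscale S (\<lambda>x. r) (Xs ! i)]) = mscale S (\<lambda>x. r) (B Xs)"
      using B unfolding multilinear_def by blast
    show "B [mscale S (\<lambda>x. r) X, Y] = mscale S (\<lambda>x. r) (B [X, Y])"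
      using *[rule_format, of "[X, Y]" 0 r] that by (simp add: arg_lists_pair)
    show "B [X, mscale S (\<lambda>x. r) Y] = mscale S (\<lambda>x. r) (B [X, Y])"
      using *[rule_format, of "[X, Y]" 1 r] that by (simp add: arg_lists_pair)
  qed
  fix Xs assume Xs: "Xs \<in> arg_lists S (Suc p)"
  note len = arg_lists_length[OF Xs]
  let ?Ys = "omit i Xs"
  have Ys: "?Ys \<in> arg_lists S p" using Xs ij by (simp add: arg_lists_omit)
  have X: "Xs ! i \<in> mcarrier S" "Xs ! j \<in> mcarrier S" using Xs ij by (simp_all add: arg_lists_nth)
  have j: "j - Suc 0 = omit_index i j" "omit_index i j < p" using ij by (simp_all add: omit_index_def)
  show "bracket_term i j B c Xs \<in> smooth_functions At"
    unfolding bracket_term_def by (intro additiveD(1)[OF ca] arg_lists_update Ys B_closed X)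
  fix m assume m: "m < Suc p"
  consider "m = i" | "m = j" | "m \<noteq> i" "m \<noteq> j" by blast
  note cases = this
  \<comment> \<open>With the bracket already in place, a change of an argument other than i and j is
    a change in a single slot of c.\<close>
  let ?Zs = "?Ys[omit_index i j := B [Xs ! i, Xs ! j]]"
  have Zs: "?Zs \<in> arg_lists S p" by (intro arg_lists_update Ys B_closed X)
  show "bracket_term i j B c (Xs[m := madd S (Xs ! m) Y]) =
      (\<lambda>x. bracket_term i j B c Xs x + bracket_term i j B c (Xs[m := Y]) x)" if Y: "Y \<in> mcarrier S" for Y
    using cases
  proof cases
    case 1
    then show ?thesis
      using additive_madd[OF ca Ys j(2) B_closed[OF X] B_closed[OF Y X(2)]] ij len X Y
      by (simp add: bracket_term_def omit_update_same j B_add)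
  next
    case 2
    then show ?thesis
      using additive_madd[OF ca Ys j(2) B_closed[OF X] B_closed[OF X(1) Y]] ij len X Y
      by (simp add: bracket_term_def omit_update j B_add)
  next
    case 3
    have ne: "omit_index i m \<noteq> omit_index i j" using 3 ij by (simp add: omit_index_eq_iff)
    have "?Zs ! omit_index i m = Xs ! m" using ne 3 m ij len by (simp add: nth_omit)
    then show ?thesis
      using additiveD(2)[OF ca Zs, of "omit_index i m" Y] 3 m ij len Y ne
      by (simp add: bracket_term_def omit_update j omit_index_less list_update_swap[OF ne])
  qed
  show "bracket_term i j B c (Xs[m := mscale S (\<lambda>x. r) (Xs ! m)]) = (\<lambda>x. r * bracket_term i j B c Xs x)" for r
    using cases
  proof cases
    case 1
    then show ?thesis
      using multilinear_mscale[OF c Ys j(2) B_closed[OF X]] ij len X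
      by (simp add: bracket_term_def omit_update_same j B_scale)
  next
    case 2
    then show ?thesis
      using multilinear_mscale[OF c Ys j(2) B_closed[OF X]] ij len X
      by (simp add: bracket_term_def omit_update j B_scale)
  next
    case 3
    have ne: "omit_index i m \<noteq> omit_index i j" using 3 ij by (simp add: omit_index_eq_iff)
    have "?Zs ! omit_index i m = Xs ! m" using ne 3 m ij len by (simp add: nth_omit)
    then show ?thesis
      using c[unfolded multilinear_function_module, THEN conjunct2, rule_format, OF Zs, of "omit_index i m" r]
        3 m ij len ne
      by (simp add: bracket_term_def omit_update j omit_index_less list_update_swap[OF ne])
  qed
qed

section \<open>The Loday operator as a sum of terms\<close>

definition loday_terms :: "nat \<Rightarrow> ('v list \<Rightarrow> 'm \<Rightarrow> real) \<Rightarrow> 'v list \<Rightarrow> 'm \<Rightarrow> real" where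
  "loday_terms p c Xs = (\<lambda>x. (\<Sum>i<p + 1. (-1) ^ i * anchor_term i c Xs x) +
     (\<Sum>j<p + 1. \<Sum>i<j. (-1) ^ (i + 1) * bracket_term i j (binary_operator b) c Xs x))"

lemma loday_terms_eq:
  assumes "Xs \<in> arg_lists S (Suc p)"
  shows "loday_terms p c Xs x =
    (\<Sum>i<p + 1. (-1) ^ i * a (Xs ! i) (c (omit i Xs)) x) +
    (\<Sum>j<p + 1. \<Sum>i<j. (-1) ^ (i + 1) * c (omit i (Xs[j := b (Xs ! i) (Xs ! j)])) x)"
proof -
  have "bracket_term i j (binary_operator b) c Xs = c (omit i (Xs[j := b (Xs ! i) (Xs ! j)]))"
    if "j < p + 1" "i < j" for i j
    using that arg_lists_length[OF assms]
    by (simp add: bracket_term_def binary_operator_def omit_update omit_index_def)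
  then show ?thesis by (simp add: loday_terms_def anchor_term_def)
qed

lemma multilinear_loday_terms: "multilinear S FN p c \<Longrightarrow> multilinear S FN (Suc p) (loday_terms p c)"
  unfolding loday_terms_def
  by (intro multilinear_add multilinear_sum multilinear_scale multilinear_anchor_term
      multilinear_bracket_term b_multilinear) auto

lemma binary_operator_closed: "Ys \<in> arg_lists S 2 \<Longrightarrow> binary_operator b Ys \<in> mcarrier S"
  using b_multilinear by (simp add: multilinear_def)

lemma order_less_loday_terms:
  assumes "I \<subseteq> {..<Suc p}"
    and "\<And>i. i < p + 1 \<Longrightarrow> fun_order_less (Suc p) I k (anchor_term i c)"
    and "\<And>i j. i < j \<Longrightarrow> j < p + 1 \<Longrightarrow> fun_order_less (Suc p) I k (bracket_term i j (binary_operator b) c)"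
  shows "fun_order_less (Suc p) I k (loday_terms p c)"
  unfolding loday_terms_def using assms
  by (intro order_less_add order_less_sum order_less_scale) auto

text \<open>One variable m at a time: I = {m}, while I' and J contain the single variable of c and
  of the bracket through which m acts.\<close>

lemma multidifferential_loday_terms:
  assumes c: "multidifferential At S FN p c" and B: "multidifferential At S S 2 (binary_operator b)"
  shows "multidifferential At S FN (Suc p) (loday_terms p c)"
proof -
  from c obtain k where k: "\<And>m. m < p \<Longrightarrow> fun_order_less p {m} (Suc k) c" and cm: "multilinear S FN p c"
    unfolding multidifferential_def order_le_iff by blast
  from B obtain n where n: "\<And>m. m < 2 \<Longrightarrow> order_less At S S 2 {m} (Suc n) (binary_operator b)"
    unfolding multidifferential_def order_le_iff by blast
  note ca = multilinear_imp_additive[OF cm]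
  \<comment> \<open>Anchor terms have strict bound k + 2, bracket terms (n + 1) + (k + 1) - 1; the
    bound n + k + 2 covers both.\<close>
  have "fun_order_less (Suc p) {m} (Suc (Suc (n + k))) (loday_terms p c)" if m: "m < Suc p" for m
  proof (rule order_less_loday_terms)
    fix i assume i: "i < p + 1"
    have *: "fun_order_less (Suc p) {m} (Suc (Suc k)) (anchor_term i c)"
    proof (cases "m = i")
      case True
      have "fun_order_less (Suc p) {m} (Suc (Suc k)) (anchor_term i c) \<longleftrightarrow>
          (\<forall>f\<in>smooth_functions At. fun_order_less (Suc p) {m} (Suc k) (delta S FN m f (anchor_term i c)))"
        unfolding order_less.simps(2)[of _ _ _ _ _ "Suc k"] by blast
      then show ?thesis
        using i True ca by (auto intro!: order_less_zero simp: delta_anchor_term_same simp del: order_less.simps)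
    next
      case False
      then show ?thesis
        using i m ca by (intro order_less_anchor_term[where I' = "{omit_index i m}"] k) (auto intro: omit_index_less)
    qed
    then show "fun_order_less (Suc p) {m} (Suc (Suc (n + k))) (anchor_term i c)"
      using m by (intro order_less_mono[OF _ _ *]) auto
  next
    fix i j assume ij: "i < j" "j < p + 1"
    have "fun_order_less (Suc p) {m} (Suc n + Suc k - 1) (bracket_term i j (binary_operator b) c)"
    proof (cases "m = i")
      case True
      \<comment> \<open>A factor at argument i acts through the first argument of the bracket and
        then through slot j - 1 of c.\<close>
      then show ?thesis using ij ca binary_operator_closed
        by (intro order_less_bracket_term[where I' = "{j - 1}" and J = "{0}"] k n) auto
    next
      case False
      \<comment> \<open>For m \<noteq> i the first argument of the bracket is unchanged; its second
        one is affected when m = j.\<close>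
      then show ?thesis using ij m ca binary_operator_closed
        by (intro order_less_bracket_term[where I' = "{omit_index i m}" and J = "{1}"] k n)
          (auto intro: omit_index_less)
    qed
    then show "fun_order_less (Suc p) {m} (Suc (Suc (n + k))) (bracket_term i j (binary_operator b) c)"
      using m by (elim order_less_mono[rotated 2]) auto
  qed (use m in auto)
  then show ?thesis
    unfolding multidifferential_def order_le_iff using multilinear_loday_terms[OF cm] by blast
qed

text \<open>Total order at most 1 means the strict bound 2, so a bracket term has the bound 2 + k -
  1 = k + 1, the same as an anchor term.\<close>

lemma total_order_loday_terms:
  assumes c: "multilinear S FN p c" "fun_order_less p {..<p} k c"
    and B: "order_less At S S 2 {..<2} 2 (binary_operator b)"
  shows "fun_order_less (Suc p) {..<Suc p} (Suc k) (loday_terms p c)"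
proof (rule order_less_loday_terms)
  note ca = multilinear_imp_additive[OF c(1)]
  show "fun_order_less (Suc p) {..<Suc p} (Suc k) (anchor_term i c)" if "i < p + 1" for i
    using that ca c(2) by (intro order_less_anchor_term[where I' = "{..<p}"]) (auto intro: omit_index_less)
  show "fun_order_less (Suc p) {..<Suc p} (Suc k) (bracket_term i j (binary_operator b) c)" if "i < j" "j < p + 1" for i j
  proof -
    have "fun_order_less (Suc p) {..<Suc p} (2 + k - 1) (bracket_term i j (binary_operator b) c)"
      using that ca c(2) B binary_operator_closed
      by (intro order_less_bracket_term[where I' = "{..<p}" and J = "{..<2}"]) (auto intro: omit_index_less)
    then show ?thesis by simp
  qed
qed simp

lemma delta_loday_terms:
  "delta S FN m f (loday_terms p c) Xs x =
    (\<Sum>i<p + 1. (-1) ^ i * delta S FN m f (anchor_term i c) Xs x) +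
    (\<Sum>j<p + 1. \<Sum>i<j. (-1) ^ (i + 1) * delta S FN m f (bracket_term i j (binary_operator b) c) Xs x)"
  unfolding delta_function_module loday_terms_def
  by (simp only: right_diff_distrib sum_subtractf distrib_left sum_distrib_left mult.left_commute[of "f x"])

text \<open>Only anchor terms with i < p and bracket terms with j = p have a defect. A bracket term
  with j < p keeps the last argument in the last slot of c, where c is linear over functions; for
  the anchor term with i = p the linearity of \<rho> applies. For each i < p the two remaining
  defects are the same symbol term, with signs (-1)^i and (-1)^(i+1).\<close>

lemma delta_last_loday_terms:
  assumes c: "multilinear S FN p c" and p: "p > 0"
    and c0: "\<And>f Xs. f \<in> smooth_functions At \<Longrightarrow> Xs \<in> arg_lists S p \<Longrightarrow> delta S FN (p - 1) f c Xs = (\<lambda>x. 0)"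
    and leibniz: "\<And>X Y f. X \<in> mcarrier S \<Longrightarrow> Y \<in> mcarrier S \<Longrightarrow> f \<in> smooth_functions At \<Longrightarrow>
      b X (mscale S f Y) = madd S (mscale S f (b X Y)) (mscale S (a X f) Y)"
    and f: "f \<in> smooth_functions At" and Xs: "Xs \<in> arg_lists S (Suc p)"
  shows "delta S FN p f (loday_terms p c) Xs = (\<lambda>x. 0)"
proof
  fix x
  note ca = multilinear_imp_additive[OF c]
  note len = arg_lists_length[OF Xs]
  have idx: "omit_index i p = p - 1" if "i < p" for i using that by (simp add: omit_index_def)
  have Ys: "omit i Xs \<in> arg_lists S p" if "i < Suc p" for i
    using Xs that by (rule arg_lists_omit)
  have X: "Xs ! i \<in> mcarrier S" if "i < Suc p" for i
    using Xs that by (rule arg_lists_nth)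
  have anchor: "delta S FN p f (anchor_term i c) Xs x = symbol_term i f c Xs x" if i: "i < p" for i
  proof -
    have "anchor_term i (delta S FN (p - 1) f c) Xs = (\<lambda>x. 0)"
      using a_scale[OF X F_const, of i 0 0] i c0[OF f Ys] by (simp add: anchor_term_def)
    then show ?thesis
      using delta_anchor_term[OF Xs _ _ _ f ca, of i p] i idx[OF i] by simp
  qed
  have anchor_last: "delta S FN p f (anchor_term p c) Xs x = 0"
    using Xs f ca by (simp add: delta_anchor_term_same)
  have bracket: "delta S FN p f (bracket_term i j (binary_operator b) c) Xs x = 0" if ij: "i < j" "j < p" for i j
  proof -
    have "(omit i Xs)[j - 1 := binary_operator b [Xs ! i, Xs ! j]] \<in> arg_lists S p"
      using ij by (intro arg_lists_update Ys binary_operator_closed arg_lists_pair X) auto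
    then show ?thesis
      using delta_bracket_term_other[OF Xs, of i j p f] ij idx c0[OF f] by (simp add: bracket_term_def)
  qed
  have bracket_last: "delta S FN p f (bracket_term i p (binary_operator b) c) Xs x = symbol_term i f c Xs x"
    if i: "i < p" for i
  proof -
    let ?Ys = "omit i Xs"
    have b: "b (Xs ! i) (Xs ! p) \<in> mcarrier S" using X i by (simp add: b_closed)
    have af: "a (Xs ! i) f \<in> smooth_functions At" using X i f by (simp add: a_closed)
    have Y: "?Ys \<in> arg_lists S p" using Ys i by simp
    have order0: "c (?Ys[p - 1 := mscale S g Z]) = (\<lambda>x. g x * c (?Ys[p - 1 := Z]) x)"
      if "g \<in> smooth_functions At" "Z \<in> mcarrier S" for g Z
      using c0[OF that(1) arg_lists_update[OF Y that(2), of "p - 1"]] p arg_lists_length[OF Y]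
      by (simp add: delta_function_module fun_eq_iff)
    \<comment> \<open>After omission of i < p the last argument already stands in slot p - 1, so the
      summand \<rho>(X)(f) Y of the Leibniz rule yields c on the omitted list itself.\<close>
    have last: "?Ys[p - 1 := Xs ! p] = ?Ys"
      using nth_omit[of p i Xs] idx[OF i] i len by (metis lessI less_SucI less_not_refl list_update_id)
    have "c (?Ys[p - 1 := b (Xs ! i) (mscale S f (Xs ! p))]) =
        (\<lambda>x. f x * c (?Ys[p - 1 := b (Xs ! i) (Xs ! p)]) x + a (Xs ! i) f x * c ?Ys x)"
      using i p f b af X
      by (simp add: leibniz additive_madd[OF ca Y] mscale_closed order0[simplified] last[simplified])
    then show ?thesis
      using i len idx[OF i]
      by (simp add: delta_function_module bracket_term_def binary_operator_def symbol_term_def omit_update)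
  qed
  have "(\<Sum>i<p + 1. (-1) ^ i * delta S FN p f (anchor_term i c) Xs x) =
      (\<Sum>i<p. (-1) ^ i * symbol_term i f c Xs x)"
    by (simp add: anchor anchor_last)
  moreover have "(\<Sum>j<p + 1. \<Sum>i<j. (-1) ^ (i + 1) * delta S FN p f (bracket_term i j (binary_operator b) c) Xs x) =
      (\<Sum>i<p. (-1) ^ (i + 1) * symbol_term i f c Xs x)"
    by (simp add: bracket bracket_last)
  ultimately show "delta S FN p f (loday_terms p c) Xs x = 0"
    unfolding delta_loday_terms by (simp add: sum_negf)
qed

text \<open>Without arguments c has no last slot, but \<partial> c is then a single anchor term,
  linear over functions in its only argument.\<close>

lemma delta_loday_terms_0:
  assumes "multilinear S FN 0 c" "f \<in> smooth_functions At" "Xs \<in> arg_lists S (Suc 0)"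
  shows "delta S FN 0 f (loday_terms 0 c) Xs = (\<lambda>x. 0)"
proof
  fix x
  have "delta S FN 0 f (anchor_term 0 c) Xs = (\<lambda>x. 0)"
    using assms multilinear_imp_additive by (intro delta_anchor_term_same) auto
  then show "delta S FN 0 f (loday_terms 0 c) Xs x = 0"
    by (simp add: delta_loday_terms)
qed

end

section \<open>Calculus in finite-dimensional normed spaces\<close>

abbreviation fderiv :: "('a::real_normed_vector \<Rightarrow> 'b::real_normed_vector) \<Rightarrow> 'a \<Rightarrow> 'a \<Rightarrow> 'b" where
  "fderiv f x \<equiv> frechet_derivative f (at x)"

lemma has_derivative_fderiv: "f differentiable (at x) \<Longrightarrow> (f has_derivative fderiv f x) (at x)"
  by (simp add: frechet_derivative_works)

lemma fderiv_eqI: "(f has_derivative f') (at x) \<Longrightarrow> fderiv f x = f'"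
  by (rule frechet_derivative_at[symmetric])

lemma fderiv_cong_open:
  assumes "open S" "x \<in> S" "\<And>y. y \<in> S \<Longrightarrow> f y = g y" "f differentiable (at x)"
  shows "g differentiable (at x)" "fderiv g x = fderiv f x"
proof -
  have "(g has_derivative fderiv f x) (at x)"
    using has_derivative_fderiv[OF assms(4)] assms(1-3) by (rule has_derivative_transform_within_open)
  then show "g differentiable (at x)" "fderiv g x = fderiv f x"
    by (auto simp: differentiable_def dest: fderiv_eqI)
qed

section \<open>Stability properties of \<open>Ck_on\<close>\<close>

lemma Ck_on_imp_continuous_on: "Ck_on k S f \<Longrightarrow> continuous_on S f"
  by (cases k) (auto intro!: differentiable_imp_continuous_on differentiable_at_imp_differentiable_on)

lemma Ck_on_SucD: "Ck_on (Suc k) S f \<Longrightarrow> Ck_on k S f"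
proof (induction k arbitrary: f)
  case 0
  then show ?case using Ck_on_imp_continuous_on by fastforce
next
  case (Suc k)
  then show ?case by (metis Ck_on.simps(2))
qed

text \<open>Openness of S makes the equation hold near each point, so that the derivatives agree as
  well.\<close>

lemma Ck_on_cong: "open S \<Longrightarrow> (\<And>x. x \<in> S \<Longrightarrow> f x = g x) \<Longrightarrow> Ck_on k S f \<Longrightarrow> Ck_on k S g"
proof (induction k arbitrary: f g)
  case 0
  then show ?case by (auto intro: continuous_on_eq)
next
  case (Suc k)
  have d: "g differentiable (at x)" "fderiv g x = fderiv f x" if "x \<in> S" for x
    using fderiv_cong_open[OF Suc.prems(1) that Suc.prems(2)] Suc.prems(3) that by auto
  have "Ck_on k S (\<lambda>x. fderiv g x v)" for v
    by (rule Suc.IH[OF Suc.prems(1), of "\<lambda>x. fderiv f x v"]) (use d Suc.prems(3) in auto)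
  then show ?case using d by simp
qed

lemma Ck_on_subset: "T \<subseteq> S \<Longrightarrow> Ck_on k S f \<Longrightarrow> Ck_on k T f"
  by (induction k arbitrary: f) (auto intro: continuous_on_subset)

lemma Ck_on_local:
  assumes "\<And>x. x \<in> S \<Longrightarrow> \<exists>T. open T \<and> x \<in> T \<and> Ck_on k T f"
  shows "Ck_on k S f"
  using assms
proof (induction k arbitrary: f)
  case 0
  have "isCont f x" if "x \<in> S" for x
    using 0[OF that] by (auto simp: continuous_on_eq_continuous_at)
  then show ?case by (simp add: continuous_at_imp_continuous_on)
next
  case (Suc k)
  have "Ck_on k S (\<lambda>x. fderiv f x v)" for v
    using Suc.prems by (intro Suc.IH) (metis Ck_on.simps(2))
  moreover have "f differentiable (at x)" if "x \<in> S" for x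
    using Suc.prems[OF that] by auto
  ultimately show ?case by simp
qed

lemma Ck_on_const: "Ck_on k S (\<lambda>x. c)"
  by (induction k arbitrary: c) (simp_all add: frechet_derivative_const)

lemma Ck_on_add:
  "open S \<Longrightarrow> Ck_on k S f \<Longrightarrow> Ck_on k S g \<Longrightarrow> Ck_on k S (\<lambda>x. f x + g x)"
proof (induction k arbitrary: f g)
  case (Suc k)
  have d: "((\<lambda>x. f x + g x) has_derivative (\<lambda>v. fderiv f x v + fderiv g x v)) (at x)" if "x \<in> S" for x
    using Suc.prems that by (intro has_derivative_add has_derivative_fderiv) auto
  have "Ck_on k S (\<lambda>x. fderiv (\<lambda>x. f x + g x) x v)" for v
  proof (rule Ck_on_cong[OF Suc.prems(1)])
    show "Ck_on k S (\<lambda>x. fderiv f x v + fderiv g x v)"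
      using Suc.prems by (intro Suc.IH) auto
  qed (simp add: fderiv_eqI[OF d])
  then show ?case using d by (auto simp: differentiable_def)
qed (auto intro: continuous_on_add)

lemma Ck_on_sum:
  "open S \<Longrightarrow> (\<And>i. i \<in> A \<Longrightarrow> Ck_on k S (f i)) \<Longrightarrow> Ck_on k S (\<lambda>x. \<Sum>i\<in>A. f i x)"
  by (induction A rule: infinite_finite_induct) (simp_all add: Ck_on_const Ck_on_add)

text \<open>The product rule expresses directional derivatives by the same B, so the induction runs
  over all pairs f, g at once.\<close>

lemma Ck_on_bilinear:
  assumes "bounded_bilinear B"
  shows "open S \<Longrightarrow> Ck_on k S f \<Longrightarrow> Ck_on k S g \<Longrightarrow> Ck_on k S (\<lambda>x. B (f x) (g x))"
proof (induction k arbitrary: f g)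
  case 0
  then show ?case using bounded_bilinear.continuous_on[OF assms] by auto
next
  case (Suc k)
  have d: "((\<lambda>x. B (f x) (g x)) has_derivative (\<lambda>v. B (f x) (fderiv g x v) + B (fderiv f x v) (g x))) (at x)"
    if "x \<in> S" for x
    using Suc.prems that by (intro bounded_bilinear.FDERIV[OF assms] has_derivative_fderiv) auto
  have "Ck_on k S (\<lambda>x. fderiv (\<lambda>x. B (f x) (g x)) x v)" for v
  proof (rule Ck_on_cong[OF Suc.prems(1)])
    show "Ck_on k S (\<lambda>x. B (f x) (fderiv g x v) + B (fderiv f x v) (g x))"
      using Suc.prems Ck_on_SucD[OF Suc.prems(2)] Ck_on_SucD[OF Suc.prems(3)]
      by (intro Ck_on_add Suc.IH) auto
  qed (simp add: fderiv_eqI[OF d])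
  then show ?case using d by (auto simp: differentiable_def)
qed

lemmas Ck_on_scaleR = Ck_on_bilinear[OF bounded_bilinear_scaleR]
lemmas Ck_on_mult = Ck_on_bilinear[OF bounded_bilinear_mult]

lemma Ck_on_linear:
  assumes "bounded_linear L"
  shows "open S \<Longrightarrow> Ck_on k S f \<Longrightarrow> Ck_on k S (\<lambda>x. L (f x))"
proof (induction k arbitrary: f)
  case 0
  then show ?case using bounded_linear.continuous_on[OF assms] by auto
next
  case (Suc k)
  have d: "((\<lambda>x. L (f x)) has_derivative (\<lambda>v. L (fderiv f x v))) (at x)" if "x \<in> S" for x
    using Suc.prems that by (intro bounded_linear.has_derivative[OF assms] has_derivative_fderiv) auto
  have "Ck_on k S (\<lambda>x. fderiv (\<lambda>x. L (f x)) x v)" for v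
  proof (rule Ck_on_cong[OF Suc.prems(1)])
    show "Ck_on k S (\<lambda>x. L (fderiv f x v))"
      using Suc.prems by (intro Suc.IH) auto
  qed (simp add: fderiv_eqI[OF d])
  then show ?case using d by (auto simp: differentiable_def)
qed

lemma Ck_on_id: "Ck_on k S (\<lambda>x. x)"
  by (cases k) (simp_all add: frechet_derivative_ident Ck_on_const)

lemma Ck_on_Pair:
  assumes "open S" "Ck_on k S f" "Ck_on k S g"
  shows "Ck_on k S (\<lambda>x. (f x, g x))"
proof -
  have "bounded_linear (\<lambda>u. (u, 0 :: 'c))" "bounded_linear (\<lambda>v. (0 :: 'b, v))"
    by (simp_all add: bounded_linear_Pair bounded_linear_ident bounded_linear_zero)
  from Ck_on_add[OF assms(1) Ck_on_linear[OF this(1) assms(1,2)] Ck_on_linear[OF this(2) assms(1,3)]]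
  show ?thesis by simp
qed

text \<open>Spans of finite sets are complete because the coordinate along a vector outside a complete
  subspace is controlled by the positive distance of that vector to the subspace.\<close>

lemma coordinate_bound:
  fixes e :: "'a::real_normed_vector"
  assumes "closed V" "subspace V" "e \<notin> V" "w \<in> V"
  shows "\<bar>t\<bar> * infdist e V \<le> norm (t *\<^sub>R e + w)"
proof (cases "t = 0")
  case False
  have "(- (1 / t)) *\<^sub>R w \<in> V" using assms by (intro subspace_scale)
  then have "infdist e V \<le> dist e ((- (1 / t)) *\<^sub>R w)" by (rule infdist_le)
  also have "\<dots> = norm ((1 / t) *\<^sub>R (t *\<^sub>R e + w))"
    using False by (simp add: dist_norm algebra_simps)
  also have "\<dots> = norm (t *\<^sub>R e + w) / \<bar>t\<bar>" by simp
  finally show ?thesis using False by (simp add: field_simps)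
qed simp

lemma infdist_pos:
  fixes e :: "'a::real_normed_vector"
  assumes "closed V" "subspace V" "e \<notin> V"
  shows "infdist e V > 0"
proof -
  have "V \<noteq> {}" using subspace_0[OF assms(2)] by blast
  then show ?thesis
    using in_closed_iff_infdist_zero[OF assms(1), of e] infdist_nonneg[of e V] assms(3) by linarith
qed

lemma Cauchy_dist_le:
  fixes s :: "nat \<Rightarrow> 'a::metric_space" and u :: "nat \<Rightarrow> 'b::metric_space"
  assumes "Cauchy s" "\<And>m n. dist (u m) (u n) \<le> K * dist (s m) (s n)" "K > 0"
  shows "Cauchy u"
proof (rule metric_CauchyI)
  fix \<epsilon> :: real assume "\<epsilon> > 0"
  then have "\<epsilon> / K > 0" using assms(3) by simp
  then obtain M where M: "\<And>m n. m \<ge> M \<Longrightarrow> n \<ge> M \<Longrightarrow> dist (s m) (s n) < \<epsilon> / K"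
    using assms(1) metric_CauchyD by metis
  have "dist (u m) (u n) < \<epsilon>" if "m \<ge> M" "n \<ge> M" for m n
    using assms(2)[of m n] M[OF that] assms(3) by (simp add: field_simps)
  then show "\<exists>M. \<forall>m\<ge>M. \<forall>n\<ge>M. dist (u m) (u n) < \<epsilon>" by blast
qed

lemma complete_span_finite:
  fixes B :: "'a::real_normed_vector set"
  assumes "finite B"
  shows "complete (span B)"
  using assms
proof (induction B rule: finite_induct)
  case empty
  then show ?case by (simp add: compact_imp_complete)
next
  case (insert e B)
  show ?case
  proof (cases "e \<in> span B")
    case True
    then show ?thesis using insert by (simp add: span_redundant)
  next
    case False
    let ?d = "infdist e (span B)"
    have cl: "closed (span B)" using insert.IH by (rule complete_imp_closed)
    have d: "?d > 0" using infdist_pos[OF cl subspace_span False] .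
    show ?thesis
      unfolding complete_def
    proof (intro allI impI)
      fix s :: "nat \<Rightarrow> 'a" assume s: "(\<forall>n. s n \<in> span (insert e B)) \<and> Cauchy s"
      then have "\<forall>n. \<exists>t. s n - t *\<^sub>R e \<in> span B" by (simp add: span_insert)
      then obtain t where t: "\<And>n. s n - t n *\<^sub>R e \<in> span B" by metis
      \<comment> \<open>The distance of e to the span controls the coefficients along e, so these
        form a Cauchy sequence of reals.\<close>
      have le: "\<bar>t m - t n\<bar> * ?d \<le> dist (s m) (s n)" for m n
      proof -
        have "(s m - t m *\<^sub>R e) - (s n - t n *\<^sub>R e) \<in> span B" by (intro span_diff t)
        from coordinate_bound[OF cl subspace_span False this, of "t m - t n"]
        show ?thesis by (simp add: algebra_simps dist_norm)
      qed
      have "\<bar>t m - t n\<bar> \<le> 1 / ?d * dist (s m) (s n)" for m n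
        using le[of m n] d by (simp add: field_simps)
      then have "Cauchy t"
        using s d Cauchy_dist_le[of s t "1 / ?d"] by (simp add: dist_real_def)
      then obtain t0 where t0: "t \<longlonglongrightarrow> t0" using Cauchy_convergent convergent_def by metis
      \<comment> \<open>Removing the component along e enlarges distances at most by the factor 1 +
        norm e / d: the second summand is the bound on the coefficients times norm e.\<close>
      have dist_le: "dist (s m - t m *\<^sub>R e) (s n - t n *\<^sub>R e) \<le> (1 + norm e / ?d) * dist (s m) (s n)" for m n
      proof -
        have dist_le: "dist (s m - t m *\<^sub>R e) (s n - t n *\<^sub>R e) = norm ((s m - s n) - (t m - t n) *\<^sub>R e)"
          by (simp add: dist_norm algebra_simps)
        also have "\<dots> \<le> dist (s m) (s n) + \<bar>t m - t n\<bar> * norm e"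
          by (metis dist_norm norm_scaleR norm_triangle_ineq4)
        also have "\<bar>t m - t n\<bar> * norm e \<le> (dist (s m) (s n) / ?d) * norm e"
          using le[of m n] d by (intro mult_right_mono) (simp_all add: field_simps)
        finally show ?thesis by (simp add: algebra_simps)
      qed
      have "1 + norm e / ?d > 0" using d by (intro add_pos_nonneg) auto
      with dist_le have "Cauchy (\<lambda>n. s n - t n *\<^sub>R e)"
        using s Cauchy_dist_le[of s "\<lambda>n. s n - t n *\<^sub>R e" "1 + norm e / ?d"] by blast
      then obtain l where l: "l \<in> span B" "(\<lambda>n. s n - t n *\<^sub>R e) \<longlonglongrightarrow> l"
        using insert.IH[unfolded complete_def, rule_format, of "\<lambda>n. s n - t n *\<^sub>R e"] t by blast
      have "(\<lambda>n. (s n - t n *\<^sub>R e) + t n *\<^sub>R e) \<longlonglongrightarrow> l + t0 *\<^sub>R e"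
        by (intro tendsto_intros l t0)
      then have "s \<longlonglongrightarrow> l + t0 *\<^sub>R e" by simp
      moreover have "l + t0 *\<^sub>R e \<in> span (insert e B)"
        using l(1) unfolding span_insert by (auto intro: exI[of _ t0])
      ultimately show "\<exists>l\<in>span (insert e B). s \<longlonglongrightarrow> l" by blast
    qed
  qed
qed

text \<open>Choose a basis inside the finite spanning set. The coordinate along e is bounded by the
  reciprocal of the distance of e to the span of the other basis vectors, which is positive because
  that span is complete, hence closed.\<close>

lemma finite_dimensional_coordinates:
  assumes "finite_dimensional TYPE('a::real_normed_vector)"
  shows "\<exists>(B :: 'a::real_normed_vector set) (co :: 'a \<Rightarrow> 'a \<Rightarrow> real). finite B \<and>
    (\<forall>e\<in>B. bounded_linear (co e)) \<and> (\<forall>v. (\<Sum>e\<in>B. co e v *\<^sub>R e) = v)"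
proof -
  obtain A :: "'a set" where A: "finite A" "span A = UNIV"
    using assms unfolding finite_dimensional_def by blast
  obtain B where B: "B \<subseteq> A" "independent B" "A \<subseteq> span B"
    by (rule maximal_independent_subset)
  have fin: "finite B" using A(1) B(1) finite_subset by blast
  have span: "span B = UNIV" using A(2) B(3) span_mono span_span by (metis top.extremum_uniqueI)
  define co where "co e v = representation B v e" for e v
  have rep: "(\<Sum>e\<in>B. co e v *\<^sub>R e) = v" for v
    unfolding co_def using sum_representation_eq[OF B(2), of v B] span fin by simp
  have bl: "bounded_linear (co e)" if e: "e \<in> B" for e
  proof (rule bounded_linear_intro)
    let ?V = "span (B - {e})"
    show "co e (u + v) = co e u + co e v" for u v
      unfolding co_def using representation_add[OF B(2)] span by simp
    show "co e (r *\<^sub>R v) = r *\<^sub>R co e v" for r v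
      unfolding co_def using representation_scale[OF B(2)] span by simp
    have cl: "closed ?V" using fin by (intro complete_imp_closed complete_span_finite) simp
    have ne: "e \<notin> ?V" using B(2) e unfolding dependent_def by blast
    have d: "infdist e ?V > 0" using infdist_pos[OF cl subspace_span ne] .
    show "norm (co e v) \<le> norm v * (1 / infdist e ?V)" for v
    proof -
      have "(\<Sum>e'\<in>B - {e}. co e' v *\<^sub>R e') \<in> ?V"
        by (intro span_sum span_scale span_base)
      from coordinate_bound[OF cl subspace_span ne this, of "co e v"]
      have "\<bar>co e v\<bar> * infdist e ?V \<le> norm (\<Sum>e\<in>B. co e v *\<^sub>R e)"
        by (simp add: sum.remove[OF fin e])
      then have "\<bar>co e v\<bar> * infdist e ?V \<le> norm v" by (simp add: rep)
      then show ?thesis using d by (simp add: field_simps)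
    qed
  qed
  show ?thesis using fin bl rep by blast
qed

lemma fderiv_coordinates:
  assumes "f differentiable (at x)" "(\<Sum>e\<in>B. t e *\<^sub>R e) = v"
  shows "fderiv f x v = (\<Sum>e\<in>B. t e *\<^sub>R fderiv f x e)"
proof -
  have "linear (fderiv f x)" using assms(1) by (simp add: linear_frechet_derivative)
  then show ?thesis unfolding assms(2)[symmetric] by (simp add: linear_sum linear_scale)
qed

text \<open>The chain rule differentiates g in the direction \<open>fderiv f x v\<close>, which
  varies with x, while the hypothesis on g concerns fixed directions. Expansion of this direction in
  coordinates leaves products of scalar functions with derivatives of g in fixed directions, and the
  induction hypothesis applies to the latter.\<close>

lemma Ck_on_compose:
  fixes f :: "'a::real_normed_vector \<Rightarrow> 'b::real_normed_vector" and g :: "'b \<Rightarrow> 'c::real_normed_vector"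
  assumes fd: "finite_dimensional TYPE('b)"
  shows "open S \<Longrightarrow> open T \<Longrightarrow> f ` S \<subseteq> T \<Longrightarrow> Ck_on k S f \<Longrightarrow> Ck_on k T g \<Longrightarrow> Ck_on k S (\<lambda>x. g (f x))"
proof (induction k arbitrary: g)
  case 0
  then show ?case using continuous_on_compose2[of T g S f] by auto
next
  case (Suc k)
  obtain B :: "'b set" and co where B: "finite B" "\<And>e. e \<in> B \<Longrightarrow> bounded_linear (co e)"
      "\<And>v. (\<Sum>e\<in>B. co e v *\<^sub>R e) = v"
    using finite_dimensional_coordinates[OF fd] by blast
  have d: "((\<lambda>x. g (f x)) has_derivative (\<lambda>v. fderiv g (f x) (fderiv f x v))) (at x)" if "x \<in> S" for x
    using Suc.prems that by (intro has_derivative_compose[of f _ x UNIV g, simplified] has_derivative_fderiv) auto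
  have "Ck_on k S (\<lambda>x. fderiv (\<lambda>x. g (f x)) x v)" for v
  proof (rule Ck_on_cong[OF Suc.prems(1)])
    show "Ck_on k S (\<lambda>x. \<Sum>e\<in>B. co e (fderiv f x v) *\<^sub>R fderiv g (f x) e)"
      using Suc.prems Ck_on_SucD[OF Suc.prems(4)]
      by (intro Ck_on_sum Ck_on_scaleR Ck_on_linear[OF B(2)] Suc.IH) auto
    show "(\<Sum>e\<in>B. co e (fderiv f x v) *\<^sub>R fderiv g (f x) e) = fderiv (\<lambda>x. g (f x)) x v" if "x \<in> S" for x
    proof -
      have "g differentiable (at (f x))" using Suc.prems that by auto
      from fderiv_coordinates[OF this B(3)[of "fderiv f x v"]] show ?thesis
        by (simp add: fderiv_eqI[OF d[OF that]])
    qed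
  qed
  then show ?case using d by (auto simp: differentiable_def)
qed

text \<open>The expansion in coordinates again, now for the derivative of f along a vector field
  w.\<close>

lemma Ck_on_fderiv_along:
  fixes f :: "'a::real_normed_vector \<Rightarrow> 'b::real_normed_vector"
  assumes fd: "finite_dimensional TYPE('a)" and "open S" "Ck_on (Suc k) S f" "Ck_on k S w"
  shows "Ck_on k S (\<lambda>x. fderiv f x (w x))"
proof -
  obtain B :: "'a set" and co where B: "finite B" "\<And>e. e \<in> B \<Longrightarrow> bounded_linear (co e)"
      "\<And>v. (\<Sum>e\<in>B. co e v *\<^sub>R e) = v"
    using finite_dimensional_coordinates[OF fd] by blast
  show ?thesis
  proof (rule Ck_on_cong[OF assms(2)])
    show "Ck_on k S (\<lambda>x. \<Sum>e\<in>B. co e (w x) *\<^sub>R fderiv f x e)"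
      using assms by (intro Ck_on_sum Ck_on_scaleR Ck_on_linear[OF B(2)]) auto
    show "(\<Sum>e\<in>B. co e (w x) *\<^sub>R fderiv f x e) = fderiv f x (w x)" if "x \<in> S" for x
      using fderiv_coordinates[OF _ B(3)[of "w x"], of f x] assms(3) that by simp
  qed
qed

text \<open>Serves the composition rule for the local form of a bundle morphism, a function on chart
  domain times fibre.\<close>

lemma finite_dimensional_prod:
  assumes "finite_dimensional TYPE('a::real_normed_vector)" "finite_dimensional TYPE('b::real_normed_vector)"
  shows "finite_dimensional TYPE('a::real_normed_vector \<times> 'b::real_normed_vector)"
proof -
  obtain A :: "'a set" where A: "finite A" "span A = UNIV"
    using assms(1) unfolding finite_dimensional_def by blast
  obtain B :: "'b set" where B: "finite B" "span B = UNIV"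
    using assms(2) unfolding finite_dimensional_def by blast
  let ?C = "(\<lambda>u. (u, 0)) ` A \<union> (\<lambda>v. (0, v)) ` B"
  have l: "linear (\<lambda>u. (u, 0 :: 'b))" "linear (\<lambda>v. (0 :: 'a, v))"
    by (auto intro!: linearI)
  have "(u, v) \<in> span ?C" for u v
  proof -
    have "(u, 0) \<in> span ?C"
      using linear_span_image[OF l(1), of A] A(2) span_mono[of "(\<lambda>u. (u, 0)) ` A" ?C] by blast
    moreover have "(0, v) \<in> span ?C"
      using linear_span_image[OF l(2), of B] B(2) span_mono[of "(\<lambda>v. (0, v)) ` B" ?C] by blast
    ultimately have "(u, 0) + (0, v) \<in> span ?C" by (rule span_add)
    then show ?thesis by simp
  qed
  then have "span ?C = UNIV" by auto
  then show ?thesis unfolding finite_dimensional_def using A(1) B(1) by (metis finite_UnI finite_imageI)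
qed

section \<open>Sections and the anchor\<close>

lemma smooth_on_Ck: "smooth_on S f \<Longrightarrow> Ck_on k S f"
  by (simp add: smooth_on_def)

lemma smooth_on_differentiable: "smooth_on S f \<Longrightarrow> x \<in> S \<Longrightarrow> f differentiable (at x)"
  using smooth_on_Ck[of S f "Suc 0"] by simp

lemma smooth_on_subset: "smooth_on S f \<Longrightarrow> T \<subseteq> S \<Longrightarrow> smooth_on T f"
  by (auto simp: smooth_on_def intro: Ck_on_subset)

lemma smooth_on_cong: "open S \<Longrightarrow> smooth_on S f \<Longrightarrow> (\<And>x. x \<in> S \<Longrightarrow> f x = g x) \<Longrightarrow> smooth_on S g"
  unfolding smooth_on_def using Ck_on_cong[of S f g] by blast

lemma smooth_on_const: "smooth_on S (\<lambda>x. c)"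
  by (simp add: smooth_on_def Ck_on_const)

lemma smooth_on_add: "open S \<Longrightarrow> smooth_on S f \<Longrightarrow> smooth_on S g \<Longrightarrow> smooth_on S (\<lambda>x. f x + g x)"
  by (simp add: smooth_on_def Ck_on_add)

lemma smooth_on_mult:
  fixes f g :: "'a::real_normed_vector \<Rightarrow> real"
  shows "open S \<Longrightarrow> smooth_on S f \<Longrightarrow> smooth_on S g \<Longrightarrow> smooth_on S (\<lambda>x. f x * g x)"
  by (simp add: smooth_on_def Ck_on_mult)

lemma smooth_on_scaleR: "open S \<Longrightarrow> smooth_on S f \<Longrightarrow> smooth_on S g \<Longrightarrow> smooth_on S (\<lambda>x. f x *\<^sub>R g x)"
  by (simp add: smooth_on_def Ck_on_scaleR)

lemma smooth_on_Pair: "open S \<Longrightarrow> smooth_on S f \<Longrightarrow> smooth_on S g \<Longrightarrow> smooth_on S (\<lambda>x. (f x, g x))"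
  by (simp add: smooth_on_def Ck_on_Pair)

lemma smooth_on_id: "smooth_on S (\<lambda>x. x)"
  by (simp add: smooth_on_def Ck_on_id)

lemma smooth_on_compose:
  fixes f :: "'a::real_normed_vector \<Rightarrow> 'b::real_normed_vector"
  assumes "finite_dimensional TYPE('b)" "open S" "open T" "f ` S \<subseteq> T" "smooth_on S f" "smooth_on T g"
  shows "smooth_on S (\<lambda>x. g (f x))"
  unfolding smooth_on_def using assms by (auto intro: Ck_on_compose smooth_on_Ck)

lemma smooth_on_fderiv_along:
  fixes f :: "'a::real_normed_vector \<Rightarrow> 'b::real_normed_vector"
  assumes "finite_dimensional TYPE('a)" "open S" "smooth_on S f" "smooth_on S w"
  shows "smooth_on S (\<lambda>x. fderiv f x (w x))"
  unfolding smooth_on_def using assms by (auto intro: Ck_on_fderiv_along smooth_on_Ck simp del: Ck_on.simps)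

lemma smooth_on_local:
  assumes "\<And>x. x \<in> S \<Longrightarrow> \<exists>T. open T \<and> x \<in> T \<and> smooth_on T f"
  shows "smooth_on S f"
  unfolding smooth_on_def using assms by (intro allI Ck_on_local) (meson smooth_on_Ck)

lemma fibre_tangent_bundleD:
  assumes "w \<in> fibre (tangent_bundle At) x"
  shows "fst w = x"
    and "(U, \<phi>) \<in> At \<Longrightarrow> (V, \<psi>) \<in> At \<Longrightarrow> x \<in> U \<Longrightarrow> x \<in> V \<Longrightarrow>
      snd w (V, \<psi>) = fderiv (\<psi> \<circ> inv_into U \<phi>) (\<phi> x) (snd w (U, \<phi>))"
proof -
  obtain v where w: "w = (x, v)" and all: "\<forall>(U, \<phi>)\<in>At. \<forall>(V, \<psi>)\<in>At. x \<in> U \<inter> V \<longrightarrow>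
      v (V, \<psi>) = fderiv (\<psi> \<circ> inv_into U \<phi>) (\<phi> x) (v (U, \<phi>))"
    using assms by (auto simp: fibre_def tangent_bundle_def)
  show "fst w = x" using w by simp
  show "snd w (V, \<psi>) = fderiv (\<psi> \<circ> inv_into U \<phi>) (\<phi> x) (snd w (U, \<phi>))"
    if "(U, \<phi>) \<in> At" "(V, \<psi>) \<in> At" "x \<in> U" "x \<in> V"
    using bspec[OF bspec[OF all that(1), unfolded split_conv] that(2), unfolded split_conv] that(3,4) w by simp
qed

lemma section_module_simps:
  "mcarrier (section_module At E) = sections At E"
  "mzero (section_module At E) = vzero E"
  "madd (section_module At E) X Y = (\<lambda>x. vadd E (X x) (Y x))"
  "mscale (section_module At E) f X = (\<lambda>x. vscale E (f x) (X x))"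
  by (simp_all add: section_module_def)

section \<open>Charts, trivializations and sections\<close>

locale manifold_bundle =
  fixes At :: "('m::{t2_space, second_countable_topology}, 'b::real_normed_vector) chart set"
    and E :: "('m, 'e, 'f::real_normed_vector) vbundle"
  assumes is_manifold: "smooth_manifold At" and is_bundle: "vector_bundle At E"
begin

lemma fin_dim: "finite_dimensional TYPE('b)" "finite_dimensional TYPE('f)"
  using is_manifold is_bundle by (auto simp: smooth_manifold_def vector_bundle_def)

lemma chart_cover: "\<exists>U \<phi>. (U, \<phi>) \<in> At \<and> x \<in> U"
proof -
  have "x \<in> (\<Union>(U, \<phi>)\<in>At. U)"
    unfolding is_manifold[unfolded smooth_manifold_def, THEN conjunct2, THEN conjunct1] by simp
  then show ?thesis by auto
qed

lemma chart:
  assumes "(U, \<phi>) \<in> At"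
  shows "open U" "open (\<phi> ` U)" "homeomorphism U (\<phi> ` U) \<phi> (inv_into U \<phi>)"
  using assms is_manifold unfolding smooth_manifold_def by auto

lemma chart_change:
  assumes "(U, \<phi>) \<in> At" "(V, \<psi>) \<in> At"
  shows "smooth_on (\<phi> ` (U \<inter> V)) (\<psi> \<circ> inv_into U \<phi>)"
proof -
  have "\<forall>(U, \<phi>)\<in>At. \<forall>(V, \<psi>)\<in>At. smooth_on (\<phi> ` (U \<inter> V)) (\<psi> \<circ> inv_into U \<phi>)"
    using is_manifold unfolding smooth_manifold_def by blast
  then show ?thesis using assms by blast
qed

lemma chart_inv: "(U, \<phi>) \<in> At \<Longrightarrow> x \<in> U \<Longrightarrow> inv_into U \<phi> (\<phi> x) = x"
  using chart(3) by (simp add: homeomorphism_def)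

text \<open>Charts are homeomorphisms onto open sets. Local forms of sections live on images of this
  kind, and the rules for smooth maps ask for open domains.\<close>

lemma chart_image_open:
  assumes "(U, \<phi>) \<in> At" "open V"
  shows "open (\<phi> ` (U \<inter> V))"
proof -
  have "openin (top_of_set U) (U \<inter> V)" using assms(2) by (rule openin_open_Int)
  then have "openin (top_of_set (\<phi> ` U)) (\<phi> ` (U \<inter> V))"
    using homeomorphism_imp_open_map[OF chart(3)[OF assms(1)]] by blast
  then show ?thesis using chart(2)[OF assms(1)] openin_open_trans by blast
qed

lemma triv_cover: "\<exists>U \<Phi>. (U, \<Phi>) \<in> trivs E \<and> x \<in> U"
proof -
  have "(\<Union>(U, \<Phi>)\<in>trivs E. U) = UNIV"
    using is_bundle unfolding vector_bundle_def by (elim conjE)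
  then have "x \<in> (\<Union>(U, \<Phi>)\<in>trivs E. U)" by simp
  then show ?thesis by auto
qed

lemma triv:
  assumes "(U, \<Phi>) \<in> trivs E"
  shows "open U"
    and "x \<in> U \<Longrightarrow> bij_betw \<Phi> (fibre E x) UNIV"
    and "x \<in> U \<Longrightarrow> \<Phi> (vzero E x) = 0"
    and "x \<in> U \<Longrightarrow> u \<in> fibre E x \<Longrightarrow> v \<in> fibre E x \<Longrightarrow> \<Phi> (vadd E u v) = \<Phi> u + \<Phi> v"
    and "x \<in> U \<Longrightarrow> u \<in> fibre E x \<Longrightarrow> \<Phi> (vscale E r u) = r *\<^sub>R \<Phi> u"
proof -
  have *: "\<forall>(U, \<Phi>)\<in>trivs E. open U \<and>
        (\<forall>x\<in>U. bij_betw \<Phi> (fibre E x) UNIV \<and>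
           \<Phi> (vzero E x) = 0 \<and>
           (\<forall>u\<in>fibre E x. \<forall>v\<in>fibre E x. \<Phi> (vadd E u v) = \<Phi> u + \<Phi> v) \<and>
           (\<forall>r. \<forall>u\<in>fibre E x. \<Phi> (vscale E r u) = r *\<^sub>R \<Phi> u))"
    using is_bundle unfolding vector_bundle_def by blast
  then have **: "open U \<and>
        (\<forall>x\<in>U. bij_betw \<Phi> (fibre E x) UNIV \<and>
           \<Phi> (vzero E x) = 0 \<and>
           (\<forall>u\<in>fibre E x. \<forall>v\<in>fibre E x. \<Phi> (vadd E u v) = \<Phi> u + \<Phi> v) \<and>
           (\<forall>r. \<forall>u\<in>fibre E x. \<Phi> (vscale E r u) = r *\<^sub>R \<Phi> u))"
    using assms by blast
  from ** show "open U" by blast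
  from ** show "x \<in> U \<Longrightarrow> bij_betw \<Phi> (fibre E x) UNIV" by blast
  from ** show "x \<in> U \<Longrightarrow> \<Phi> (vzero E x) = 0" by blast
  from ** show "x \<in> U \<Longrightarrow> u \<in> fibre E x \<Longrightarrow> v \<in> fibre E x \<Longrightarrow> \<Phi> (vadd E u v) = \<Phi> u + \<Phi> v" by blast
  from ** show "x \<in> U \<Longrightarrow> u \<in> fibre E x \<Longrightarrow> \<Phi> (vscale E r u) = r *\<^sub>R \<Phi> u" by blast
qed

lemma fibre_closed:
  "vzero E x \<in> fibre E x"
  "u \<in> fibre E x \<Longrightarrow> v \<in> fibre E x \<Longrightarrow> vadd E u v \<in> fibre E x"
  "u \<in> fibre E x \<Longrightarrow> vscale E r u \<in> fibre E x"
  using is_bundle unfolding vector_bundle_def by auto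

text \<open>The axioms state no algebraic laws for fibres; these are verified after applying a
  trivialization, which is injective on the fibre.\<close>

lemma fibre_eqI:
  assumes "u \<in> fibre E x" "v \<in> fibre E x"
    and "\<And>U \<Phi>. (U, \<Phi>) \<in> trivs E \<Longrightarrow> x \<in> U \<Longrightarrow> \<Phi> u = \<Phi> v"
  shows "u = v"
proof -
  obtain U \<Phi> where t: "(U, \<Phi>) \<in> trivs E" "x \<in> U" using triv_cover by blast
  have "inj_on \<Phi> (fibre E x)" using triv(2)[OF t] by (simp add: bij_betw_def)
  then show ?thesis using assms(3)[OF t] assms(1,2) by (simp add: inj_on_def)
qed

lemma smooth_functionsD: "f \<in> smooth_functions At \<Longrightarrow> (U, \<phi>) \<in> At \<Longrightarrow> smooth_on (\<phi> ` U) (\<lambda>y. f (inv_into U \<phi> y))"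
  by (auto simp: smooth_functions_def o_def)

lemma smooth_functionsI:
  "(\<And>U \<phi>. (U, \<phi>) \<in> At \<Longrightarrow> smooth_on (\<phi> ` U) (\<lambda>y. f (inv_into U \<phi> y))) \<Longrightarrow> f \<in> smooth_functions At"
  by (auto simp: smooth_functions_def o_def)

lemma smooth_function_differentiable:
  "f \<in> smooth_functions At \<Longrightarrow> (U, \<phi>) \<in> At \<Longrightarrow> x \<in> U \<Longrightarrow> (\<lambda>y. f (inv_into U \<phi> y)) differentiable (at (\<phi> x))"
  using smooth_on_differentiable[OF smooth_functionsD] by blast

lemma sectionsD:
  assumes "X \<in> sections At E"
  shows "X x \<in> fibre E x"
    and "(W, \<phi>) \<in> At \<Longrightarrow> (U, \<Phi>) \<in> trivs E \<Longrightarrow> smooth_on (\<phi> ` (W \<inter> U)) (\<lambda>y. \<Phi> (X (inv_into W \<phi> y)))"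
  using assms by (auto simp: sections_def)

lemma sectionsI:
  assumes "\<And>x. X x \<in> fibre E x"
    and "\<And>W \<phi> U \<Phi>. (W, \<phi>) \<in> At \<Longrightarrow> (U, \<Phi>) \<in> trivs E \<Longrightarrow> smooth_on (\<phi> ` (W \<inter> U)) (\<lambda>y. \<Phi> (X (inv_into W \<phi> y)))"
  shows "X \<in> sections At E"
  using assms by (auto simp: sections_def)

lemma sections_vadd:
  assumes "X \<in> sections At E" "Y \<in> sections At E"
  shows "(\<lambda>x. vadd E (X x) (Y x)) \<in> sections At E"
proof (rule sectionsI)
  fix W \<phi> U \<Phi> assume c: "(W, \<phi>) \<in> At" and t: "(U, \<Phi>) \<in> trivs E"
  have op: "open (\<phi> ` (W \<inter> U))" using chart_image_open[OF c triv(1)[OF t]] .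
  have "smooth_on (\<phi> ` (W \<inter> U)) (\<lambda>y. \<Phi> (X (inv_into W \<phi> y)) + \<Phi> (Y (inv_into W \<phi> y)))"
    using op assms c t by (intro smooth_on_add sectionsD)
  then show "smooth_on (\<phi> ` (W \<inter> U)) (\<lambda>y. \<Phi> (vadd E (X (inv_into W \<phi> y)) (Y (inv_into W \<phi> y))))"
    by (rule smooth_on_cong[OF op])
      (use assms c in \<open>auto simp: chart_inv triv(4)[OF t] sectionsD(1)\<close>)
qed (use assms in \<open>simp add: fibre_closed sectionsD\<close>)

lemma sections_vscale:
  assumes "X \<in> sections At E" "f \<in> smooth_functions At"
  shows "(\<lambda>x. vscale E (f x) (X x)) \<in> sections At E"
proof (rule sectionsI)
  fix W \<phi> U \<Phi> assume c: "(W, \<phi>) \<in> At" and t: "(U, \<Phi>) \<in> trivs E"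
  have op: "open (\<phi> ` (W \<inter> U))" using chart_image_open[OF c triv(1)[OF t]] .
  have "smooth_on (\<phi> ` (W \<inter> U)) (\<lambda>y. f (inv_into W \<phi> y) *\<^sub>R \<Phi> (X (inv_into W \<phi> y)))"
    using op assms c t
    by (intro smooth_on_scaleR sectionsD smooth_on_subset[OF smooth_functionsD[OF assms(2) c]]) auto
  then show "smooth_on (\<phi> ` (W \<inter> U)) (\<lambda>y. \<Phi> (vscale E (f (inv_into W \<phi> y)) (X (inv_into W \<phi> y))))"
    by (rule smooth_on_cong[OF op])
      (use assms c in \<open>auto simp: chart_inv triv(5)[OF t] sectionsD(1)\<close>)
qed (use assms in \<open>simp add: fibre_closed sectionsD\<close>)

lemma sections_vzero: "vzero E \<in> sections At E"
proof (rule sectionsI)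
  fix W \<phi> U \<Phi> assume c: "(W, \<phi>) \<in> At" and t: "(U, \<Phi>) \<in> trivs E"
  have op: "open (\<phi> ` (W \<inter> U))" using chart_image_open[OF c triv(1)[OF t]] .
  show "smooth_on (\<phi> ` (W \<inter> U)) (\<lambda>y. \<Phi> (vzero E (inv_into W \<phi> y)))"
    by (rule smooth_on_cong[OF op smooth_on_const[where c = 0]])
      (use c in \<open>auto simp: chart_inv triv(3)[OF t]\<close>)
qed (simp add: fibre_closed)

lemma smooth_functions_const: "(\<lambda>x. r) \<in> smooth_functions At"
  by (simp add: smooth_functionsI smooth_on_const)

lemma smooth_functions_add:
  "f \<in> smooth_functions At \<Longrightarrow> g \<in> smooth_functions At \<Longrightarrow> (\<lambda>x. f x + g x) \<in> smooth_functions At"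
  by (rule smooth_functionsI) (intro smooth_on_add smooth_functionsD chart)

lemma smooth_functions_mult:
  "f \<in> smooth_functions At \<Longrightarrow> g \<in> smooth_functions At \<Longrightarrow> (\<lambda>x. f x * g x) \<in> smooth_functions At"
  by (rule smooth_functionsI) (intro smooth_on_mult smooth_functionsD chart)

text \<open>The definition picks some chart at x. The chain rule for the coordinate change matches
  the transformation law of tangent vectors, so every chart at x gives the same value.\<close>

lemma tangent_apply_chart:
  assumes w: "w \<in> fibre (tangent_bundle At) x" and f: "f \<in> smooth_functions At"
    and c: "(V, \<psi>) \<in> At" "x \<in> V"
  shows "tangent_apply At w f = fderiv (\<lambda>y. f (inv_into V \<psi> y)) (\<psi> x) (snd w (V, \<psi>))"
proof -
  obtain U \<phi> where U: "(SOME c. c \<in> At \<and> x \<in> fst c) = (U, \<phi>)" by fastforce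
  have "\<exists>c. c \<in> At \<and> x \<in> fst c" using c by auto
  from someI_ex[OF this] have U': "(U, \<phi>) \<in> At" "x \<in> U" unfolding U by auto
  have ta: "tangent_apply At w f = fderiv (f \<circ> inv_into U \<phi>) (\<phi> x) (snd w (U, \<phi>))"
    using fibre_tangent_bundleD(1)[OF w] U by (simp add: tangent_apply_def split_beta)
  let ?t = "\<psi> \<circ> inv_into U \<phi>" and ?f = "\<lambda>y. f (inv_into V \<psi> y)"
  have x: "\<phi> x \<in> \<phi> ` (U \<inter> V)" using U' c by blast
  have tx: "?t (\<phi> x) = \<psi> x" using U' by (simp add: chart_inv)
  have dt: "(?t has_derivative fderiv ?t (\<phi> x)) (at (\<phi> x))"
    using smooth_on_differentiable[OF chart_change[OF U'(1) c(1)] x] by (rule has_derivative_fderiv)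
  have df: "(?f has_derivative fderiv ?f (\<psi> x)) (at (?t (\<phi> x)))"
    unfolding tx using smooth_function_differentiable[OF f c] by (rule has_derivative_fderiv)
  have "((\<lambda>y. ?f (?t y)) has_derivative (\<lambda>v. fderiv ?f (\<psi> x) (fderiv ?t (\<phi> x) v))) (at (\<phi> x))"
    using has_derivative_compose[OF dt df] .
  \<comment> \<open>The two local forms of f are compared on the image of U \<inter> V, an open
    neighbourhood of the point, which is enough for derivatives.\<close>
  then have "((f \<circ> inv_into U \<phi>) has_derivative (\<lambda>v. fderiv ?f (\<psi> x) (fderiv ?t (\<phi> x) v))) (at (\<phi> x))"
    by (rule has_derivative_transform_within_open[OF _ chart_image_open[OF U'(1) chart(1)[OF c(1)]] x])
      (use U' c in \<open>auto simp: chart_inv\<close>)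
  from fderiv_eqI[OF this] show ?thesis
    unfolding ta using fibre_tangent_bundleD(2)[OF w U'(1) c(1) U'(2) c(2)] by simp
qed

end

section \<open>The derivations defined by the anchor\<close>

locale anchored_bundle = manifold_bundle At E
  for At :: "('m::{t2_space, second_countable_topology}, 'b::real_normed_vector) chart set"
    and E :: "('m, 'e, 'f::real_normed_vector) vbundle" +
  fixes \<rho> :: "'e \<Rightarrow> ('m, 'b) tvector"
  assumes morphism: "bundle_morphism At E (tangent_bundle At) \<rho>"
begin

lemma \<rho>_fibre: "u \<in> fibre E x \<Longrightarrow> \<rho> u \<in> fibre (tangent_bundle At) x"
  using morphism by (simp add: bundle_morphism_def)

lemma \<rho>_vadd: "u \<in> fibre E x \<Longrightarrow> v \<in> fibre E x \<Longrightarrow> snd (\<rho> (vadd E u v)) c = snd (\<rho> u) c + snd (\<rho> v) c"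
  using morphism by (auto simp: bundle_morphism_def tangent_bundle_def split_beta)

lemma \<rho>_vscale: "u \<in> fibre E x \<Longrightarrow> snd (\<rho> (vscale E r u)) c = r *\<^sub>R snd (\<rho> u) c"
  using morphism by (auto simp: bundle_morphism_def tangent_bundle_def split_beta)

lemma anchor_action_chart:
  assumes "X \<in> sections At E" "f \<in> smooth_functions At" "(U, \<phi>) \<in> At" "x \<in> U"
  shows "anchor_action At \<rho> X f x = fderiv (\<lambda>y. f (inv_into U \<phi> y)) (\<phi> x) (snd (\<rho> (X x)) (U, \<phi>))"
  unfolding anchor_action_def using assms by (intro tangent_apply_chart \<rho>_fibre sectionsD(1))

text \<open>Over a trivializing set the coordinates of \<rho>(X) are the local form of \<rho>
  composed with the graph of the local form of X, hence smooth; \<rho>(X)(f) is the derivative of f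
  along this vector field. Smoothness is tested near each point because a trivialization need not
  cover the chart.\<close>

lemma anchor_action_smooth:
  assumes X: "X \<in> sections At E" and f: "f \<in> smooth_functions At"
  shows "anchor_action At \<rho> X f \<in> smooth_functions At"
proof (rule smooth_functionsI, rule smooth_on_local)
  fix W \<phi> y assume c: "(W, \<phi>) \<in> At" and y: "y \<in> \<phi> ` W"
  obtain U \<Phi> where t: "(U, \<Phi>) \<in> trivs E" "inv_into W \<phi> y \<in> U" using triv_cover by blast
  let ?S = "\<phi> ` (W \<inter> U)"
  have op: "open ?S" using chart_image_open[OF c triv(1)[OF t(1)]] .
  have "y \<in> ?S" using y t(2) c by (auto simp: chart_inv)
  let ?G = "\<lambda>(y, v). snd (\<rho> (inv_into (fibre E (inv_into W \<phi> y)) \<Phi> v)) (W, \<phi>)"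
  let ?w = "\<lambda>y. snd (\<rho> (X (inv_into W \<phi> y))) (W, \<phi>)"
  \<comment> \<open>Each chart of the base provides the trivialization of the tangent bundle that
    reads off the coordinate vector in this chart.\<close>
  have T: "(W, \<lambda>(x, v). v (W, \<phi>)) \<in> trivs (tangent_bundle At)"
    using c by (auto simp: tangent_bundle_def intro!: image_eqI[of _ _ "(W, \<phi>)"])
  have all: "\<forall>(W, \<phi>)\<in>At. \<forall>(U, \<Phi>)\<in>trivs E. \<forall>(V, \<Psi>)\<in>trivs (tangent_bundle At).
      smooth_on (\<phi> ` (W \<inter> U \<inter> V) \<times> UNIV)
        (\<lambda>(y, v). \<Psi> (\<rho> (inv_into (fibre E (inv_into W \<phi> y)) \<Phi> v)))"
    using morphism unfolding bundle_morphism_def by (elim conjE)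
  have "smooth_on (\<phi> ` (W \<inter> U \<inter> W) \<times> UNIV)
      (\<lambda>(y, v). (\<lambda>(x, v). v (W, \<phi>)) (\<rho> (inv_into (fibre E (inv_into W \<phi> y)) \<Phi> v)))"
    using bspec[OF bspec[OF bspec[OF all c, unfolded split_conv] t(1), unfolded split_conv] T, unfolded split_conv] .
  moreover have "W \<inter> U \<inter> W = W \<inter> U" by blast
  ultimately have G: "smooth_on (?S \<times> UNIV) ?G" by (simp add: split_beta)
  have pair: "smooth_on ?S (\<lambda>y. (y, \<Phi> (X (inv_into W \<phi> y))))"
    by (rule smooth_on_Pair[OF op smooth_on_id sectionsD(2)[OF X c t(1)]])
  have "smooth_on ?S (\<lambda>y. ?G (y, \<Phi> (X (inv_into W \<phi> y))))"
    by (rule smooth_on_compose[OF finite_dimensional_prod[OF fin_dim] op open_Times[OF op open_UNIV] _ pair G]) auto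
  then have w: "smooth_on ?S ?w"
  proof (rule smooth_on_cong[OF op])
    fix y assume "y \<in> ?S"
    then have "inv_into W \<phi> y \<in> U" using c by (auto simp: chart_inv)
    then have "inv_into (fibre E (inv_into W \<phi> y)) \<Phi> (\<Phi> (X (inv_into W \<phi> y))) = X (inv_into W \<phi> y)"
      using triv(2)[OF t(1)] sectionsD(1)[OF X] by (intro inv_into_f_f) (auto simp: bij_betw_def)
    then show "?G (y, \<Phi> (X (inv_into W \<phi> y))) = ?w y" by simp
  qed
  have "smooth_on ?S (\<lambda>y. fderiv (\<lambda>y. f (inv_into W \<phi> y)) y (?w y))"
    by (intro smooth_on_fderiv_along fin_dim op w smooth_on_subset[OF smooth_functionsD[OF f c]]) auto
  then have "smooth_on ?S (\<lambda>y. anchor_action At \<rho> X f (inv_into W \<phi> y))"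
  proof (rule smooth_on_cong[OF op])
    fix y assume "y \<in> ?S"
    then have "inv_into W \<phi> y \<in> W" "\<phi> (inv_into W \<phi> y) = y" using c by (auto simp: chart_inv)
    then show "fderiv (\<lambda>y. f (inv_into W \<phi> y)) y (?w y) = anchor_action At \<rho> X f (inv_into W \<phi> y)"
      using anchor_action_chart[OF X f c] by simp
  qed
  with op \<open>y \<in> ?S\<close> show "\<exists>T. open T \<and> y \<in> T \<and> smooth_on T (\<lambda>y. anchor_action At \<rho> X f (inv_into W \<phi> y))"
    by blast
qed

lemma anchor_action_add:
  assumes X: "X \<in> sections At E" and f: "f \<in> smooth_functions At" and g: "g \<in> smooth_functions At"
  shows "anchor_action At \<rho> X (\<lambda>x. f x + g x) = (\<lambda>x. anchor_action At \<rho> X f x + anchor_action At \<rho> X g x)"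
proof
  fix x
  obtain U \<phi> where c: "(U, \<phi>) \<in> At" "x \<in> U" using chart_cover by blast
  have "((\<lambda>y. f (inv_into U \<phi> y) + g (inv_into U \<phi> y)) has_derivative
      (\<lambda>v. fderiv (\<lambda>y. f (inv_into U \<phi> y)) (\<phi> x) v + fderiv (\<lambda>y. g (inv_into U \<phi> y)) (\<phi> x) v)) (at (\<phi> x))"
    using f g c by (intro has_derivative_add has_derivative_fderiv smooth_function_differentiable)
  from fderiv_eqI[OF this] show "anchor_action At \<rho> X (\<lambda>x. f x + g x) x = anchor_action At \<rho> X f x + anchor_action At \<rho> X g x"
    using X f g c by (simp add: anchor_action_chart[OF _ _ c] smooth_functions_add)
qed

lemma anchor_action_mult:
  assumes X: "X \<in> sections At E" and f: "f \<in> smooth_functions At" and g: "g \<in> smooth_functions At"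
  shows "anchor_action At \<rho> X (\<lambda>x. f x * g x) =
    (\<lambda>x. anchor_action At \<rho> X f x * g x + f x * anchor_action At \<rho> X g x)"
proof
  fix x
  obtain U \<phi> where c: "(U, \<phi>) \<in> At" "x \<in> U" using chart_cover by blast
  have "((\<lambda>y. f (inv_into U \<phi> y) * g (inv_into U \<phi> y)) has_derivative
      (\<lambda>v. f (inv_into U \<phi> (\<phi> x)) * fderiv (\<lambda>y. g (inv_into U \<phi> y)) (\<phi> x) v +
        fderiv (\<lambda>y. f (inv_into U \<phi> y)) (\<phi> x) v * g (inv_into U \<phi> (\<phi> x)))) (at (\<phi> x))"
    using f g c by (intro has_derivative_mult has_derivative_fderiv smooth_function_differentiable)
  from fderiv_eqI[OF this] show "anchor_action At \<rho> X (\<lambda>x. f x * g x) x =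
      anchor_action At \<rho> X f x * g x + f x * anchor_action At \<rho> X g x"
    using X f g c by (simp add: anchor_action_chart[OF _ _ c] smooth_functions_mult chart_inv)
qed

lemma anchor_action_const:
  assumes X: "X \<in> sections At E"
  shows "anchor_action At \<rho> X (\<lambda>x. r) = (\<lambda>x. 0)"
proof
  fix x
  obtain U \<phi> where c: "(U, \<phi>) \<in> At" "x \<in> U" using chart_cover by blast
  show "anchor_action At \<rho> X (\<lambda>x. r) x = 0"
    using X c by (simp add: anchor_action_chart[OF _ _ c] smooth_functions_const)
qed

lemma anchor_action_vadd:
  assumes "X \<in> sections At E" "Y \<in> sections At E" "f \<in> smooth_functions At"
  shows "anchor_action At \<rho> (\<lambda>x. vadd E (X x) (Y x)) f =
    (\<lambda>x. anchor_action At \<rho> X f x + anchor_action At \<rho> Y f x)"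
proof
  fix x
  obtain U \<phi> where c: "(U, \<phi>) \<in> At" "x \<in> U" using chart_cover by blast
  have "linear (fderiv (\<lambda>y. f (inv_into U \<phi> y)) (\<phi> x))"
    using assms c by (intro linear_frechet_derivative smooth_function_differentiable)
  then show "anchor_action At \<rho> (\<lambda>x. vadd E (X x) (Y x)) f x =
      anchor_action At \<rho> X f x + anchor_action At \<rho> Y f x"
    using assms by (simp add: anchor_action_chart[OF _ _ c] sections_vadd \<rho>_vadd[of _ x] sectionsD linear_add)
qed

lemma anchor_action_vscale:
  assumes "X \<in> sections At E" "f \<in> smooth_functions At" "g \<in> smooth_functions At"
  shows "anchor_action At \<rho> (\<lambda>x. vscale E (f x) (X x)) g = (\<lambda>x. f x * anchor_action At \<rho> X g x)"
proof
  fix x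
  obtain U \<phi> where c: "(U, \<phi>) \<in> At" "x \<in> U" using chart_cover by blast
  have "linear (fderiv (\<lambda>y. g (inv_into U \<phi> y)) (\<phi> x))"
    using assms c by (intro linear_frechet_derivative smooth_function_differentiable)
  then show "anchor_action At \<rho> (\<lambda>x. vscale E (f x) (X x)) g x = f x * anchor_action At \<rho> X g x"
    using assms by (simp add: anchor_action_chart[OF _ _ c] sections_vscale \<rho>_vscale[of _ x] sectionsD linear_scale)
qed

text \<open>The module laws for sections are pointwise identities in the fibres, obtained through
  \<open>fibre_eqI\<close>.\<close>

lemma loday_module:
  assumes "multilinear (section_module At E) (section_module At E) 2 (binary_operator br)"
  shows "loday_module At (section_module At E) (anchor_action At \<rho>) br"
proof (unfold_locales, unfold section_module_simps)
  show "br X Y \<in> sections At E" if "X \<in> sections At E" "Y \<in> sections At E" for X Y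
  proof -
    have "[X, Y] \<in> arg_lists (section_module At E) 2"
      using that by (simp add: arg_lists_def section_module_simps)
    then have "binary_operator br [X, Y] \<in> sections At E"
      using assms unfolding multilinear_def section_module_simps by blast
    then show ?thesis by (simp add: binary_operator_def)
  qed
  \<comment> \<open>The Leibniz rule with a constant factor, whose derivative is zero.\<close>
  show "anchor_action At \<rho> X (\<lambda>x. r * f x) = (\<lambda>x. r * anchor_action At \<rho> X f x)"
    if "X \<in> sections At E" "f \<in> smooth_functions At" for X f r
    using anchor_action_mult[OF that(1) smooth_functions_const that(2)] that(1)
    by (simp add: anchor_action_const)
  have "vadd E (vzero E x) (vzero E x) = vzero E x" for x
    by (rule fibre_eqI[of _ x]) (auto simp: fibre_closed triv)
  then show "(\<lambda>x. vadd E (vzero E x) (vzero E x)) = vzero E" by (rule ext)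
  have "vscale E r (vadd E u v) = vadd E (vscale E r u) (vscale E r v)"
    if "u \<in> fibre E x" "v \<in> fibre E x" for x r u v
    using that by (intro fibre_eqI[of _ x]) (auto simp: fibre_closed triv(4,5)[where x = x] scaleR_add_right)
  then show "(\<lambda>x. vscale E (f x) (vadd E (X x) (Y x))) = (\<lambda>x. vadd E (vscale E (f x) (X x)) (vscale E (f x) (Y x)))"
    if "X \<in> sections At E" "Y \<in> sections At E" for X Y f
    using sectionsD(1)[OF that(1)] sectionsD(1)[OF that(2)] by blast
  have "vadd E (vadd E u (vscale E (- 1) v)) v = u" if "u \<in> fibre E x" "v \<in> fibre E x" for x u v
    using that by (intro fibre_eqI[of _ x]) (auto simp: fibre_closed triv(4,5)[where x = x])
  then show "(\<lambda>x. vadd E (mdiff (section_module At E) X Y x) (Y x)) = X"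
    if "X \<in> sections At E" "Y \<in> sections At E" for X Y
    using sectionsD(1)[OF that(1)] sectionsD(1)[OF that(2)]
    unfolding mdiff_def section_module_simps by blast
qed (simp_all add: smooth_functions_const smooth_functions_add smooth_functions_mult anchor_action_add
    anchor_action_mult anchor_action_smooth anchor_action_vadd anchor_action_vscale
    sections_vadd sections_vscale sections_vzero assms)

end

section \<open>The Loday operator\<close>

locale faint_algebroid = anchored_bundle At E \<rho>
  for At :: "('m::{t2_space, second_countable_topology}, 'b::real_normed_vector) chart set"
    and E :: "('m, 'e, 'f::real_normed_vector) vbundle" and \<rho> +
  fixes br :: "('m \<Rightarrow> 'e) \<Rightarrow> ('m \<Rightarrow> 'e) \<Rightarrow> ('m \<Rightarrow> 'e)"
  assumes bracket: "multidifferential At (section_module At E) (section_module At E) 2 (binary_operator br)"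
begin

abbreviation "SM \<equiv> section_module At E"

sublocale loday_module At SM "anchor_action At \<rho>" br
  using bracket by (intro loday_module) (simp add: multidifferential_def)

abbreviation "lod \<equiv> loday At E br \<rho>"
abbreviation "loday_list \<equiv> loday_rec (anchor_action At \<rho>) br"

section \<open>Passage to normalized operators\<close>

lemma loday_outside: "Xs \<notin> arg_lists SM (Suc p) \<Longrightarrow> lod p c Xs = (\<lambda>x. 0)"
  by (simp add: loday_def fun_eq_iff)

lemma loday_eq_terms: "Xs \<in> arg_lists SM (Suc p) \<Longrightarrow> lod p c Xs = loday_terms p c Xs"
  by (simp add: loday_def fun_eq_iff loday_terms_eq)

lemma loday_eq_rec: "Xs \<in> arg_lists SM (Suc p) \<Longrightarrow> lod p c Xs = loday_list c Xs"
  by (simp add: loday_def fun_eq_iff loday_rec_eq arg_lists_length)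

text \<open>Only lists of p sections are ever fed to the operand. It may therefore be exchanged for
  one that differs elsewhere, such as the recursive shuffle product for the normalized one.\<close>

lemma loday_cong:
  assumes "\<And>Ys. Ys \<in> arg_lists SM p \<Longrightarrow> c Ys = d Ys"
  shows "lod p c = lod p d"
proof
  fix Xs show "lod p c Xs = lod p d Xs"
  proof (cases "Xs \<in> arg_lists SM (Suc p)")
    case True
    have "Ys \<in> arg_lists SM (Suc p) \<Longrightarrow> i < Suc p \<Longrightarrow> c (omit i Ys) = d (omit i Ys)" for i Ys
      by (simp add: assms arg_lists_omit)
    moreover have "Xs[j := br (Xs ! i) (Xs ! j)] \<in> arg_lists SM (Suc p)" if "j < Suc p" "i < j" for i j
      using that by (intro arg_lists_update[OF True] b_closed arg_lists_nth[OF True]) auto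
    ultimately show ?thesis
      using True by (intro ext) (simp add: loday_def del: sum.lessThan_Suc)
  qed (simp add: loday_outside)
qed

lemma DopD:
  assumes "c \<in> Dop At E p"
  shows "multidifferential At SM FN p c" "multilinear SM FN p c"
    and "Xs \<notin> arg_lists SM p \<Longrightarrow> c Xs = (\<lambda>x. 0)"
    and "length Xs \<noteq> p \<Longrightarrow> c Xs = (\<lambda>x. 0)"
  using assms by (auto simp: Dop_def multidifferential_def arg_lists_def)

text \<open>The normalization by zero extends c to lists of all lengths with smooth values, as a
  cochain demands.\<close>

lemma cochain_Dop:
  assumes "c \<in> Dop At E p"
  shows "cochain c"
  unfolding cochain_def
proof (intro allI impI)
  fix Ys
  show "c Ys \<in> smooth_functions At"
  proof (cases "Ys \<in> arg_lists SM p")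
    case True
    then show ?thesis using additiveD(1)[OF multilinear_imp_additive] DopD(2)[OF assms] by blast
  next
    case False
    then show ?thesis using DopD(3)[OF assms] by (simp add: F_const)
  qed
qed

lemma loday_Dop:
  assumes "c \<in> Dop At E p"
  shows "lod p c \<in> Dop At E (Suc p)"
proof -
  have m: "multidifferential At SM FN (Suc p) (loday_terms p c)"
    using DopD(1)[OF assms] bracket by (rule multidifferential_loday_terms)
  then obtain k where k: "\<And>i. i < Suc p \<Longrightarrow> fun_order_less (Suc p) {i} (Suc k) (loday_terms p c)"
    and ml: "multilinear SM FN (Suc p) (loday_terms p c)"
    unfolding multidifferential_def order_le_iff by blast
  have "fun_order_less (Suc p) {i} (Suc k) (lod p c)" if "i < Suc p" for i
    by (rule order_less_cong[OF _ _ k[OF that]]) (use that in \<open>auto simp: loday_eq_terms\<close>)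
  moreover have "multilinear SM FN (Suc p) (lod p c)"
    by (rule multilinear_cong[OF _ ml]) (simp add: loday_eq_terms)
  ultimately have "multidifferential At SM FN (Suc p) (lod p c)"
    unfolding multidifferential_def order_le_iff by blast
  then show ?thesis by (simp add: Dop_def loday_outside)
qed

lemma loday_linear:
  assumes c: "c \<in> Dop At E p" and d: "d \<in> Dop At E p"
  shows "lod p (op_add (op_scale r c) (op_scale s d)) = op_add (op_scale r (lod p c)) (op_scale s (lod p d))"
proof (intro ext)
  fix Xs x
  show "lod p (op_add (op_scale r c) (op_scale s d)) Xs x =
      op_add (op_scale r (lod p c)) (op_scale s (lod p d)) Xs x"
  proof (cases "Xs \<in> arg_lists SM (Suc p)")
    case True
    then have V: "set Xs \<subseteq> mcarrier SM" by (simp add: arg_lists_def)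
    note cd = cochain_Dop[OF c] cochain_Dop[OF d]
    have "loday_list (\<lambda>Ys x. r * c Ys x + s * d Ys x) Xs x =
        loday_list (\<lambda>Ys x. r * c Ys x) Xs x + loday_list (\<lambda>Ys x. s * d Ys x) Xs x"
      \<comment> \<open>A constant factor is a special case of a factor that depends on the number
        of arguments.\<close>
      using cochain_scale[OF cd(1), of "\<lambda>n. r"] cochain_scale[OF cd(2), of "\<lambda>n. s"] V
      by (rule loday_rec_add)
    also have "\<dots> = r * loday_list c Xs x + s * loday_list d Xs x"
      using loday_rec_scale[OF cd(1) V, of "\<lambda>n. r"] loday_rec_scale[OF cd(2) V, of "\<lambda>n. s"] by simp
    finally show ?thesis
      unfolding loday_eq_rec[OF True] op_add_def op_scale_def .
  qed (simp add: loday_outside op_add_def op_scale_def)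
qed

text \<open>\<open>loday_rec\<close> knows no arity. Off length p + 1 it involves only values of c
  off length p, which are zero by normalization, and the anchor sends zero to zero.\<close>

lemma loday_rec_Dop:
  assumes c: "c \<in> Dop At E p" and Ys: "set Ys \<subseteq> mcarrier SM"
  shows "loday_list c Ys = lod p c Ys"
proof (cases "length Ys = Suc p")
  case True
  then show ?thesis using Ys by (simp add: loday_eq_rec arg_lists_def)
next
  case False
  have "c (omit i Zs) = (\<lambda>x. 0)" if "i < length Ys" "length Zs = length Ys" for i Zs
    using that False by (intro DopD(4)[OF c]) (auto simp: length_omit)
  moreover have "anchor_action At \<rho> (Ys ! i) (\<lambda>x. 0) = (\<lambda>x. 0)" if "i < length Ys" for i
    using that Ys by (intro anchor_action_const) (auto simp: section_module_simps)
  moreover have "Ys \<notin> arg_lists SM (Suc p)" using False by (simp add: arg_lists_def)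
  ultimately show ?thesis by (intro ext) (simp add: loday_rec_eq loday_outside)
qed

lemma shuffle_product_eq_rec:
  assumes "\<And>Ys. length Ys \<noteq> p \<Longrightarrow> l Ys = (\<lambda>x. 0)" "\<And>Ys. length Ys \<noteq> q \<Longrightarrow> l' Ys = (\<lambda>x. 0)"
    and "Xs \<in> arg_lists SM (p + q)"
  shows "shuffle_product At E p q l l' Xs = shuffle_rec l l' Xs"
  using assms shuffle_rec_eq_shuffle_sum[OF assms(1,2), where Xs = Xs]
  by (simp add: shuffle_product_def shuffle_sum_def arg_lists_length fun_eq_iff)

text \<open>All products are replaced by recursive ones and \<partial> by \<open>loday_rec\<close>,
  for which the rule is known.\<close>

lemma loday_shuffle_product:
  assumes l: "l \<in> Dop At E p" and l': "l' \<in> Dop At E q"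
  shows "lod (p + q) (shuffle_product At E p q l l') =
    op_add (shuffle_product At E (Suc p) q (lod p l) l')
      (op_scale ((-1) ^ p) (shuffle_product At E p (Suc q) l (lod q l')))"
proof (intro ext)
  fix Xs x
  show "lod (p + q) (shuffle_product At E p q l l') Xs x =
    op_add (shuffle_product At E (Suc p) q (lod p l) l')
      (op_scale ((-1) ^ p) (shuffle_product At E p (Suc q) l (lod q l'))) Xs x"
  proof (cases "Xs \<in> arg_lists SM (Suc (p + q))")
    case True
    then have V: "set Xs \<subseteq> mcarrier SM" by (simp add: arg_lists_def)
    \<comment> \<open>l vanishes on lists of length other than p, so the twist is the factor (-1)^p
      of the graded Leibniz rule.\<close>
    have s: "(\<lambda>Ys x. (-1) ^ length Ys * l Ys x) = (\<lambda>Ys x. (-1) ^ p * l Ys x + 0 * l Ys x)"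
      using DopD(4)[OF l] by (fastforce simp: fun_eq_iff)
    have "lod (p + q) (shuffle_product At E p q l l') Xs x = lod (p + q) (shuffle_rec l l') Xs x"
      using DopD(4)[OF l] DopD(4)[OF l'] by (subst loday_cong) (auto intro: shuffle_product_eq_rec)
    also have "\<dots> = shuffle_rec (loday_list l) l' Xs x +
        shuffle_rec (\<lambda>Ys x. (-1) ^ length Ys * l Ys x) (loday_list l') Xs x"
      unfolding loday_eq_rec[OF True] using cochain_Dop[OF l] cochain_Dop[OF l'] V
      by (rule loday_rec_shuffle_rec)
    also have "shuffle_rec (loday_list l) l' Xs = shuffle_rec (lod p l) l' Xs"
      using V by (intro shuffle_rec_cong[where V = "mcarrier SM"]) (simp_all add: loday_rec_Dop[OF l])
    also have "\<dots> = shuffle_product At E (Suc p) q (lod p l) l' Xs"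
      using True DopD(4)[OF loday_Dop[OF l]] DopD(4)[OF l']
      by (intro shuffle_product_eq_rec[symmetric]) auto
    also have "shuffle_rec (\<lambda>Ys x. (-1) ^ length Ys * l Ys x) (loday_list l') Xs x =
        (-1) ^ p * shuffle_rec l (loday_list l') Xs x"
      unfolding s shuffle_rec_linear_left by simp
    also have "shuffle_rec l (loday_list l') Xs = shuffle_rec l (lod q l') Xs"
      using V by (intro shuffle_rec_cong[where V = "mcarrier SM"]) (simp_all add: loday_rec_Dop[OF l'])
    also have "\<dots> = shuffle_product At E p (Suc q) l (lod q l') Xs"
      using True DopD(4)[OF loday_Dop[OF l']] DopD(4)[OF l]
      by (intro shuffle_product_eq_rec[symmetric]) auto
    finally show ?thesis by (simp add: op_add_def op_scale_def)
  qed (simp add: loday_outside op_add_def op_scale_def shuffle_product_def)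
qed

lemma order_less_last:
  assumes "\<And>f Xs. f \<in> smooth_functions At \<Longrightarrow> Xs \<in> arg_lists SM (Suc p) \<Longrightarrow>
      delta SM FN p f (loday_terms p c) Xs = (\<lambda>x. 0)"
  shows "fun_order_less (Suc p) {p} (Suc 0) (lod p c)"
proof (rule order_less_cong)
  show "fun_order_less (Suc p) {p} (Suc 0) (loday_terms p c)"
    using assms by (simp add: function_module_simps)
qed (simp_all add: loday_eq_terms)

text \<open>In strict bounds, order 0 in the last variable is the bound 1 and total order at most p
  - 1 is the bound p. For p = 0 no condition is imposed on c, whence the separate case.\<close>

lemma loday_reduced_Dop:
  assumes br: "pseudoalgebra_bracket At E br \<rho>" and c: "c \<in> reduced_Dop At E p"
  shows "lod p c \<in> reduced_Dop At E (Suc p)"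
proof -
  have cD: "c \<in> Dop At E p" using c by (simp add: reduced_Dop_def)
  have cm: "multilinear SM FN p c" using DopD(2)[OF cD] .
  have B: "order_less At SM SM 2 {..<2} 2 (binary_operator br)"
    using br unfolding pseudoalgebra_bracket_def total_order_le_iff by (simp add: numeral_2_eq_2)
  have "fun_order_less (Suc p) {p} (Suc 0) (lod p c) \<and> fun_order_less (Suc p) {..<Suc p} (Suc p) (lod p c)"
  proof (cases p)
    case 0
    have "fun_order_less (Suc p) {p} (Suc 0) (lod p c)"
      using delta_loday_terms_0 cm unfolding 0 by (intro order_less_last) auto
    \<comment> \<open>With a single argument the last variable is the only one, so both conditions
      coincide.\<close>
    moreover have "{p} = {..<Suc p}" using 0 by auto
    ultimately show ?thesis using 0 by metis
  next
    case (Suc q)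
    have c': "fun_order_less p {p - 1} (Suc 0) c" "fun_order_less p {..<p} p c"
      using c Suc unfolding reduced_Dop_def order_le_iff total_order_le_iff
      by (auto simp del: order_less.simps)
    have "fun_order_less (Suc p) {p} (Suc 0) (lod p c)"
    proof (rule order_less_last, rule delta_last_loday_terms[OF cm])
      show "p > 0" using Suc by simp
      show "delta SM FN (p - 1) f c Xs = (\<lambda>x. 0)"
        if "f \<in> smooth_functions At" "Xs \<in> arg_lists SM p" for f Xs
        using c'(1) that by (simp add: function_module_simps)
      show "br X (mscale SM f Y) = madd SM (mscale SM f (br X Y)) (mscale SM (anchor_action At \<rho> X f) Y)"
        if "X \<in> mcarrier SM" "Y \<in> mcarrier SM" "f \<in> smooth_functions At" for X Y f
        using br that unfolding pseudoalgebra_bracket_def section_module_simps(1) by blast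
    qed
    moreover have "fun_order_less (Suc p) {..<Suc p} (Suc p) (lod p c)"
      by (rule order_less_cong[OF _ _ total_order_loday_terms[OF cm c'(2) B]]) (simp_all add: loday_eq_terms)
    ultimately show ?thesis by blast
  qed
  then show ?thesis
    using loday_Dop[OF cD] by (simp add: reduced_Dop_def order_le_iff total_order_le_iff del: order_less.simps)
qed

text \<open>Keeps the support finite: nonzero components of the image lie one degree above nonzero
  components of c.\<close>

lemma loday_zero: "lod p (\<lambda>Xs x. 0) = (\<lambda>Xs x. 0)"
proof
  fix Xs
  show "lod p (\<lambda>Xs x. 0) Xs = (\<lambda>x. 0)"
  proof (cases "Xs \<in> arg_lists SM (Suc p)")
    case True
    have "anchor_action At \<rho> (Xs ! i) (\<lambda>x. 0) = (\<lambda>x. 0)" if "i < Suc p" for i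
      using arg_lists_nth[OF True that] by (simp add: anchor_action_const section_module_simps)
    then show ?thesis by (intro ext) (simp add: loday_def del: sum.lessThan_Suc)
  qed (simp add: loday_outside)
qed

lemma zero_Dop: "(\<lambda>Xs x. 0) \<in> Dop At E 0"
  by (simp add: Dop_def multidifferential_def multilinear_zero)

lemma loday_sum_reduced:
  assumes br: "pseudoalgebra_bracket At E br \<rho>" and c: "c \<in> direct_sum (reduced_Dop At E)"
  shows "loday_sum At E br \<rho> c \<in> direct_sum (reduced_Dop At E)"
proof -
  have "loday_sum At E br \<rho> c n \<in> reduced_Dop At E n" for n
  proof (cases n)
    case 0
    then show ?thesis by (simp add: loday_sum_def reduced_Dop_def zero_Dop)
  next
    case (Suc p)
    then show ?thesis using loday_reduced_Dop[OF br] c by (simp add: loday_sum_def direct_sum_def)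
  qed
  moreover have "{n. loday_sum At E br \<rho> c n \<noteq> (\<lambda>Xs x. 0)} \<subseteq> Suc ` {p. c p \<noteq> (\<lambda>Xs x. 0)}"
  proof
    fix n assume n: "n \<in> {n. loday_sum At E br \<rho> c n \<noteq> (\<lambda>Xs x. 0)}"
    then obtain p where p: "n = Suc p" by (cases n) (auto simp: loday_sum_def)
    with n have "c p \<noteq> (\<lambda>Xs x. 0)" using loday_zero[of p] by (auto simp: loday_sum_def)
    with p show "n \<in> Suc ` {p. c p \<noteq> (\<lambda>Xs x. 0)}" by simp
  qed
  then have "finite {n. loday_sum At E br \<rho> c n \<noteq> (\<lambda>Xs x. 0)}"
    using c by (elim finite_subset) (simp add: direct_sum_def)
  ultimately show ?thesis by (simp add: direct_sum_def)
qed

end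

theorem theorem8p3:
  fixes At :: "('m::{t2_space, second_countable_topology}, 'b::real_normed_vector) chart set"
    and E :: "('m, 'e, 'f::real_normed_vector) vbundle"
    and br :: "('m \<Rightarrow> 'e) \<Rightarrow> ('m \<Rightarrow> 'e) \<Rightarrow> ('m \<Rightarrow> 'e)"
    and \<rho> :: "'e \<Rightarrow> ('m, 'b) tvector"
  assumes "smooth_manifold At"
    and "vector_bundle At E"
    and "anchored_faint_algebroid At E br \<rho>"
  shows
    "(\<forall>p. \<forall>c\<in>Dop At E p. loday At E br \<rho> p c \<in> Dop At E (p + 1)) \<and>
     (\<forall>p. \<forall>c\<in>Dop At E p. \<forall>d\<in>Dop At E p. \<forall>r s :: real.
        loday At E br \<rho> p (op_add (op_scale r c) (op_scale s d)) =
        op_add (op_scale r (loday At E br \<rho> p c)) (op_scale s (loday At E br \<rho> p d))) \<and>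
     (\<forall>p q. \<forall>l\<in>Dop At E p. \<forall>l'\<in>Dop At E q.
        loday At E br \<rho> (p + q) (shuffle_product At E p q l l') =
        op_add (shuffle_product At E (p + 1) q (loday At E br \<rho> p l) l')
          (op_scale ((-1) ^ p) (shuffle_product At E p (q + 1) l (loday At E br \<rho> q l')))) \<and>
     (pseudoalgebra_bracket At E br \<rho> \<longrightarrow>
        (\<forall>c\<in>direct_sum (reduced_Dop At E).
           loday_sum At E br \<rho> c \<in> direct_sum (reduced_Dop At E)))"
proof -
  interpret faint_algebroid At E \<rho> br
    using assms by unfold_locales (simp_all add: anchored_faint_algebroid_def)
  show ?thesis
    using loday_Dop loday_linear loday_shuffle_product loday_sum_reduced by simp
qed

end
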